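(* Let $\Omega\subsetneq\mathbb{R}^2$ be a domain. Then: (i) if $x,y\in\Omega$ satisfy $d_Q(x,y)<\pi$, then there is only one quasihyperbolic geodesic between $x$ and $y$; (ii) if $\Omega$ is simply connected, then for all $x,y\in\Omega$ there is only one quasihyperbolic geodesic between $x$ and $y$.
   Context: For a domain $\Omega\subsetneq\mathbb{R}^2$, let $d(z,\partial\Omega)$ be the Euclidean distance from $z$ to $\partial\Omega$. The quasihyperbolic length of a rectifiable curve $\gamma\subset\Omega$ is $l_Q(\gamma)=\int_\gamma \frac{|dz|}{d(z,\partial\Omega)}$, and the quasihyperbolic metric is $d_Q(x,y)=\inf l_Q(\gamma)$, the infimum being over all rectifiable curves in $\Omega$ joining $x$ and $y$. A quasihyperbolic geodesic between $x$ and $y$ is a rectifiable curve in $\Omega$ joining $x$ and $y$ with $l_Q(\gamma)=d_Q(x,y)$; geodesics differing only by parametrization are identified. *)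

theory Defs
  imports "HOL-Analysis.Analysis"
begin

text \<open>
  Curves are paths in the sense of the library: continuous maps on \<open>{0..1}\<close>.
\<close>

definition polygonal_lengths :: "(real \<Rightarrow> 'a::metric_space) \<Rightarrow> real \<Rightarrow> real \<Rightarrow> real set" where
  "polygonal_lengths \<gamma> a b =
     {(\<Sum>i<n. dist (\<gamma> (t i)) (\<gamma> (t (Suc i)))) | (n::nat) (t::nat \<Rightarrow> real).
        mono_on {..n} t \<and> t ` {..n} \<subseteq> {a..b}}"

definition rectifiable_path :: "(real \<Rightarrow> 'a::metric_space) \<Rightarrow> bool" where
  "rectifiable_path \<gamma> \<longleftrightarrow> path \<gamma> \<and> bdd_above (polygonal_lengths \<gamma> 0 1)"

text \<open>
  Length of the restriction of \<open>\<gamma>\<close> to \<open>{a..b}\<close>; as a real supremum it is meaningful only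
  for rectifiable \<open>\<gamma>\<close> and \<open>0 \<le> a \<le> b \<le> 1\<close>.
\<close>

definition arc_length :: "(real \<Rightarrow> 'a::metric_space) \<Rightarrow> real \<Rightarrow> real \<Rightarrow> real" where
  "arc_length \<gamma> a b = Sup (polygonal_lengths \<gamma> a b)"

text \<open>
  The arc length parametrization, on \<open>{0..arc_length \<gamma> 0 1}\<close>. For rectifiable \<open>\<gamma>\<close> the map
  \<open>t \<mapsto> arc_length \<gamma> 0 t\<close> is continuous and nondecreasing, so a parameter \<open>t\<close> as below exists,
  and \<open>\<gamma>\<close> is constant on the interval of all such \<open>t\<close>, so the choice does not matter.
\<close>

definition arc_length_param :: "(real \<Rightarrow> 'a::metric_space) \<Rightarrow> real \<Rightarrow> 'a" where
  "arc_length_param \<gamma> s = \<gamma> (SOME t. t \<in> {0..1} \<and> arc_length \<gamma> 0 t = s)"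

text \<open>The line integral of \<open>\<rho>\<close> along a rectifiable curve with respect to arc length \<open>|dz|\<close>.\<close>

definition arc_length_integral :: "(real \<Rightarrow> 'a::metric_space) \<Rightarrow> ('a \<Rightarrow> real) \<Rightarrow> real" where
  "arc_length_integral \<gamma> \<rho> =
     integral {0..arc_length \<gamma> 0 1} (\<lambda>s. \<rho> (arc_length_param \<gamma> s))"

definition qh_length :: "'a::metric_space set \<Rightarrow> (real \<Rightarrow> 'a) \<Rightarrow> real" where
  "qh_length \<Omega> \<gamma> = arc_length_integral \<gamma> (\<lambda>z. 1 / infdist z (frontier \<Omega>))"

definition rectifiable_joining ::
    "'a::metric_space set \<Rightarrow> 'a \<Rightarrow> 'a \<Rightarrow> (real \<Rightarrow> 'a) \<Rightarrow> bool" where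
  "rectifiable_joining \<Omega> x y \<gamma> \<longleftrightarrow>
     rectifiable_path \<gamma> \<and> path_image \<gamma> \<subseteq> \<Omega> \<and> pathstart \<gamma> = x \<and> pathfinish \<gamma> = y"

definition qh_dist :: "'a::metric_space set \<Rightarrow> 'a \<Rightarrow> 'a \<Rightarrow> real" where
  "qh_dist \<Omega> x y = Inf {qh_length \<Omega> \<gamma> | \<gamma>. rectifiable_joining \<Omega> x y \<gamma>}"

definition qh_geodesic :: "'a::metric_space set \<Rightarrow> 'a \<Rightarrow> 'a \<Rightarrow> (real \<Rightarrow> 'a) \<Rightarrow> bool" where
  "qh_geodesic \<Omega> x y \<gamma> \<longleftrightarrow>
     rectifiable_joining \<Omega> x y \<gamma> \<and> qh_length \<Omega> \<gamma> = qh_dist \<Omega> x y"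

text \<open>
  Changes of parameter are only required to be nondecreasing, so that a path may pause on
  subintervals. Hence neither of two parametrizations of one curve need factor through the
  other, and both are compared with a third one.
\<close>

definition parameter_change :: "(real \<Rightarrow> real) \<Rightarrow> bool" where
  "parameter_change \<phi> \<longleftrightarrow>
     continuous_on {0..1} \<phi> \<and> mono_on {0..1} \<phi> \<and> \<phi> 0 = 0 \<and> \<phi> 1 = 1"

definition same_up_to_parametrization ::
    "(real \<Rightarrow> 'a::topological_space) \<Rightarrow> (real \<Rightarrow> 'a) \<Rightarrow> bool" where
  "same_up_to_parametrization \<gamma> \<eta> \<longleftrightarrow>
     (\<exists>\<kappa> \<phi> \<psi>. path \<kappa> \<and> parameter_change \<phi> \<and> parameter_change \<psi> \<and>
        (\<forall>t\<in>{0..1}. \<gamma> t = \<kappa> (\<phi> t) \<and> \<eta> t = \<kappa> (\<psi> t)))"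

definition unique_qh_geodesic :: "'a::metric_space set \<Rightarrow> 'a \<Rightarrow> 'a \<Rightarrow> bool" where
  "unique_qh_geodesic \<Omega> x y \<longleftrightarrow>
     (\<exists>\<gamma>. qh_geodesic \<Omega> x y \<gamma> \<and>
        (\<forall>\<eta>. qh_geodesic \<Omega> x y \<eta> \<longrightarrow> same_up_to_parametrization \<gamma> \<eta>))"

end

theory Submission
  imports Defs "HOL-Complex_Analysis.Complex_Analysis"
begin

text \<open>
  The density \<open>1 / d(z)\<close> is the supremum of the densities \<open>1 / |z - p|\<close> over the boundary points
  \<open>p\<close>, so its logarithm is a supremum of harmonic functions and the quasihyperbolic metric has
  nonpositive curvature. Two distinct geodesics with common endpoints contain two arcs \<open>\<gamma>\<close> and \<open>\<eta>\<close>
  that meet only at their ends and form a Jordan curve. If its interior contained a point \<open>p\<close>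
  outside the domain, the curve would wind around \<open>p\<close> and have length at least \<open>2 \<pi>\<close> already
  for the density \<open>1 / |z - p|\<close>; this is impossible if the domain is simply connected or the
  distance of the endpoints is below \<open>\<pi>\<close>.

  Otherwise the logarithm of the density has a harmonic majorant in the interior with the same
  boundary values. It is the logarithm of \<open>|G'|\<close> for a holomorphic function \<open>G\<close>, so the flat metric
  \<open>|G'| |dz|\<close> dominates the quasihyperbolic metric in the interior, while \<open>G\<close> does not increase
  lengths along the two arcs. Let \<open>f\<close> be a nonconstant real linear function of \<open>G\<close> with equal values
  at the two common endpoints, with the sign chosen such that its maximum is larger. Close to the
  maximum, a level line of \<open>f\<close> through the interior is a straight segment for \<open>G\<close> that joins two points
  of the same arc. Since that arc is minimizing, it must be straight as well, that is, \<open>f\<close> is constant on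
  a nondegenerate piece of it. This cannot happen for uncountably many levels.
\<close>

section \<open>Curves of at most unit quasihyperbolic speed\<close>

text \<open>Geodesics are a priori only Lipschitz, and the Jordan domain between them has no smooth
  boundary, so no derivatives along the arcs are at hand. Lengths are therefore encoded by the
  two-point estimate \<open>qcurve\<close>, an integrated form of the lower bound
  \<open>ln (1 + |x - y| / d x)\<close> for the quasihyperbolic distance; it is stable under limits
  and concatenation. For the same reason the Dirichlet problem is solved only approximately, on
  neighbourhoods of the closed Jordan domain: there the approximants of \<open>G\<close> are
  holomorphic across the curve, their Lipschitz bounds along the arcs can be read off, and these
  bounds pass to the limit. \<open>G\<close> may fail to be injective, so straight lines are lifted
  from an interior point instead of being pulled back by an inverse, and the two ends of a lift
  could lie on different arcs. Levels near the maximum exclude this, since the maximum is attained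
  away from the common endpoints, where the arcs are disjoint. The bound \<open>pi\<close> arises
  because both arcs have the same length, so each carries half of \<open>2 * pi\<close>.\<close>

text \<open>The increments of \<open>h\<close> telescope, so the estimate with error rate
  \<open>e\<close> passes from two adjacent intervals to their union; a short interval around
  \<open>s\<close> is split at \<open>s\<close>. Bisection then reaches \<open>{a..b}\<close>, and
  \<open>e\<close> tends to 0. This serves as a mean value inequality for curves not known to be
  differentiable.\<close>

lemma dist_le_of_locally_le:
  fixes g :: "real \<Rightarrow> 'a::metric_space"
  assumes "a \<le> b" and mono: "mono_on {a..b} h"
    and loc: "\<And>s e. s \<in> {a..b} \<Longrightarrow> e > 0 \<Longrightarrow>
       \<forall>\<^sub>F t in at s within {a..b}. dist (g t) (g s) \<le> \<bar>h t - h s\<bar> + e * \<bar>t - s\<bar>"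
  shows "dist (g a) (g b) \<le> h b - h a"
proof -
  have *: "dist (g a) (g b) \<le> h b - h a + e * (b - a)" if e: "e > 0" for e
  proof -
    define P where "P u v \<longleftrightarrow> (a \<le> u \<and> v \<le> b \<longrightarrow> dist (g u) (g v) \<le> h v - h u + e * (v - u))" for u v
    have "P a b"
      using \<open>a \<le> b\<close>
    proof (induction rule: Bolzano)
      case (trans u v w)
      show ?case unfolding P_def
      proof
        assume "a \<le> u \<and> w \<le> b"
        with trans have "dist (g u) (g v) \<le> h v - h u + e * (v - u)"
          "dist (g v) (g w) \<le> h w - h v + e * (w - v)" by (auto simp: P_def)
        with dist_triangle[of "g u" "g w" "g v"]
        show "dist (g u) (g w) \<le> h w - h u + e * (w - u)"
          by (simp add: algebra_simps)
      qed
    next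
      case (local s)
      then obtain d where d: "d > 0"
        "\<And>t. t \<in> {a..b} \<Longrightarrow> \<bar>t - s\<bar> < d \<Longrightarrow> dist (g t) (g s) \<le> \<bar>h t - h s\<bar> + e * \<bar>t - s\<bar>"
        using loc[of s e] e unfolding eventually_at by (force simp: dist_real_def)
      show ?case unfolding P_def
      proof (intro exI[of _ d] conjI allI impI d(1))
        fix u v assume "u \<le> s \<and> s \<le> v \<and> v - u < d" "a \<le> u \<and> v \<le> b"
        then have "dist (g u) (g s) \<le> h s - h u + e * (s - u)"
          "dist (g v) (g s) \<le> h v - h s + e * (v - s)"
          using d(2)[of u] d(2)[of v] mono_onD[OF mono, of u s] mono_onD[OF mono, of s v] by auto
        with dist_triangle2[of "g u" "g v" "g s"]
        show "dist (g u) (g v) \<le> h v - h u + e * (v - u)"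
          by (simp add: algebra_simps)
      qed
    qed
    then show ?thesis by (simp add: P_def)
  qed
  show ?thesis
  proof (rule field_le_epsilon)
    fix e :: real assume "e > 0"
    \<comment> \<open>The summand 1 keeps the denominator positive when
      \<open>a = b\<close>.\<close>
    then have "e / (b - a + 1) * (b - a) \<le> e"
      using \<open>a \<le> b\<close> by (simp add: field_simps)
    with *[of "e / (b - a + 1)"] \<open>e > 0\<close> \<open>a \<le> b\<close>
    show "dist (g a) (g b) \<le> h b - h a + e" by simp
  qed
qed

corollary dist_le_of_locally_lipschitz:
  fixes g :: "real \<Rightarrow> 'a::metric_space"
  assumes "a \<le> b" "K \<ge> 0"
    and loc: "\<And>s e. s \<in> {a..b} \<Longrightarrow> e > 0 \<Longrightarrow>
       \<forall>\<^sub>F t in at s within {a..b}. dist (g t) (g s) \<le> (K + e) * \<bar>t - s\<bar>"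
  shows "dist (g a) (g b) \<le> K * (b - a)"
proof -
  have "dist (g a) (g b) \<le> K * b - K * a"
  proof (rule dist_le_of_locally_le[OF \<open>a \<le> b\<close>])
    show "mono_on {a..b} ((*) K)" using \<open>K \<ge> 0\<close> by (auto intro!: mono_onI mult_left_mono)
    fix s e :: real assume "s \<in> {a..b}" "e > 0"
    from loc[OF this] show "\<forall>\<^sub>F t in at s within {a..b}. dist (g t) (g s) \<le> \<bar>K * t - K * s\<bar> + e * \<bar>t - s\<bar>"
    proof eventually_elim
      case (elim t)
      have "\<bar>K * t - K * s\<bar> = K * \<bar>t - s\<bar>" using \<open>K \<ge> 0\<close>
        by (simp add: abs_mult right_diff_distrib[symmetric])
      with elim show ?case by (simp add: algebra_simps)
    qed
  qed
  then show ?thesis by (simp add: algebra_simps)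
qed

abbreviation bdist :: "'a::metric_space set \<Rightarrow> 'a \<Rightarrow> real" where
  "bdist \<Omega> z \<equiv> infdist z (frontier \<Omega>)"

lemma bdist_pos:
  assumes "open \<Omega>" "frontier \<Omega> \<noteq> {}" "z \<in> \<Omega>"
  shows "bdist \<Omega> z > 0"
  using assms by (intro infdist_pos_not_in_closed) (auto simp: frontier_def interior_open)

text \<open>
  This is the 1-Lipschitz condition for the quasihyperbolic metric, stated without that metric. It is
  equivalent to its infinitesimal version (see \<open>qcurveI_local\<close> below), and it is evidently
  preserved by pointwise limits.
\<close>

definition qcurve :: "'a::metric_space set \<Rightarrow> real \<Rightarrow> (real \<Rightarrow> 'a) \<Rightarrow> bool" where
  "qcurve \<Omega> V \<kappa> \<longleftrightarrow> 0 \<le> V \<and> (\<forall>s\<in>{0..V}. \<kappa> s \<in> \<Omega>) \<and>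
     (\<forall>s\<in>{0..V}. \<forall>t\<in>{0..V}. dist (\<kappa> s) (\<kappa> t) \<le> bdist \<Omega> (\<kappa> s) * (exp \<bar>s - t\<bar> - 1))"

lemma qcurve_dist:
  assumes "qcurve \<Omega> V \<kappa>" "s \<in> {0..V}" "t \<in> {0..V}"
  shows "dist (\<kappa> s) (\<kappa> t) \<le> bdist \<Omega> (\<kappa> s) * (exp \<bar>s - t\<bar> - 1)"
  using assms unfolding qcurve_def by blast

lemma qcurve_mem: "qcurve \<Omega> V \<kappa> \<Longrightarrow> s \<in> {0..V} \<Longrightarrow> \<kappa> s \<in> \<Omega>"
  and qcurve_nonneg: "qcurve \<Omega> V \<kappa> \<Longrightarrow> 0 \<le> V"
  unfolding qcurve_def by blast+

lemma qcurve_bdist_le: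
  assumes "qcurve \<Omega> V \<kappa>" "s \<in> {0..V}" "t \<in> {0..V}"
  shows "bdist \<Omega> (\<kappa> t) \<le> bdist \<Omega> (\<kappa> s) * exp \<bar>s - t\<bar>"
  using qcurve_dist[OF assms] infdist_triangle[of "\<kappa> t" "frontier \<Omega>" "\<kappa> s"]
  by (simp add: algebra_simps dist_commute)

lemma abs_ln_1p_le:
  assumes "\<bar>u\<bar> \<le> b" "b < 1"
  shows "\<bar>ln (1 + u)\<bar> \<le> b / (1 - b::real)"
proof -
  have b: "0 \<le> b" using assms by linarith
  have "ln (1 + u) \<le> u" using assms by (intro ln_add_one_self_le_self2) auto
  moreover have "b \<le> b / (1 - b)"
    using b assms(2) by (simp add: pos_le_divide_eq algebra_simps)
  moreover have "- ln (1 + u) \<le> b / (1 - b)"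
  proof -
    have "- ln (1 + u) = ln (1 / (1 + u))" using assms by (simp add: ln_div)
    also have "\<dots> \<le> 1 / (1 + u) - 1" using assms by (intro ln_le_minus_one) auto
    also have "1 / (1 + u) \<le> 1 / (1 - b)" using assms by (intro divide_left_mono mult_pos_pos) auto
    also have "1 / (1 - b) - 1 = b / (1 - b)" using assms by (simp add: field_simps)
    finally show ?thesis by simp
  qed
  ultimately show ?thesis using assms(1) by linarith
qed

text \<open>A Gronwall argument: seen from a fixed \<open>p\<close>, the function \<open>D\<close>
  majorizes \<open>bdist\<close> along the curve, with equality at \<open>p\<close>. The local speed
  is at most \<open>bdist\<close>, hence at most \<open>D\<close>, so \<open>ln D\<close> has local
  Lipschitz constant 1. Exponentiating the resulting bound on \<open>D q\<close> gives the
  claim.\<close>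

lemma qcurveI_local:
  assumes \<Omega>: "open \<Omega>" "frontier \<Omega> \<noteq> {}" and V: "0 \<le> V" and mem: "\<And>s. s \<in> {0..V} \<Longrightarrow> \<kappa> s \<in> \<Omega>"
    and loc: "\<And>s e. s \<in> {0..V} \<Longrightarrow> e > 0 \<Longrightarrow>
       \<forall>\<^sub>F t in at s within {0..V}. dist (\<kappa> t) (\<kappa> s) \<le> (1 + e) * bdist \<Omega> (\<kappa> s) * \<bar>t - s\<bar>"
  shows "qcurve \<Omega> V \<kappa>"
proof -
  have main: "dist (\<kappa> p) (\<kappa> q) \<le> bdist \<Omega> (\<kappa> p) * (exp \<bar>p - q\<bar> - 1)" 
    if pq: "p \<in> {0..V}" "q \<in> {0..V}" for p q
  proof -
    define D where "D r = bdist \<Omega> (\<kappa> p) + dist (\<kappa> r) (\<kappa> p)" for r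
    have pos: "bdist \<Omega> (\<kappa> r) > 0" if "r \<in> {0..V}" for r using bdist_pos[OF \<Omega> mem[OF that]] .
    have D_ge: "D r \<ge> bdist \<Omega> (\<kappa> r)" for r
      unfolding D_def by (rule infdist_triangle)
    define a b where "a = min p q" and "b = max p q"
    have ab: "a \<le> b" "{a..b} \<subseteq> {0..V}" using pq by (auto simp: a_def b_def)
    have "dist (ln (D a)) (ln (D b)) \<le> 1 * (b - a)"
    proof (rule dist_le_of_locally_lipschitz[OF ab(1)])
      fix s e :: real assume s: "s \<in> {a..b}" and e: "e > 0"
      with ab have sV: "s \<in> {0..V}" by auto
      have Ds: "D s > 0" using D_ge[of s] pos[OF sV] by linarith
      \<comment> \<open>The local bound is used with \<open>e/2\<close>; the other half of
        \<open>e\<close> absorbs the factor \<open>1 / (1 - b)\<close> of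
        \<open>abs_ln_1p_le\<close>.\<close>
      have "((\<lambda>t. (1 + e/2) / (1 - (1 + e/2) * \<bar>t - s\<bar>)) \<longlongrightarrow> (1 + e/2) / (1 - (1 + e/2) * \<bar>s - s\<bar>)) (at s within {a..b})"
        by (intro tendsto_intros) auto
      then have "\<forall>\<^sub>F t in at s within {a..b}. (1 + e/2) / (1 - (1 + e/2) * \<bar>t - s\<bar>) < 1 + e"
        using e by (intro order_tendstoD(2)) auto
      moreover have "((\<lambda>t. (1 + e/2) * \<bar>t - s\<bar>) \<longlongrightarrow> (1 + e/2) * \<bar>s - s\<bar>) (at s within {a..b})"
        by (intro tendsto_intros)
      then have "\<forall>\<^sub>F t in at s within {a..b}. (1 + e/2) * \<bar>t - s\<bar> < 1"
        by (intro order_tendstoD(2)) auto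
      moreover have "\<forall>\<^sub>F t in at s within {a..b}. dist (\<kappa> t) (\<kappa> s) \<le> (1 + e/2) * bdist \<Omega> (\<kappa> s) * \<bar>t - s\<bar>"
        using loc[OF sV, of "e/2"] e at_le[OF ab(2), of s] by (auto simp: le_filter_def)
      ultimately show "\<forall>\<^sub>F t in at s within {a..b}. dist (ln (D t)) (ln (D s)) \<le> (1 + e) * \<bar>t - s\<bar>"
      proof eventually_elim
        case (elim t)
        let ?b = "(1 + e/2) * \<bar>t - s\<bar>"
        have "\<bar>D t - D s\<bar> \<le> dist (\<kappa> t) (\<kappa> s)"
          unfolding D_def using dist_triangle[of "\<kappa> t" "\<kappa> p" "\<kappa> s"] dist_triangle[of "\<kappa> s" "\<kappa> p" "\<kappa> t"]
          by (simp add: dist_commute abs_le_iff)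
        also have "\<dots> \<le> ?b * bdist \<Omega> (\<kappa> s)" using elim(3) by (simp add: mult_ac)
        also have "\<dots> \<le> ?b * D s" using e by (intro mult_left_mono D_ge) auto
        finally have "\<bar>(D t - D s) / D s\<bar> \<le> ?b" using Ds by (simp add: field_simps)
        then have "\<bar>ln (1 + (D t - D s) / D s)\<bar> \<le> ?b / (1 - ?b)"
          using elim(2) by (rule abs_ln_1p_le)
        also have "1 + (D t - D s) / D s = D t / D s" using Ds by (simp add: field_simps)
        also have "ln (D t / D s) = ln (D t) - ln (D s)"
        proof -
          have "D t \<ge> bdist \<Omega> (\<kappa> p)" by (simp add: D_def)
          with pos[OF pq(1)] have "D t > 0" by linarith
          with Ds show ?thesis by (simp add: ln_div)
        qed
        also have "?b / (1 - ?b) = (1 + e/2) / (1 - ?b) * \<bar>t - s\<bar>" by simp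
        also have "\<dots> \<le> (1 + e) * \<bar>t - s\<bar>" using elim(1) by (intro mult_right_mono) auto
        finally show ?case by (simp add: dist_real_def)
      qed
    qed auto
    then have "\<bar>ln (D q) - ln (D p)\<bar> \<le> \<bar>p - q\<bar>"
      by (auto simp: a_def b_def dist_real_def min_def max_def split: if_splits)
    then have "ln (D q) \<le> ln (D p) + \<bar>p - q\<bar>" by linarith
    then have "D q \<le> exp (ln (D p) + \<bar>p - q\<bar>)"
      using D_ge[of q] pos[OF pq(2)] by (metis exp_le_cancel_iff exp_ln less_le_trans)
    also have "\<dots> = bdist \<Omega> (\<kappa> p) * exp \<bar>p - q\<bar>"
      using pos[OF pq(1)] by (simp add: exp_add D_def)
    finally show ?thesis unfolding D_def by (simp add: algebra_simps dist_commute)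
  qed
  with V mem show ?thesis by (auto simp: qcurve_def)
qed

text \<open>At \<open>m\<close> the distance to the boundary has grown at most by the factor
  \<open>exp u\<close>, and \<open>exp u - 1\<close> and \<open>exp u * (exp v - 1)\<close> add up
  to \<open>exp (u + v) - 1\<close>. Hence nothing is lost where two curves are joined.\<close>

lemma exp_dist_trans:
  fixes u v :: real
  assumes "dist a m \<le> bdist \<Omega> a * (exp u - 1)" "dist m b \<le> bdist \<Omega> m * (exp v - 1)" "v \<ge> 0"
  shows "dist a b \<le> bdist \<Omega> a * (exp (u + v) - 1)"
proof -
  have "bdist \<Omega> m \<le> bdist \<Omega> a * exp u"
    using infdist_triangle[of m "frontier \<Omega>" a] assms(1) by (simp add: algebra_simps dist_commute)
  then have "bdist \<Omega> m * (exp v - 1) \<le> bdist \<Omega> a * exp u * (exp v - 1)"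
    using assms(3) by (intro mult_right_mono) auto
  with assms(1,2) dist_triangle[of a b m] show ?thesis
    by (simp add: algebra_simps exp_add)
qed

lemma qcurve_join:
  assumes 1: "qcurve \<Omega> V \<kappa>" and 2: "qcurve \<Omega> W \<mu>" and eq: "\<kappa> V = \<mu> 0"
  shows "qcurve \<Omega> (V + W) (\<lambda>t. if t \<le> V then \<kappa> t else \<mu> (t - V))" (is "qcurve _ _ ?j")
proof -
  note VW = qcurve_nonneg[OF 1] qcurve_nonneg[OF 2]
  have mixed: "dist (\<kappa> s) (\<mu> t) \<le> bdist \<Omega> (\<kappa> s) * (exp (V - s + t) - 1)"
       "dist (\<mu> t) (\<kappa> s) \<le> bdist \<Omega> (\<mu> t) * (exp (V - s + t) - 1)"
      if "s \<in> {0..V}" "t \<in> {0..W}" for s t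
  proof -
    show "dist (\<kappa> s) (\<mu> t) \<le> bdist \<Omega> (\<kappa> s) * (exp (V - s + t) - 1)"
      using qcurve_dist[OF 1 that(1), of V] qcurve_dist[OF 2 _ that(2), of 0] VW that eq
      by (intro exp_dist_trans[of _ "\<kappa> V"]) auto
    have "dist (\<mu> t) (\<kappa> s) \<le> bdist \<Omega> (\<mu> t) * (exp (t + (V - s)) - 1)"
      using qcurve_dist[OF 1 _ that(1), of V] qcurve_dist[OF 2 that(2), of 0] VW that eq
      by (intro exp_dist_trans[of _ "\<kappa> V"]) auto
    then show "dist (\<mu> t) (\<kappa> s) \<le> bdist \<Omega> (\<mu> t) * (exp (V - s + t) - 1)"
      by (simp add: add.commute)
  qed
  show ?thesis unfolding qcurve_def
  proof (intro conjI ballI)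
    fix s t assume st: "s \<in> {0..V + W}" "t \<in> {0..V + W}"
    show "dist (?j s) (?j t) \<le> bdist \<Omega> (?j s) * (exp \<bar>s - t\<bar> - 1)"
    proof (cases "s \<le> V"; cases "t \<le> V")
      assume "s \<le> V" "t \<le> V"
      then show ?thesis using st qcurve_dist[OF 1, of s t] by simp
    next
      assume "s \<le> V" "\<not> t \<le> V"
      then show ?thesis using st mixed(1)[of s "t - V"] by simp
    next
      assume "\<not> s \<le> V" "t \<le> V"
      then show ?thesis using st mixed(2)[of t "s - V"] by simp
    next
      assume "\<not> s \<le> V" "\<not> t \<le> V"
      then show ?thesis using st qcurve_dist[OF 2, of "s - V" "t - V"] by simp
    qed
  qed (use VW qcurve_mem[OF 1] qcurve_mem[OF 2] in auto)
qed

text \<open>Besides shifts and reversals this allows \<open>\<phi> t = min t V\<close>, which lets a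
  curve rest at its end so that curves of different lengths share a parameter interval.\<close>

lemma qcurve_reparam:
  assumes "qcurve \<Omega> V \<kappa>" "0 \<le> W" "\<And>t. t \<in> {0..W} \<Longrightarrow> \<phi> t \<in> {0..V}"
    "\<And>s t. s \<in> {0..W} \<Longrightarrow> t \<in> {0..W} \<Longrightarrow> \<bar>\<phi> s - \<phi> t\<bar> \<le> \<bar>s - t\<bar>"
  shows "qcurve \<Omega> W (\<lambda>t. \<kappa> (\<phi> t))"
  unfolding qcurve_def
proof (intro conjI ballI)
  fix s t assume st: "s \<in> {0..W}" "t \<in> {0..W}"
  have "dist (\<kappa> (\<phi> s)) (\<kappa> (\<phi> t)) \<le> bdist \<Omega> (\<kappa> (\<phi> s)) * (exp \<bar>\<phi> s - \<phi> t\<bar> - 1)"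
    using assms st by (intro qcurve_dist) auto
  also have "\<dots> \<le> bdist \<Omega> (\<kappa> (\<phi> s)) * (exp \<bar>s - t\<bar> - 1)"
    using assms(4)[OF st] by (intro mult_left_mono infdist_nonneg) auto
  finally show "dist (\<kappa> (\<phi> s)) (\<kappa> (\<phi> t)) \<le> bdist \<Omega> (\<kappa> (\<phi> s)) * (exp \<bar>s - t\<bar> - 1)" .
qed (use assms(2,3) qcurve_mem[OF assms(1)] in auto)

lemma exp_diff_one_le: "exp h - 1 \<le> exp h * (h::real)"
proof -
  have "exp h * (1 - h) \<le> exp h * exp (- h)"
    using exp_ge_add_one_self[of "- h"] by (intro mult_left_mono) auto
  then show ?thesis by (simp add: algebra_simps exp_minus field_simps)
qed

text \<open>The constant depends only on the initial point and on an upper bound \<open>W\<close> of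
  the length, which makes families of curves equicontinuous. One factor \<open>exp W\<close> bounds
  \<open>bdist\<close> along the curve, the other the slope of \<open>exp\<close>.\<close>

lemma qcurve_lipschitz:
  assumes q: "qcurve \<Omega> V \<kappa>" and V: "V \<le> W" and st: "s \<in> {0..V}" "t \<in> {0..V}"
  shows "dist (\<kappa> s) (\<kappa> t) \<le> bdist \<Omega> (\<kappa> 0) * exp (2 * W) * \<bar>s - t\<bar>"
proof -
  have "dist (\<kappa> s) (\<kappa> t) \<le> bdist \<Omega> (\<kappa> s) * (exp \<bar>s - t\<bar> - 1)" by (rule qcurve_dist[OF q st])
  also have "\<dots> \<le> (bdist \<Omega> (\<kappa> 0) * exp W) * (exp W * \<bar>s - t\<bar>)"
  proof (intro mult_mono)
    have "bdist \<Omega> (\<kappa> s) \<le> bdist \<Omega> (\<kappa> 0) * exp \<bar>0 - s\<bar>" using st by (intro qcurve_bdist_le[OF q]) auto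
    also have "\<dots> \<le> bdist \<Omega> (\<kappa> 0) * exp W" using st V by (intro mult_left_mono) (auto simp: infdist_nonneg)
    finally show "bdist \<Omega> (\<kappa> s) \<le> bdist \<Omega> (\<kappa> 0) * exp W" .
    have "exp \<bar>s - t\<bar> - 1 \<le> exp \<bar>s - t\<bar> * \<bar>s - t\<bar>" by (rule exp_diff_one_le)
    also have "\<dots> \<le> exp W * \<bar>s - t\<bar>" using st V by (intro mult_right_mono) auto
    finally show "exp \<bar>s - t\<bar> - 1 \<le> exp W * \<bar>s - t\<bar>" .
  qed (auto simp: infdist_nonneg)
  also have "\<dots> = bdist \<Omega> (\<kappa> 0) * exp (2 * W) * \<bar>s - t\<bar>"
    by (simp add: exp_double power2_eq_square)
  finally show ?thesis .
qed

lemma qcurve_continuous_on: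
  assumes "qcurve \<Omega> V \<kappa>" shows "continuous_on {0..V} \<kappa>"
proof -
  have "lipschitz_on (bdist \<Omega> (\<kappa> 0) * exp (2 * V)) {0..V} \<kappa>"
    using qcurve_lipschitz[OF assms order_refl] by (auto simp: lipschitz_on_def dist_real_def infdist_nonneg)
  then show ?thesis by (rule lipschitz_on_continuous_on)
qed

section \<open>Arc length\<close>

definition psum :: "(real \<Rightarrow> 'a::metric_space) \<Rightarrow> nat \<Rightarrow> (nat \<Rightarrow> real) \<Rightarrow> real" where
  "psum \<gamma> n t = (\<Sum>i<n. dist (\<gamma> (t i)) (\<gamma> (t (Suc i))))"

lemma polygonal_lengths_iff:
  "L \<in> polygonal_lengths \<gamma> a b \<longleftrightarrow> (\<exists>n t. mono_on {..n} t \<and> t ` {..n} \<subseteq> {a..b} \<and> L = psum \<gamma> n t)"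
  unfolding polygonal_lengths_def psum_def by blast

lemma polygonal_lengths_mono:
  "{a..b} \<subseteq> {c..d} \<Longrightarrow> polygonal_lengths \<gamma> a b \<subseteq> polygonal_lengths \<gamma> c d"
  unfolding polygonal_lengths_def by blast

lemma polygonal_lengths_nonempty: "a \<le> b \<Longrightarrow> polygonal_lengths \<gamma> a b \<noteq> {}"
  unfolding polygonal_lengths_def
  by (auto intro!: exI[of _ 0] exI[of _ "\<lambda>_. a"] simp: mono_on_def)

lemma psum_join:
  assumes t: "mono_on {..n} t" "t ` {..n} \<subseteq> {a..b}" and u: "mono_on {..m} u" "u ` {..m} \<subseteq> {b..c}"
    and ab: "a \<le> b" "b \<le> c"
  shows "\<exists>L\<in>polygonal_lengths \<gamma> a c. psum \<gamma> n t + psum \<gamma> m u + dist (\<gamma> (t n)) (\<gamma> (u 0)) = L"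
proof -
  define r where "r i = (if i \<le> n then t i else u (i - Suc n))" for i
  have "psum \<gamma> (Suc (n + m)) r = (\<Sum>i<n + Suc m. dist (\<gamma> (r i)) (\<gamma> (r (Suc i))))"
    by (simp add: psum_def)
  also have "\<dots> = (\<Sum>i<n. dist (\<gamma> (r i)) (\<gamma> (r (Suc i)))) + 
      (\<Sum>i<Suc m. dist (\<gamma> (r (n + i))) (\<gamma> (r (Suc (n + i)))))"
    by (induction m) auto
  also have "(\<Sum>i<n. dist (\<gamma> (r i)) (\<gamma> (r (Suc i)))) = psum \<gamma> n t"
    unfolding psum_def by (intro sum.cong) (auto simp: r_def)
  also have "(\<Sum>i<Suc m. dist (\<gamma> (r (n + i))) (\<gamma> (r (Suc (n + i))))) =
     dist (\<gamma> (r n)) (\<gamma> (r (Suc n))) + (\<Sum>i<m. dist (\<gamma> (r (n + Suc i))) (\<gamma> (r (Suc (n + Suc i)))))"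
    by (subst sum.lessThan_Suc_shift) simp
  also have "(\<Sum>i<m. dist (\<gamma> (r (n + Suc i))) (\<gamma> (r (Suc (n + Suc i))))) = psum \<gamma> m u"
    unfolding psum_def by (intro sum.cong) (auto simp: r_def)
  finally have "psum \<gamma> (Suc (n + m)) r = psum \<gamma> n t + psum \<gamma> m u + dist (\<gamma> (t n)) (\<gamma> (u 0))"
    by (simp add: r_def[of n] r_def[of "Suc n"])
  moreover have "mono_on {..Suc (n + m)} r"
  proof (rule mono_onI)
    fix i j assume ij: "i \<in> {..Suc (n + m)}" "j \<in> {..Suc (n + m)}" "i \<le> j"
    consider "j \<le> n" | "i \<le> n" "n < j" | "n < i" "n < j" using ij by linarith
    then show "r i \<le> r j"
    proof cases
      case 1 with ij show ?thesis using mono_onD[OF t(1), of i j] by (auto simp: r_def)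
    next
      case 2
      then have "t i \<le> b" "b \<le> u (j - Suc n)" using t(2) u(2) ij by (auto simp: image_subset_iff)
      with 2 show ?thesis by (auto simp: r_def)
    next
      case 3 with ij show ?thesis using mono_onD[OF u(1), of "i - Suc n" "j - Suc n"] by (auto simp: r_def)
    qed
  qed
  moreover have "r ` {..Suc (n + m)} \<subseteq> {a..c}"
  proof clarify
    fix i assume "i \<le> Suc (n + m)"
    then have "r i \<in> {a..b} \<union> {b..c}" using t(2) u(2) by (auto simp: r_def image_subset_iff)
    then show "r i \<in> {a..c}" using ab by auto
  qed
  ultimately show ?thesis
    by (intro bexI[of _ "psum \<gamma> (Suc (n + m)) r"]) (simp, unfold polygonal_lengths_iff, blast)
qed

text \<open>Clamping all nodes at \<open>b\<close> from above and from below cuts the polygon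
  without a search for the edge that crosses \<open>b\<close>: that edge is split by the triangle
  inequality, and every other edge degenerates in one of the two sums.\<close>

lemma psum_split:
  assumes t: "mono_on {..n} t" "t ` {..n} \<subseteq> {a..c}" and b: "a \<le> b" "b \<le> c"
  shows "psum \<gamma> n t \<le> psum \<gamma> n (\<lambda>i. min (t i) b) + psum \<gamma> n (\<lambda>i. max (t i) b)"
    "psum \<gamma> n (\<lambda>i. min (t i) b) \<in> polygonal_lengths \<gamma> a b"
    "psum \<gamma> n (\<lambda>i. max (t i) b) \<in> polygonal_lengths \<gamma> b c"
proof -
  have "dist (\<gamma> u) (\<gamma> v) \<le> dist (\<gamma> (min u b)) (\<gamma> (min v b)) + dist (\<gamma> (max u b)) (\<gamma> (max v b))"
    if "u \<le> v" for u v
    using that dist_triangle[of "\<gamma> u" "\<gamma> v" "\<gamma> b"] by (auto simp: min_def max_def)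
  then show "psum \<gamma> n t \<le> psum \<gamma> n (\<lambda>i. min (t i) b) + psum \<gamma> n (\<lambda>i. max (t i) b)"
    unfolding psum_def sum.distrib[symmetric]
    by (intro sum_mono) (use mono_onD[OF t(1)] in auto)
  show "psum \<gamma> n (\<lambda>i. min (t i) b) \<in> polygonal_lengths \<gamma> a b"
    unfolding polygonal_lengths_iff
    by (intro exI[of _ n] exI[of _ "\<lambda>i. min (t i) b"] conjI refl)
       (use b t in \<open>auto simp: mono_on_def image_subset_iff min_le_iff_disj intro: min.mono\<close>)
  show "psum \<gamma> n (\<lambda>i. max (t i) b) \<in> polygonal_lengths \<gamma> b c"
    unfolding polygonal_lengths_iff
    by (intro exI[of _ n] exI[of _ "\<lambda>i. max (t i) b"] conjI refl)
       (use b t in \<open>auto simp: mono_on_def image_subset_iff intro: max.coboundedI1 max.mono\<close>)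
qed

lemma rectifiable_bdd:
  assumes "rectifiable_path \<gamma>" "0 \<le> a" "b \<le> 1"
  shows "bdd_above (polygonal_lengths \<gamma> a b)"
  using assms by (auto simp: rectifiable_path_def intro: bdd_above_mono[OF _ polygonal_lengths_mono])

lemma polygonal_le_arc_length:
  assumes "rectifiable_path \<gamma>" "0 \<le> a" "b \<le> 1" "L \<in> polygonal_lengths \<gamma> a b"
  shows "L \<le> arc_length \<gamma> a b"
  unfolding arc_length_def using assms by (intro cSup_upper rectifiable_bdd) auto

lemma arc_length_add:
  assumes \<gamma>: "rectifiable_path \<gamma>" and abc: "0 \<le> a" "a \<le> b" "b \<le> c" "c \<le> 1"
  shows "arc_length \<gamma> a c = arc_length \<gamma> a b + arc_length \<gamma> b c"
proof (rule antisym)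
  show "arc_length \<gamma> a c \<le> arc_length \<gamma> a b + arc_length \<gamma> b c"
    unfolding arc_length_def[of \<gamma> a c]
  proof (rule cSup_least)
    fix L assume "L \<in> polygonal_lengths \<gamma> a c"
    then obtain n t where t: "mono_on {..n} t" "t ` {..n} \<subseteq> {a..c}" and L: "L = psum \<gamma> n t"
      unfolding polygonal_lengths_iff by blast
    note psum_split[OF t abc(2,3), of \<gamma>]
    moreover have "psum \<gamma> n (\<lambda>i. min (t i) b) \<le> arc_length \<gamma> a b"
      "psum \<gamma> n (\<lambda>i. max (t i) b) \<le> arc_length \<gamma> b c"
      using calculation abc by (auto intro!: polygonal_le_arc_length[OF \<gamma>])
    ultimately show "L \<le> arc_length \<gamma> a b + arc_length \<gamma> b c" using L by linarith
  qed (use abc in \<open>auto intro!: polygonal_lengths_nonempty\<close>)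
  have "arc_length \<gamma> a b \<le> arc_length \<gamma> a c - arc_length \<gamma> b c"
    unfolding arc_length_def[of \<gamma> a b]
  proof (rule cSup_least)
    fix L assume L: "L \<in> polygonal_lengths \<gamma> a b"
    have "arc_length \<gamma> b c \<le> arc_length \<gamma> a c - L"
      unfolding arc_length_def[of \<gamma> b c]
    proof (rule cSup_least)
      fix M assume "M \<in> polygonal_lengths \<gamma> b c"
      with L obtain n t m u where "mono_on {..n} t" "t ` {..n} \<subseteq> {a..b}" "L = psum \<gamma> n t"
        "mono_on {..m} u" "u ` {..m} \<subseteq> {b..c}" "M = psum \<gamma> m u"
        unfolding polygonal_lengths_iff by blast
      from psum_join[OF this(1,2,4,5) abc(2,3), of \<gamma>] this(3,6)
      obtain N where "N \<in> polygonal_lengths \<gamma> a c" "L + M + dist (\<gamma> (t n)) (\<gamma> (u 0)) = N" by auto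
      with polygonal_le_arc_length[OF \<gamma> abc(1,4) this(1)] zero_le_dist[of "\<gamma> (t n)" "\<gamma> (u 0)"]
      show "M \<le> arc_length \<gamma> a c - L" by linarith
    qed (use abc in \<open>auto intro!: polygonal_lengths_nonempty\<close>)
    then show "L \<le> arc_length \<gamma> a c - arc_length \<gamma> b c" by linarith
  qed (use abc in \<open>auto intro!: polygonal_lengths_nonempty\<close>)
  then show "arc_length \<gamma> a b + arc_length \<gamma> b c \<le> arc_length \<gamma> a c" by linarith
qed

lemma dist_le_arc_length:
  assumes "rectifiable_path \<gamma>" "0 \<le> a" "a \<le> b" "b \<le> 1"
  shows "dist (\<gamma> a) (\<gamma> b) \<le> arc_length \<gamma> a b"
proof -
  have "psum \<gamma> 1 (\<lambda>i. if i = 0 then a else b) \<in> polygonal_lengths \<gamma> a b"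
    unfolding polygonal_lengths_iff using assms
    by (intro exI conjI refl) (auto simp: mono_on_def)
  from polygonal_le_arc_length[OF assms(1,2,4) this] show ?thesis by (simp add: psum_def)
qed

lemma arc_length_self [simp]: "arc_length \<gamma> a a = 0"
proof -
  have "polygonal_lengths \<gamma> a a = {0}"
  proof
    show "polygonal_lengths \<gamma> a a \<subseteq> {0}"
    proof
      fix L assume "L \<in> polygonal_lengths \<gamma> a a"
      then obtain n t where t: "t ` {..n} \<subseteq> {a}" "L = psum \<gamma> n t"
        unfolding polygonal_lengths_iff by auto
      then have "psum \<gamma> n t = (\<Sum>i<n. 0)" unfolding psum_def
        by (intro sum.cong) (auto simp: image_subset_iff)
      with t show "L \<in> {0}" by simp
    qed
    then show "{0} \<subseteq> polygonal_lengths \<gamma> a a" using polygonal_lengths_nonempty[of a a \<gamma>] by auto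
  qed
  then show ?thesis by (simp add: arc_length_def)
qed

lemma arc_length_diff:
  assumes "rectifiable_path \<gamma>" "0 \<le> s" "s \<le> t" "t \<le> 1"
  shows "arc_length \<gamma> 0 t - arc_length \<gamma> 0 s = arc_length \<gamma> s t"
  using arc_length_add[OF assms(1), of 0 s t] assms by auto

lemma arc_length_nonneg:
  assumes "rectifiable_path \<gamma>" "0 \<le> a" "a \<le> b" "b \<le> 1"
  shows "0 \<le> arc_length \<gamma> a b"
  using dist_le_arc_length[OF assms] zero_le_dist order_trans by blast

text \<open>A monotone sequence with two values jumps at most once, so at most one edge is
  nondegenerate.\<close>

lemma psum_two_valued:
  assumes "mono_on {..n} t" "t ` {..n} \<subseteq> {a, b}" "a < b"
  shows "psum \<gamma> n t \<le> dist (\<gamma> a) (\<gamma> b)"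
proof -
  have "psum \<gamma> n t = dist (\<gamma> (t 0)) (\<gamma> (t n))"
    using assms(1,2)
  proof (induction n)
    case (Suc n)
    have *: "t i \<in> {a, b}" if "i \<le> Suc n" for i using Suc.prems(2) that by blast
    have "psum \<gamma> n t = dist (\<gamma> (t 0)) (\<gamma> (t n))"
      using mono_on_subset[OF Suc.prems(1), of "{..n}"] order_trans[OF image_mono Suc.prems(2), of "{..n}"]
      by (intro Suc.IH) auto
    moreover have "t 0 \<le> t n" "t n \<le> t (Suc n)" using mono_onD[OF Suc.prems(1)] by auto
    ultimately show ?case using *[of 0] *[of n] *[of "Suc n"] assms(3)
      by (auto simp: psum_def)
  qed (simp add: psum_def)
  moreover have "t 0 \<in> {a, b}" "t n \<in> {a, b}" using assms(2) by auto
  ultimately show ?thesis by (auto simp: dist_commute)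
qed

text \<open>Once a polygon through partition points is nearly as long as the curve, a short interval with one
  end at \<open>s\<close> contains no partition point in its interior, so it contributes no more than its chord.\<close>

lemma arc_length_near_small:
  assumes \<gamma>: "rectifiable_path \<gamma>" and s: "s \<in> {0..1}" and e: "e > 0"
  shows "\<exists>d>0. \<forall>t\<in>{0..1}. \<bar>t - s\<bar> < d \<longrightarrow> arc_length \<gamma> (min s t) (max s t) < e"
proof -
  have "path \<gamma>" using \<gamma> by (simp add: rectifiable_path_def)
  then obtain d1 where d1: "d1 > 0" "\<And>t. t \<in> {0..1} \<Longrightarrow> dist t s < d1 \<Longrightarrow> dist (\<gamma> t) (\<gamma> s) < e/2"
    using s e unfolding path_def continuous_on_iff by (metis half_gt_zero)
  have "\<exists>L\<in>polygonal_lengths \<gamma> 0 1. arc_length \<gamma> 0 1 - e/2 < L"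
    unfolding arc_length_def using e
    by (subst less_cSup_iff[symmetric]) (auto intro!: polygonal_lengths_nonempty rectifiable_bdd[OF \<gamma>])
  then obtain n p where p: "mono_on {..n} p" "p ` {..n} \<subseteq> {0..1}" "arc_length \<gamma> 0 1 - e/2 < psum \<gamma> n p"
    by (auto simp: polygonal_lengths_iff)
  \<comment> \<open>Distance 0 is removed because \<open>s\<close> may itself be a partition point;
    the minimum of \<open>X\<close> bounds the distance to all the others.\<close>
  define X where "X = (\<lambda>i. \<bar>p i - s\<bar>) ` {..n} - {0}"
  have "\<exists>d2>0. \<forall>x\<in>X. d2 \<le> x"
  proof (cases "X = {}")
    case False
    have "finite X" unfolding X_def by auto
    with False have "Min X \<in> X" "\<forall>x\<in>X. Min X \<le> x" by auto
    then show ?thesis by (intro exI[of _ "Min X"]) (auto simp: X_def)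
  qed (auto intro: exI[of _ 1])
  then obtain d2 where d2: "d2 > 0" "\<And>x. x \<in> X \<Longrightarrow> d2 \<le> x" by blast
  show ?thesis
  proof (intro exI[of _ "min d1 d2"] conjI ballI impI)
    fix t assume t: "t \<in> {0..1}" "\<bar>t - s\<bar> < min d1 d2"
    define a b where "a = min s t" and "b = max s t"
    have ab: "0 \<le> a" "a \<le> b" "b \<le> 1" using s t by (auto simp: a_def b_def)
    show "arc_length \<gamma> (min s t) (max s t) < e"
    proof (cases "s = t")
      case False
      note sp = psum_split[OF p(1,2), of b \<gamma>]
      define r where "r i = min (p i) b" for i
      have r: "mono_on {..n} r" "r ` {..n} \<subseteq> {0..b}"
        using p(1,2) ab by (auto simp: r_def mono_on_def image_subset_iff min_le_iff_disj intro: min.mono)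
      note sr = psum_split[OF r ab(1,2), of \<gamma>]
      have "psum \<gamma> n (\<lambda>i. max (r i) a) \<le> dist (\<gamma> a) (\<gamma> b)"
      proof (rule psum_two_valued)
        show "mono_on {..n} (\<lambda>i. max (r i) a)"
          using r(1) by (auto simp: mono_on_def intro: max.coboundedI1 max.mono)
        have "max (r i) a \<in> {a, b}" if "i \<le> n" for i
        proof -
          have "p i = s \<or> d2 \<le> \<bar>p i - s\<bar>" using d2(2)[of "\<bar>p i - s\<bar>"] that by (auto simp: X_def)
          then have "p i \<le> a \<or> b \<le> p i" using t(2) by (auto simp: a_def b_def)
          then show ?thesis using ab by (auto simp: r_def)
        qed
        then show "(\<lambda>i. max (r i) a) ` {..n} \<subseteq> {a, b}" by auto
      qed (use False in \<open>auto simp: a_def b_def\<close>)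
      also have "dist (\<gamma> a) (\<gamma> b) < e/2"
        using d1(2)[of t] t by (cases "s \<le> t") (auto simp: a_def b_def dist_real_def dist_commute)
      finally have "psum \<gamma> n (\<lambda>i. max (r i) a) < e/2" .
      moreover have "psum \<gamma> n (\<lambda>i. min (r i) a) \<le> arc_length \<gamma> 0 a"
        using ab by (intro polygonal_le_arc_length[OF \<gamma>] sr(2)) auto
      moreover have "psum \<gamma> n (\<lambda>i. max (p i) b) \<le> arc_length \<gamma> b 1"
        using ab by (intro polygonal_le_arc_length[OF \<gamma>] sp(3)) auto
      moreover have "psum \<gamma> n p \<le> psum \<gamma> n r + psum \<gamma> n (\<lambda>i. max (p i) b)"
        using sp(1) ab unfolding r_def by simp
      moreover have "arc_length \<gamma> 0 1 = arc_length \<gamma> 0 a + (arc_length \<gamma> a b + arc_length \<gamma> b 1)"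
        using ab arc_length_add[OF \<gamma>, of 0 a 1] arc_length_add[OF \<gamma>, of a b 1] by simp
      ultimately show ?thesis using sr(1) p(3) by (simp add: a_def b_def)
    qed (use e in simp)
  qed (use d1 d2 in auto)
qed

lemma continuous_on_arc_length:
  assumes \<gamma>: "rectifiable_path \<gamma>"
  shows "continuous_on {0..1} (arc_length \<gamma> 0)"
  unfolding continuous_on_iff
proof (intro ballI allI impI)
  fix s e :: real assume s: "s \<in> {0..1}" and "e > 0"
  from arc_length_near_small[OF \<gamma> this] obtain d where d: "d > 0"
    "\<And>t. t \<in> {0..1} \<Longrightarrow> \<bar>t - s\<bar> < d \<Longrightarrow> arc_length \<gamma> (min s t) (max s t) < e" by blast
  have "dist (arc_length \<gamma> 0 t) (arc_length \<gamma> 0 s) < e" if t: "t \<in> {0..1}" "\<bar>t - s\<bar> < d" for t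
    using d(2)[OF t] s t arc_length_diff[OF \<gamma>, of s t] arc_length_nonneg[OF \<gamma>, of s t]
      arc_length_diff[OF \<gamma>, of t s] arc_length_nonneg[OF \<gamma>, of t s]
    by (cases "s \<le> t") (auto simp: dist_real_def)
  with d(1) show "\<exists>d>0. \<forall>t\<in>{0..1}. dist t s < d \<longrightarrow> dist (arc_length \<gamma> 0 t) (arc_length \<gamma> 0 s) < e"
    by (intro exI[of _ d]) (auto simp: dist_real_def)
qed

lemma arc_length_surj:
  assumes \<gamma>: "rectifiable_path \<gamma>" and \<sigma>: "\<sigma> \<in> {0..arc_length \<gamma> 0 1}"
  shows "\<exists>t\<in>{0..1}. arc_length \<gamma> 0 t = \<sigma>"
  using IVT'[of "arc_length \<gamma> 0" 0 \<sigma> 1] continuous_on_arc_length[OF \<gamma>] \<sigma> by auto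

lemma arc_length_param_dist:
  assumes \<gamma>: "rectifiable_path \<gamma>" and s: "s \<in> {0..1}" and t: "t \<in> {0..1}"
  shows "dist (\<gamma> s) (\<gamma> t) \<le> \<bar>arc_length \<gamma> 0 s - arc_length \<gamma> 0 t\<bar>"
proof (cases "s \<le> t")
  case True
  with s t show ?thesis using dist_le_arc_length[OF \<gamma>, of s t] arc_length_diff[OF \<gamma>, of s t] by auto
next
  case False
  with s t show ?thesis using dist_le_arc_length[OF \<gamma>, of t s] arc_length_diff[OF \<gamma>, of t s]
    by (auto simp: dist_commute)
qed

lemma arc_length_param:
  assumes \<gamma>: "rectifiable_path \<gamma>" and t: "t \<in> {0..1}"
  shows "arc_length_param \<gamma> (arc_length \<gamma> 0 t) = \<gamma> t"
proof -
  define u where "u = (SOME u. u \<in> {0..1} \<and> arc_length \<gamma> 0 u = arc_length \<gamma> 0 t)"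
  have u: "u \<in> {0..1} \<and> arc_length \<gamma> 0 u = arc_length \<gamma> 0 t"
    unfolding u_def by (rule someI_ex) (use t in auto)
  then have "dist (\<gamma> u) (\<gamma> t) \<le> 0" using arc_length_param_dist[OF \<gamma>, of u t] t by simp
  then show ?thesis by (simp add: arc_length_param_def u_def)
qed

lemma arc_length_param_lipschitz:
  assumes \<gamma>: "rectifiable_path \<gamma>" and "\<sigma> \<in> {0..arc_length \<gamma> 0 1}" "\<tau> \<in> {0..arc_length \<gamma> 0 1}"
  shows "dist (arc_length_param \<gamma> \<sigma>) (arc_length_param \<gamma> \<tau>) \<le> \<bar>\<sigma> - \<tau>\<bar>"
  using arc_length_surj[OF \<gamma> assms(2)] arc_length_surj[OF \<gamma> assms(3)]
    arc_length_param[OF \<gamma>] arc_length_param_dist[OF \<gamma>] by metis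

section \<open>Reparametrization by quasihyperbolic length\<close>

definition qh_cumulative :: "'a::metric_space set \<Rightarrow> (real \<Rightarrow> 'a) \<Rightarrow> real \<Rightarrow> real" where
  "qh_cumulative \<Omega> \<gamma> \<sigma> = integral {0..\<sigma>} (\<lambda>s. 1 / bdist \<Omega> (arc_length_param \<gamma> s))"

lemma qh_length_cumulative: "qh_length \<Omega> \<gamma> = qh_cumulative \<Omega> \<gamma> (arc_length \<gamma> 0 1)"
  by (simp add: qh_length_def arc_length_integral_def qh_cumulative_def)

context
  fixes \<Omega> :: "'a::metric_space set" and \<gamma> :: "real \<Rightarrow> 'a"
  assumes \<Omega>: "open \<Omega>" "frontier \<Omega> \<noteq> {}" and \<gamma>: "rectifiable_path \<gamma>" "path_image \<gamma> \<subseteq> \<Omega>"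
begin

lemma arc_length_param_mem:
  assumes "\<sigma> \<in> {0..arc_length \<gamma> 0 1}" shows "arc_length_param \<gamma> \<sigma> \<in> \<Omega>"
  using arc_length_surj[OF \<gamma>(1) assms] arc_length_param[OF \<gamma>(1)] \<gamma>(2) by (force simp: path_image_def)

lemma bdist_arc_length_param_pos:
  "\<sigma> \<in> {0..arc_length \<gamma> 0 1} \<Longrightarrow> 0 < bdist \<Omega> (arc_length_param \<gamma> \<sigma>)"
  using bdist_pos[OF \<Omega> arc_length_param_mem] .

lemma continuous_on_arc_length_param: "continuous_on {0..arc_length \<gamma> 0 1} (arc_length_param \<gamma>)"
proof -
  have "1-lipschitz_on {0..arc_length \<gamma> 0 1} (arc_length_param \<gamma>)"
    using arc_length_param_lipschitz[OF \<gamma>(1)] by (auto simp: lipschitz_on_def dist_real_def)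
  then show ?thesis by (rule lipschitz_on_continuous_on)
qed

lemma continuous_on_qh_density:
  "continuous_on {0..arc_length \<gamma> 0 1} (\<lambda>s. 1 / bdist \<Omega> (arc_length_param \<gamma> s))"
  by (intro continuous_intros continuous_on_arc_length_param)
    (use bdist_arc_length_param_pos in force)

lemma qh_cumulative_diff:
  assumes "0 \<le> \<sigma>" "\<sigma> \<le> \<tau>" "\<tau> \<le> arc_length \<gamma> 0 1"
  shows "qh_cumulative \<Omega> \<gamma> \<tau> - qh_cumulative \<Omega> \<gamma> \<sigma> =
    integral {\<sigma>..\<tau>} (\<lambda>s. 1 / bdist \<Omega> (arc_length_param \<gamma> s))"
    and "(\<lambda>s. 1 / bdist \<Omega> (arc_length_param \<gamma> s)) integrable_on {\<sigma>..\<tau>}"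
proof -
  have int: "(\<lambda>s. 1 / bdist \<Omega> (arc_length_param \<gamma> s)) integrable_on {a..b}"
    if "0 \<le> a" "b \<le> arc_length \<gamma> 0 1" for a b
    using that by (intro integrable_continuous_real continuous_on_subset[OF continuous_on_qh_density]) auto
  show "(\<lambda>s. 1 / bdist \<Omega> (arc_length_param \<gamma> s)) integrable_on {\<sigma>..\<tau>}"
    using assms by (intro int) auto
  show "qh_cumulative \<Omega> \<gamma> \<tau> - qh_cumulative \<Omega> \<gamma> \<sigma> =
    integral {\<sigma>..\<tau>} (\<lambda>s. 1 / bdist \<Omega> (arc_length_param \<gamma> s))"
    using Henstock_Kurzweil_Integration.integral_combine[OF assms(1,2) int[of 0 \<tau>]] assms
    by (simp add: qh_cumulative_def)
qed

lemma qh_cumulative_diff_ge: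
  assumes "0 \<le> \<sigma>" "\<sigma> \<le> \<tau>" "\<tau> \<le> arc_length \<gamma> 0 1"
    and "\<And>u. u \<in> {\<sigma>..\<tau>} \<Longrightarrow> k \<le> 1 / bdist \<Omega> (arc_length_param \<gamma> u)"
  shows "k * (\<tau> - \<sigma>) \<le> qh_cumulative \<Omega> \<gamma> \<tau> - qh_cumulative \<Omega> \<gamma> \<sigma>"
proof -
  have "integral {\<sigma>..\<tau>} (\<lambda>_. k) \<le> integral {\<sigma>..\<tau>} (\<lambda>s. 1 / bdist \<Omega> (arc_length_param \<gamma> s))"
    using assms by (intro integral_le qh_cumulative_diff(2)) auto
  with assms show ?thesis unfolding qh_cumulative_diff(1)[OF assms(1-3)]
    by (simp add: mult.commute)
qed

lemma qh_cumulative_diff_le: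
  assumes "0 \<le> \<sigma>" "\<sigma> \<le> \<tau>" "\<tau> \<le> arc_length \<gamma> 0 1"
    and "\<And>u. u \<in> {\<sigma>..\<tau>} \<Longrightarrow> 1 / bdist \<Omega> (arc_length_param \<gamma> u) \<le> k"
  shows "qh_cumulative \<Omega> \<gamma> \<tau> - qh_cumulative \<Omega> \<gamma> \<sigma> \<le> k * (\<tau> - \<sigma>)"
proof -
  have "integral {\<sigma>..\<tau>} (\<lambda>s. 1 / bdist \<Omega> (arc_length_param \<gamma> s)) \<le> integral {\<sigma>..\<tau>} (\<lambda>_. k)"
    using assms by (intro integral_le qh_cumulative_diff(2)) auto
  with assms show ?thesis unfolding qh_cumulative_diff(1)[OF assms(1-3)]
    by (simp add: mult.commute)
qed

lemma qh_cumulative_mono: "mono_on {0..arc_length \<gamma> 0 1} (qh_cumulative \<Omega> \<gamma>)"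
proof (rule mono_onI)
  fix \<sigma> \<tau> assume "\<sigma> \<in> {0..arc_length \<gamma> 0 1}" "\<tau> \<in> {0..arc_length \<gamma> 0 1}" "\<sigma> \<le> \<tau>"
  then show "qh_cumulative \<Omega> \<gamma> \<sigma> \<le> qh_cumulative \<Omega> \<gamma> \<tau>"
    using qh_cumulative_diff_ge[of \<sigma> \<tau> 0] by (auto simp: infdist_nonneg)
qed

lemma continuous_on_qh_cumulative: "continuous_on {0..arc_length \<gamma> 0 1} (qh_cumulative \<Omega> \<gamma>)"
  unfolding qh_cumulative_def
  by (intro indefinite_integral_continuous_1 integrable_continuous_real continuous_on_qh_density)

lemma mono_on_arc_length: "mono_on {0..1} (arc_length \<gamma> 0)"
proof (rule mono_onI)
  fix s t :: real assume "s \<in> {0..1}" "t \<in> {0..1}" "s \<le> t"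
  then show "arc_length \<gamma> 0 s \<le> arc_length \<gamma> 0 t"
    using arc_length_diff[OF \<gamma>(1), of s t] arc_length_nonneg[OF \<gamma>(1), of s t] by auto
qed

lemma arc_length_bounds:
  assumes "t \<in> {0..1}" shows "arc_length \<gamma> 0 t \<in> {0..arc_length \<gamma> 0 1}"
  using assms mono_onD[OF mono_on_arc_length, of 0 t] mono_onD[OF mono_on_arc_length, of t 1] by auto

text \<open>The quasihyperbolic length becomes the parameter. The density is bounded below on the
  curve, so the cumulative length \<open>F\<close>, as a function of arc length, has a Lipschitz
  inverse \<open>\<theta>\<close>; pauses of \<open>\<gamma>\<close> go into the monotone factor
  \<open>\<Lambda>\<close>. Thus every competitor in \<open>qh_dist\<close> yields a
  \<open>qcurve\<close> on an interval of exactly its length.\<close>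

theorem rectifiable_qcurve_factorization:
  obtains \<kappa> \<Lambda> where "qcurve \<Omega> (qh_length \<Omega> \<gamma>) \<kappa>" "continuous_on {0..1} \<Lambda>" "mono_on {0..1} \<Lambda>"
    "\<Lambda> 0 = 0" "\<Lambda> 1 = qh_length \<Omega> \<gamma>" "\<And>t. t \<in> {0..1} \<Longrightarrow> \<gamma> t = \<kappa> (\<Lambda> t)"
proof -
  define A where "A = arc_length \<gamma> 0 1"
  define F where "F = qh_cumulative \<Omega> \<gamma>"
  define c where "c = arc_length_param \<gamma>"
  define V where "V = qh_length \<Omega> \<gamma>"
  have A0: "A \<ge> 0" unfolding A_def using arc_length_nonneg[OF \<gamma>(1), of 0 1] by simp
  have F0: "F 0 = 0" by (simp add: F_def qh_cumulative_def)
  have FA: "F A = V" by (simp add: F_def A_def V_def qh_length_cumulative)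
  have Fcont: "continuous_on {0..A} F" and Fmono: "mono_on {0..A} F"
    unfolding F_def A_def by (rule continuous_on_qh_cumulative qh_cumulative_mono)+
  have F_ge: "k * \<bar>\<tau> - \<sigma>\<bar> \<le> \<bar>F \<tau> - F \<sigma>\<bar>" 
    if "\<sigma> \<in> {0..A}" "\<tau> \<in> {0..A}" "\<And>u. u \<in> {min \<sigma> \<tau>..max \<sigma> \<tau>} \<Longrightarrow> k \<le> 1 / bdist \<Omega> (c u)" for \<sigma> \<tau> k
  proof (cases "\<sigma> \<le> \<tau>")
    case True
    with qh_cumulative_diff_ge[of \<sigma> \<tau> k] that show ?thesis by (force simp: A_def F_def c_def)
  next
    case False
    with qh_cumulative_diff_ge[of \<tau> \<sigma> k] that show ?thesis by (force simp: A_def F_def c_def)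
  qed
  \<comment> \<open>Along the curve \<open>bdist\<close> exceeds its initial value by at most the
    arc length \<open>A\<close>, so \<open>m\<close> is a lower bound for the density.\<close>
  define m where "m = 1 / (bdist \<Omega> (c 0) + A)"
  have b0: "bdist \<Omega> (c 0) > 0" unfolding c_def by (rule bdist_arc_length_param_pos) (use A0 in \<open>auto simp: A_def\<close>)
  have m: "m > 0" using b0 A0 by (simp add: m_def)
  have m_le: "m \<le> 1 / bdist \<Omega> (c u)" if u: "u \<in> {0..A}" for u
    unfolding m_def
  proof (rule divide_left_mono)
    have "bdist \<Omega> (c u) \<le> bdist \<Omega> (c 0) + dist (c u) (c 0)" by (rule infdist_triangle)
    also have "dist (c u) (c 0) \<le> \<bar>u - 0\<bar>" unfolding c_def
      by (rule arc_length_param_lipschitz[OF \<gamma>(1)]) (use u A0 in \<open>auto simp: A_def\<close>)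
    finally show "bdist \<Omega> (c u) \<le> bdist \<Omega> (c 0) + A" using u by auto
    show "0 < (bdist \<Omega> (c 0) + A) * bdist \<Omega> (c u)"
      using b0 A0 bdist_arc_length_param_pos[of u] u by (auto simp: c_def A_def)
  qed auto
  have F_m: "m * \<bar>\<tau> - \<sigma>\<bar> \<le> \<bar>F \<tau> - F \<sigma>\<bar>" if "\<sigma> \<in> {0..A}" "\<tau> \<in> {0..A}" for \<sigma> \<tau>
    using that by (intro F_ge m_le) (auto simp: min_def max_def split: if_splits)
  define \<theta> where "\<theta> v = (SOME \<sigma>. \<sigma> \<in> {0..A} \<and> F \<sigma> = v)" for v
  have \<theta>: "\<theta> v \<in> {0..A} \<and> F (\<theta> v) = v" if "v \<in> {0..V}" for v
    unfolding \<theta>_def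
  proof (rule someI_ex)
    show "\<exists>\<sigma>. \<sigma> \<in> {0..A} \<and> F \<sigma> = v"
      using IVT'[of F 0 v A] that F0 FA A0 Fcont by auto
  qed
  have F_in: "F \<sigma> \<in> {0..V}" if "\<sigma> \<in> {0..A}" for \<sigma>
    using mono_onD[OF Fmono, of 0 \<sigma>] mono_onD[OF Fmono, of \<sigma> A] that F0 FA by auto
  have \<theta>F: "\<theta> (F \<sigma>) = \<sigma>" if "\<sigma> \<in> {0..A}" for \<sigma>
    using F_m[of "\<theta> (F \<sigma>)" \<sigma>] \<theta>[OF F_in[OF that]] that m by (auto simp: mult_le_0_iff)
  have V0: "V \<ge> 0" using F_in[of 0] A0 by auto
  have "qcurve \<Omega> V (\<lambda>v. c (\<theta> v))"
  proof (rule qcurveI_local[OF \<Omega> V0])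
    show "c (\<theta> v) \<in> \<Omega>" if "v \<in> {0..V}" for v
      unfolding c_def using \<theta>[OF that] by (intro arc_length_param_mem) (simp add: A_def)
    fix v e :: real assume v: "v \<in> {0..V}" and e: "e > 0"
    define \<sigma> where "\<sigma> = \<theta> v"
    have \<sigma>: "\<sigma> \<in> {0..A}" "F \<sigma> = v" using \<theta>[OF v] by (auto simp: \<sigma>_def)
    have b: "bdist \<Omega> (c \<sigma>) > 0" unfolding c_def by (rule bdist_arc_length_param_pos) (use \<sigma> in \<open>auto simp: A_def\<close>)
    \<comment> \<open>Slightly below the density at \<open>\<sigma>\<close>, so that the density
      stays above \<open>k\<close> nearby, while \<open>1 / k\<close> is the speed to be
      proved.\<close>
    define k where "k = 1 / ((1 + e) * bdist \<Omega> (c \<sigma>))"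
    have k: "k > 0" "k < 1 / bdist \<Omega> (c \<sigma>)" using b e unfolding k_def by (auto intro!: divide_strict_left_mono)
    then obtain d where d: "d > 0" "\<And>u. u \<in> {0..A} \<Longrightarrow> \<bar>u - \<sigma>\<bar> < d \<Longrightarrow> k \<le> 1 / bdist \<Omega> (c u)"
    proof -
      have "continuous_on {0..A} (\<lambda>s. 1 / bdist \<Omega> (c s))" unfolding A_def c_def by (rule continuous_on_qh_density)
      then obtain d where "d > 0" "\<And>u. u \<in> {0..A} \<Longrightarrow> dist u \<sigma> < d \<Longrightarrow>
          dist (1 / bdist \<Omega> (c u)) (1 / bdist \<Omega> (c \<sigma>)) < 1 / bdist \<Omega> (c \<sigma>) - k"
        using k \<sigma>(1) unfolding continuous_on_iff by (metis diff_gt_0_iff_gt)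
      then show ?thesis using that[of d] by (force simp: dist_real_def)
    qed
    have "dist (c (\<theta> w)) (c (\<theta> v)) \<le> (1 + e) * bdist \<Omega> (c (\<theta> v)) * \<bar>w - v\<bar>"
      if w: "w \<in> {0..V}" "dist w v < m * d" for w
    proof -
      have \<theta>w: "\<theta> w \<in> {0..A}" "F (\<theta> w) = w" using \<theta>[OF w(1)] by auto
      have "m * \<bar>\<theta> w - \<sigma>\<bar> < m * d" using F_m[OF \<sigma>(1) \<theta>w(1)] w(2) \<sigma> \<theta>w by (simp add: dist_real_def)
      with m have lt: "\<bar>\<theta> w - \<sigma>\<bar> < d" by simp
      have "dist (c (\<theta> w)) (c \<sigma>) \<le> \<bar>\<theta> w - \<sigma>\<bar>" unfolding c_def
        by (rule arc_length_param_lipschitz[OF \<gamma>(1)]) (use \<theta>w \<sigma> in \<open>auto simp: A_def\<close>)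
      moreover have "k * \<bar>\<theta> w - \<sigma>\<bar> \<le> \<bar>w - v\<bar>"
      proof -
        have "k \<le> 1 / bdist \<Omega> (c u)" if "u \<in> {min \<sigma> (\<theta> w)..max \<sigma> (\<theta> w)}" for u
          using that lt \<sigma>(1) \<theta>w(1) by (intro d(2)) (auto simp: min_def max_def split: if_splits)
        from F_ge[OF \<sigma>(1) \<theta>w(1) this] show ?thesis using \<sigma> \<theta>w by simp
      qed
      ultimately have "k * dist (c (\<theta> w)) (c \<sigma>) \<le> \<bar>w - v\<bar>"
        using k by (meson mult_left_mono less_imp_le order_trans)
      then have "dist (c (\<theta> w)) (c \<sigma>) / ((1 + e) * bdist \<Omega> (c \<sigma>)) \<le> \<bar>w - v\<bar>" by (simp add: k_def)
      moreover have "(1 + e) * bdist \<Omega> (c \<sigma>) > 0" using b e by simp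
      ultimately show ?thesis unfolding \<sigma>_def[symmetric] by (simp only: pos_divide_le_eq mult.commute)
    qed
    then show "\<forall>\<^sub>F w in at v within {0..V}. dist (c (\<theta> w)) (c (\<theta> v)) \<le> (1 + e) * bdist \<Omega> (c (\<theta> v)) * \<bar>w - v\<bar>"
      unfolding eventually_at using m d by (intro exI[of _ "m * d"]) auto
  qed
  then have "qcurve \<Omega> (qh_length \<Omega> \<gamma>) (\<lambda>v. c (\<theta> v))" by (simp add: V_def)
  moreover have "continuous_on {0..1} (\<lambda>t. F (arc_length \<gamma> 0 t))"
    by (rule continuous_on_compose2[OF Fcont continuous_on_arc_length[OF \<gamma>(1)]])
      (use arc_length_bounds in \<open>auto simp: A_def\<close>)
  moreover have "mono_on {0..1} (\<lambda>t. F (arc_length \<gamma> 0 t))"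
    using arc_length_bounds mono_onD[OF mono_on_arc_length] mono_onD[OF Fmono]
    by (intro mono_onI) (auto simp: A_def)
  moreover have "\<gamma> t = c (\<theta> (F (arc_length \<gamma> 0 t)))" if "t \<in> {0..1}" for t
    using \<theta>F[of "arc_length \<gamma> 0 t"] arc_length_bounds[OF that] arc_length_param[OF \<gamma>(1) that]
    by (simp add: A_def c_def)
  ultimately show ?thesis using F0 FA by (intro that[of "\<lambda>v. c (\<theta> v)" "\<lambda>t. F (arc_length \<gamma> 0 t)"]) (auto simp: A_def V_def)
qed

end

section \<open>Length of a curve satisfying the two-point estimate\<close>

lemma polygonal_lengths_lipschitz:
  assumes lip: "\<And>r r'. r \<in> {a..b} \<Longrightarrow> r' \<in> {a..b} \<Longrightarrow> dist (\<gamma> r) (\<gamma> r') \<le> M * \<bar>r - r'\<bar>"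
    and M: "M \<ge> 0" and L: "L \<in> polygonal_lengths \<gamma> a b"
  shows "L \<le> M * (b - a)"
proof -
  obtain n t where t: "mono_on {..n} t" "t ` {..n} \<subseteq> {a..b}" "L = psum \<gamma> n t"
    using L unfolding polygonal_lengths_iff by blast
  have in_ab: "t i \<in> {a..b}" if "i \<le> n" for i using t(2) that by blast
  have "psum \<gamma> n t \<le> (\<Sum>i<n. M * t (Suc i) - M * t i)"
    unfolding psum_def
  proof (rule sum_mono)
    fix i assume i: "i \<in> {..<n}"
    have "t i \<le> t (Suc i)" using mono_onD[OF t(1), of i "Suc i"] i by auto
    then show "dist (\<gamma> (t i)) (\<gamma> (t (Suc i))) \<le> M * t (Suc i) - M * t i"
      using lip[of "t i" "t (Suc i)"] in_ab[of i] in_ab[of "Suc i"] i by (auto simp: algebra_simps)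
  qed
  also have "\<dots> = M * (t n - t 0)" by (subst sum_lessThan_telescope) (simp add: algebra_simps)
  also have "\<dots> \<le> M * (b - a)" using in_ab[of 0] in_ab[of n] M by (intro mult_left_mono) auto
  finally show ?thesis using t by simp
qed

lemma arc_length_lipschitz:
  assumes "\<And>r r'. r \<in> {a..b} \<Longrightarrow> r' \<in> {a..b} \<Longrightarrow> dist (\<gamma> r) (\<gamma> r') \<le> M * \<bar>r - r'\<bar>" "M \<ge> 0" "a \<le> b"
  shows "arc_length \<gamma> a b \<le> M * (b - a)"
  unfolding arc_length_def
  by (rule cSup_least) (use polygonal_lengths_nonempty[OF assms(3)] polygonal_lengths_lipschitz[OF assms(1,2)] in auto)

text \<open>The cumulative length along \<open>p\<close> is shown to grow at local rate at most
  \<open>V\<close>. All estimates over a short step hold up to factors exponential in the step;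
  these tend to 1 and vanish in the local comparison.\<close>

theorem qcurve_rectifiable:
  assumes \<Omega>: "open \<Omega>" "frontier \<Omega> \<noteq> {}" and q: "qcurve \<Omega> V \<kappa>"
  shows "rectifiable_joining \<Omega> (\<kappa> 0) (\<kappa> V) (\<lambda>t. \<kappa> (V * t))"
    and "qh_length \<Omega> (\<lambda>t. \<kappa> (V * t)) \<le> V"
proof -
  define p where "p t = \<kappa> (V * t)" for t
  have V: "V \<ge> 0" by (rule qcurve_nonneg[OF q])
  have Vt: "V * t \<in> {0..V}" if "t \<in> {0..1}" for t using V that by (auto simp: mult_left_le)
  have V_abs: "\<bar>V * r - V * r'\<bar> = V * \<bar>r - r'\<bar>" for r r' using V by (simp add: abs_mult right_diff_distrib[symmetric])
  define M where "M = bdist \<Omega> (\<kappa> 0) * exp (2 * V) * V"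
  have M: "M \<ge> 0" using V by (simp add: M_def infdist_nonneg)
  have lip: "dist (p r) (p r') \<le> M * \<bar>r - r'\<bar>" if "r \<in> {0..1}" "r' \<in> {0..1}" for r r'
    using qcurve_lipschitz[OF q order_refl Vt[OF that(1)] Vt[OF that(2)]] V_abs[of r r']
    by (simp add: p_def M_def mult_ac)
  have path: "path p"
    unfolding path_def p_def
    by (rule continuous_on_compose2[OF qcurve_continuous_on[OF q]]) (use Vt in \<open>auto intro!: continuous_intros\<close>)
  have rect: "rectifiable_path p"
    unfolding rectifiable_path_def
  proof (intro conjI path bdd_aboveI)
    fix L assume "L \<in> polygonal_lengths p 0 1"
    with polygonal_lengths_lipschitz[of 0 1 p M L] lip M show "L \<le> M" by auto
  qed
  have im: "path_image p \<subseteq> \<Omega>" using Vt qcurve_mem[OF q] by (auto simp: path_image_def p_def)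
  have bpos: "bdist \<Omega> (p s) > 0" if "s \<in> {0..1}" for s
  proof -
    have "p s \<in> \<Omega>" using im that unfolding path_image_def by blast
    then show ?thesis by (rule bdist_pos[OF \<Omega>])
  qed
  show "rectifiable_joining \<Omega> (\<kappa> 0) (\<kappa> V) (\<lambda>t. \<kappa> (V * t))"
    using rect im unfolding rectifiable_joining_def p_def by (auto simp: pathstart_def pathfinish_def)
  define \<Phi> where "\<Phi> t = qh_cumulative \<Omega> p (arc_length p 0 t)" for t
  \<comment> \<open>The exponent 3 collects three losses: one from the density, and two from the arc
    length, namely the variation of \<open>bdist\<close> and the slope of
    \<open>exp\<close>.\<close>
  have step: "\<bar>\<Phi> t - \<Phi> s\<bar> \<le> exp (3 * (V * (t - s))) * (V * (t - s))"
    if st: "0 \<le> s" "s \<le> t" "t \<le> 1" for s t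
  proof -
    define h where "h = V * (t - s)"
    have h: "h \<ge> 0" using V st by (simp add: h_def)
    have bs: "bdist \<Omega> (p s) > 0" using bpos[of s] st by auto
    have hr: "V * \<bar>r - r'\<bar> \<le> h" if "r \<in> {s..t}" "r' \<in> {s..t}" for r r'
      unfolding h_def using V that by (intro mult_left_mono) auto
    have b_le: "bdist \<Omega> (p r) \<le> bdist \<Omega> (p s) * exp h" "bdist \<Omega> (p s) \<le> bdist \<Omega> (p r) * exp h" if r: "r \<in> {s..t}" for r
    proof -
      have "bdist \<Omega> (p r) \<le> bdist \<Omega> (p s) * exp (V * \<bar>s - r\<bar>)"
        using qcurve_bdist_le[OF q Vt[of s] Vt[of r]] V_abs[of s r] r st by (auto simp: p_def)
      also have "\<dots> \<le> bdist \<Omega> (p s) * exp h" using hr[of s r] r bs by (intro mult_left_mono) auto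
      finally show "bdist \<Omega> (p r) \<le> bdist \<Omega> (p s) * exp h" .
      have "bdist \<Omega> (p s) \<le> bdist \<Omega> (p r) * exp (V * \<bar>r - s\<bar>)"
        using qcurve_bdist_le[OF q Vt[of r] Vt[of s]] V_abs[of r s] r st by (auto simp: p_def)
      also have "\<dots> \<le> bdist \<Omega> (p r) * exp h" using hr[of r s] r by (intro mult_left_mono) (auto simp: infdist_nonneg)
      finally show "bdist \<Omega> (p s) \<le> bdist \<Omega> (p r) * exp h" .
    qed
    have "arc_length p s t \<le> (bdist \<Omega> (p s) * exp (2 * h) * V) * (t - s)"
    proof (rule arc_length_lipschitz)
      fix r r' assume r: "r \<in> {s..t}" "r' \<in> {s..t}"
      define u where "u = V * \<bar>r - r'\<bar>"
      have u: "0 \<le> u" "u \<le> h" using hr[OF r] V by (auto simp: u_def)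
      have "exp u - 1 \<le> exp u * u" by (rule exp_diff_one_le)
      also have "\<dots> \<le> exp h * u" using u by (intro mult_right_mono) auto
      finally have "exp u - 1 \<le> exp h * u" .
      then have "bdist \<Omega> (p r) * (exp u - 1) \<le> (bdist \<Omega> (p s) * exp h) * (exp h * u)"
        using b_le(1)[OF r(1)] u by (intro mult_mono) (auto simp: infdist_nonneg)
      moreover have "dist (p r) (p r') \<le> bdist \<Omega> (p r) * (exp u - 1)"
        using qcurve_dist[OF q Vt[of r] Vt[of r']] V_abs[of r r'] r st by (auto simp: p_def u_def)
      ultimately have "dist (p r) (p r') \<le> (bdist \<Omega> (p s) * exp h) * (exp h * u)" by linarith
      then show "dist (p r) (p r') \<le> (bdist \<Omega> (p s) * exp (2 * h) * V) * \<bar>r - r'\<bar>"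
      proof -
        have "exp (2 * h) = exp h * exp h" by (simp add: exp_add[symmetric])
        then show ?thesis using \<open>dist (p r) (p r') \<le> (bdist \<Omega> (p s) * exp h) * (exp h * u)\<close> by (simp add: u_def mult_ac)
      qed
    qed (use bs V st in auto)
    then have al: "arc_length p 0 t - arc_length p 0 s \<le> bdist \<Omega> (p s) * exp (2 * h) * h"
      using arc_length_diff[OF rect, of s t] st by (simp add: h_def mult_ac)
    have a_le: "arc_length p 0 s \<le> arc_length p 0 t"
      using mono_onD[OF mono_on_arc_length[OF \<Omega> rect im], of s t] st by auto
    have "\<Phi> t - \<Phi> s \<le> (exp h / bdist \<Omega> (p s)) * (arc_length p 0 t - arc_length p 0 s)"
      unfolding \<Phi>_def
    proof (rule qh_cumulative_diff_le[OF \<Omega> rect im])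
      fix u assume u: "u \<in> {arc_length p 0 s..arc_length p 0 t}"
      have "continuous_on {s..t} (arc_length p 0)"
        by (rule continuous_on_subset[OF continuous_on_arc_length[OF rect]]) (use st in auto)
      then obtain r where r: "r \<in> {s..t}" "arc_length p 0 r = u"
        using IVT'[of "arc_length p 0" s u t] u st by auto
      have "arc_length_param p u = p r" using arc_length_param[OF rect, of r] r st by auto
      moreover have "bdist \<Omega> (p r) > 0" using bpos[of r] r st by auto
      ultimately show "1 / bdist \<Omega> (arc_length_param p u) \<le> exp h / bdist \<Omega> (p s)"
        using b_le(2)[OF r(1)] bs by (simp add: field_simps)
    qed (use arc_length_bounds[OF \<Omega> rect im, of s] arc_length_bounds[OF \<Omega> rect im, of t] a_le st in auto)
    also have "\<dots> \<le> (exp h / bdist \<Omega> (p s)) * (bdist \<Omega> (p s) * exp (2 * h) * h)"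
      using al bs by (intro mult_left_mono) auto
    also have "\<dots> = exp (3 * h) * h"
    proof -
      have "exp (3 * h) = exp h * exp (2 * h)" by (simp add: exp_add[symmetric])
      then show ?thesis using bs by simp
    qed
    finally have "\<Phi> t - \<Phi> s \<le> exp (3 * h) * h" .
    moreover have "\<Phi> s \<le> \<Phi> t" unfolding \<Phi>_def
      using mono_onD[OF qh_cumulative_mono[OF \<Omega> rect im] _ _ a_le]
       arc_length_bounds[OF \<Omega> rect im, of s] arc_length_bounds[OF \<Omega> rect im, of t] st by auto
    ultimately show ?thesis by (simp add: h_def)
  qed
  have "dist (\<Phi> 0) (\<Phi> 1) \<le> V * (1 - 0)"
  proof (rule dist_le_of_locally_lipschitz)
    fix s e :: real assume s: "s \<in> {0..1}" and e: "e > 0"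
    have "((\<lambda>t. exp (3 * (V * \<bar>t - s\<bar>)) * V) \<longlongrightarrow> exp (3 * (V * \<bar>s - s\<bar>)) * V) (at s within {0..1})"
      by (intro tendsto_intros)
    then have "\<forall>\<^sub>F t in at s within {0..1}. exp (3 * (V * \<bar>t - s\<bar>)) * V < V + e"
      using e by (intro order_tendstoD(2)) auto
    moreover have "\<forall>\<^sub>F t in at s within {0..1}. t \<in> {0..1}" by (auto simp: eventually_at_filter)
    ultimately show "\<forall>\<^sub>F t in at s within {0..1}. dist (\<Phi> t) (\<Phi> s) \<le> (V + e) * \<bar>t - s\<bar>"
    proof eventually_elim
      case (elim t)
      have "dist (\<Phi> t) (\<Phi> s) \<le> exp (3 * (V * \<bar>t - s\<bar>)) * V * \<bar>t - s\<bar>"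
        using step[of s t] step[of t s] s elim(2) by (cases "s \<le> t") (auto simp: dist_real_def abs_minus_commute)
      also have "\<dots> \<le> (V + e) * \<bar>t - s\<bar>" using elim(1) by (intro mult_right_mono) auto
      finally show ?case .
    qed
  qed (use V in auto)
  moreover have "\<Phi> 0 = 0" by (simp add: \<Phi>_def qh_cumulative_def)
  moreover have "\<Phi> 1 = qh_length \<Omega> p" by (simp add: \<Phi>_def qh_length_cumulative)
  ultimately have "qh_length \<Omega> p \<le> V" by (simp add: dist_real_def)
  then show "qh_length \<Omega> (\<lambda>t. \<kappa> (V * t)) \<le> V" unfolding p_def .
qed

section \<open>Existence of geodesics\<close>

text \<open>Arzela-Ascoli applies because the Lipschitz constant is common. A limit could a priori
  touch the boundary, but \<open>bdist\<close> decreases at most exponentially along a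
  \<open>qcurve\<close>, so it stays bounded away from 0.\<close>

lemma qcurve_limit:
  fixes \<Omega> :: "'a::euclidean_space set"
  assumes \<Omega>: "open \<Omega>" "frontier \<Omega> \<noteq> {}" and q: "\<And>n. qcurve \<Omega> W (\<kappa> n)" and x: "\<And>n. \<kappa> n 0 = x"
  obtains \<mu> k where "qcurve \<Omega> W \<mu>" "strict_mono (k :: nat \<Rightarrow> nat)"
    "\<And>t. t \<in> {0..W} \<Longrightarrow> (\<lambda>n. \<kappa> (k n) t) \<longlonglongrightarrow> \<mu> t"
proof -
  have W: "W \<ge> 0" using q qcurve_nonneg by blast
  define C where "C = bdist \<Omega> x * exp (2 * W)"
  have C: "C \<ge> 0" by (simp add: C_def infdist_nonneg)
  have lip: "dist (\<kappa> n s) (\<kappa> n t) \<le> C * \<bar>s - t\<bar>" if "s \<in> {0..W}" "t \<in> {0..W}" for n s t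
    using qcurve_lipschitz[OF q order_refl that] by (simp add: C_def x)
  obtain \<mu> k where k: "strict_mono (k :: nat \<Rightarrow> nat)"
    and conv: "\<And>e. 0 < e \<Longrightarrow> \<exists>N. \<forall>n t. n \<ge> N \<and> t \<in> {0..W} \<longrightarrow> norm (\<kappa> (k n) t - \<mu> t) < e"
  proof (rule Arzela_Ascoli[of "{0..W}" \<kappa> "norm x + C * W"])
    fix n t assume t: "t \<in> {0..W}"
    have "norm (\<kappa> n t) \<le> norm x + dist (\<kappa> n t) (\<kappa> n 0)" 
      using norm_triangle_sub[of "\<kappa> n t" x] by (simp add: x dist_norm)
    also have "dist (\<kappa> n t) (\<kappa> n 0) \<le> C * \<bar>t - 0\<bar>" using t W by (intro lip) auto
    also have "\<dots> \<le> C * W" using t C by (intro mult_left_mono) auto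
    finally show "norm (\<kappa> n t) \<le> norm x + C * W" by simp
  next
    fix t e :: real assume t: "t \<in> {0..W}" and e: "0 < e"
    show "\<exists>d>0. \<forall>n u. u \<in> {0..W} \<and> norm (t - u) < d \<longrightarrow> norm (\<kappa> n t - \<kappa> n u) < e"
    proof (intro exI[of _ "e / (C + 1)"] conjI allI impI)
      fix n u assume u: "u \<in> {0..W} \<and> norm (t - u) < e / (C + 1)"
      have "norm (\<kappa> n t - \<kappa> n u) \<le> C * \<bar>t - u\<bar>" using lip[of t u n] t u by (simp add: dist_norm)
      also have "\<dots> \<le> (C + 1) * \<bar>t - u\<bar>" by (intro mult_right_mono) auto
      also have "\<dots> < e" using u C by (simp add: field_simps)
      finally show "norm (\<kappa> n t - \<kappa> n u) < e" .
    qed (use e C in auto)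
  qed auto
  have lim: "(\<lambda>n. \<kappa> (k n) t) \<longlonglongrightarrow> \<mu> t" if "t \<in> {0..W}" for t
    using conv that unfolding LIMSEQ_iff by blast
  have mem: "\<mu> t \<in> \<Omega>" if t: "t \<in> {0..W}" for t
  proof -
    have "(\<lambda>n. bdist \<Omega> (\<kappa> (k n) t) * exp \<bar>t - 0\<bar>) \<longlonglongrightarrow> bdist \<Omega> (\<mu> t) * exp \<bar>t - 0\<bar>"
      by (intro tendsto_intros lim t)
    moreover have "bdist \<Omega> x \<le> bdist \<Omega> (\<kappa> (k n) t) * exp \<bar>t - 0\<bar>" for n
      using qcurve_bdist_le[OF q t, of 0 "k n"] W by (simp add: x)
    ultimately have "bdist \<Omega> x \<le> bdist \<Omega> (\<mu> t) * exp \<bar>t - 0\<bar>"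
      by (intro LIMSEQ_le_const) blast+
    moreover have "bdist \<Omega> x > 0" using bdist_pos[OF \<Omega>] qcurve_mem[OF q, of 0] W x by auto
    ultimately have "bdist \<Omega> (\<mu> t) \<noteq> 0" by auto
    then have "\<mu> t \<notin> frontier \<Omega>" by auto
    moreover have "\<mu> t \<in> closure \<Omega>" unfolding closure_sequential
      using lim[OF t] qcurve_mem[OF q t] by (intro exI[of _ "\<lambda>n. \<kappa> (k n) t"]) auto
    ultimately show ?thesis using \<Omega>(1) by (simp add: frontier_def interior_open)
  qed
  have "qcurve \<Omega> W \<mu>" unfolding qcurve_def
  proof (intro conjI ballI W mem)
    fix s t assume st: "s \<in> {0..W}" "t \<in> {0..W}"
    show "dist (\<mu> s) (\<mu> t) \<le> bdist \<Omega> (\<mu> s) * (exp \<bar>s - t\<bar> - 1)"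
    proof (rule LIMSEQ_le)
      show "(\<lambda>n. dist (\<kappa> (k n) s) (\<kappa> (k n) t)) \<longlonglongrightarrow> dist (\<mu> s) (\<mu> t)"
        by (intro tendsto_intros lim st)
      show "(\<lambda>n. bdist \<Omega> (\<kappa> (k n) s) * (exp \<bar>s - t\<bar> - 1)) \<longlonglongrightarrow> bdist \<Omega> (\<mu> s) * (exp \<bar>s - t\<bar> - 1)"
        by (intro tendsto_intros lim st)
    qed (use qcurve_dist[OF q st] in auto)
  qed
  with k lim show ?thesis using that by blast
qed

text \<open>The segment is run through at the constant speed \<open>b\<close>, half of
  \<open>bdist \<Omega> z\<close>; it stays within \<open>b\<close> of \<open>z\<close>, where
  \<open>bdist\<close> is still at least \<open>b\<close>.\<close>

lemma qcurve_segment: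
  fixes \<Omega> :: "'a::euclidean_space set"
  assumes \<Omega>: "open \<Omega>" "frontier \<Omega> \<noteq> {}" and z: "z \<in> \<Omega>" and w: "w \<in> \<Omega>" "dist z w < bdist \<Omega> z / 2"
    and seg: "closed_segment z w \<subseteq> \<Omega>"
  shows "\<exists>V \<kappa>. qcurve \<Omega> V \<kappa> \<and> \<kappa> 0 = z \<and> \<kappa> V = w"
proof -
  define b where "b = bdist \<Omega> z / 2"
  have b: "b > 0" using bdist_pos[OF \<Omega> z] by (simp add: b_def)
  define V where "V = dist z w / b"
  define \<kappa> where "\<kappa> t = z + (t / V) *\<^sub>R (w - z)" for t
  have V: "V \<ge> 0" using b by (simp add: V_def)
  have speed: "dist (\<kappa> t) (\<kappa> s) = b * \<bar>t - s\<bar>" if "V > 0" for s t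
  proof -
    have "\<kappa> t - \<kappa> s = ((t - s) / V) *\<^sub>R (w - z)" by (simp add: \<kappa>_def diff_divide_distrib algebra_simps)
    then have "dist (\<kappa> t) (\<kappa> s) = \<bar>t - s\<bar> / V * dist z w" using that 
      by (simp add: dist_norm norm_minus_commute)
    also have "dist z w = b * V" using b by (simp add: V_def)
    finally show ?thesis using that by simp
  qed
  have "qcurve \<Omega> V \<kappa>"
  proof (cases "V = 0")
    \<comment> \<open>Here \<open>t / V = 0\<close> by the convention for division by 0, so the
      curve rests at \<open>z\<close>.\<close>
    case True then show ?thesis using z by (simp add: qcurve_def \<kappa>_def)
  next
    case False
    with V have V: "V > 0" by simp
    have near: "b \<le> bdist \<Omega> (\<kappa> s)" if s: "s \<in> {0..V}" for s
    proof -
      have "dist z (\<kappa> s) = b * s" using speed[OF V, of s 0] s by (simp add: \<kappa>_def dist_commute)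
      also have "\<dots> \<le> b * V" using s b by (intro mult_left_mono) auto
      also have "\<dots> = dist z w" using b by (simp add: V_def)
      finally show ?thesis using w(2) infdist_triangle[of z "frontier \<Omega>" "\<kappa> s"] by (simp add: b_def)
    qed
    show ?thesis
    proof (rule qcurveI_local[OF \<Omega>])
      show "\<kappa> s \<in> \<Omega>" if s: "s \<in> {0..V}" for s
      proof -
        have "\<kappa> s = (1 - s / V) *\<^sub>R z + (s / V) *\<^sub>R w" by (simp add: \<kappa>_def algebra_simps)
        moreover have "0 \<le> s / V" "s / V \<le> 1" using s V by auto
        ultimately have "\<kappa> s \<in> closed_segment z w" unfolding closed_segment_def by blast
        with seg show ?thesis by blast
      qed
      fix s e :: real assume s: "s \<in> {0..V}" and e: "e > 0"
      have "dist (\<kappa> t) (\<kappa> s) \<le> (1 + e) * bdist \<Omega> (\<kappa> s) * \<bar>t - s\<bar>" for t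
      proof -
        have "1 * b \<le> (1 + e) * bdist \<Omega> (\<kappa> s)" using near[OF s] e b by (intro mult_mono) auto
        then show ?thesis unfolding speed[OF V] by (intro mult_right_mono) auto
      qed
      then show "\<forall>\<^sub>F t in at s within {0..V}. dist (\<kappa> t) (\<kappa> s) \<le> (1 + e) * bdist \<Omega> (\<kappa> s) * \<bar>t - s\<bar>"
        by simp
    qed (use V in auto)
  qed
  moreover have "\<kappa> V = w"
  proof (cases "V = 0")
    case True then have "z = w" using b by (simp add: V_def)
    then show ?thesis by (simp add: \<kappa>_def)
  qed (simp add: \<kappa>_def)
  ultimately show ?thesis by (intro exI[of _ V] exI[of _ \<kappa>]) (simp add: \<kappa>_def)
qed

lemma qcurve_reverse:
  assumes "qcurve \<Omega> V \<kappa>" shows "qcurve \<Omega> V (\<lambda>t. \<kappa> (V - t))"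
  by (rule qcurve_reparam[OF assms]) (use qcurve_nonneg[OF assms] in auto)

lemma qcurve_exists:
  fixes \<Omega> :: "'a::euclidean_space set"
  assumes \<Omega>: "open \<Omega>" "frontier \<Omega> \<noteq> {}" and conn: "connected \<Omega>" and xy: "x \<in> \<Omega>" "y \<in> \<Omega>"
  shows "\<exists>V \<kappa>. qcurve \<Omega> V \<kappa> \<and> \<kappa> 0 = x \<and> \<kappa> V = y"
  using conn xy
proof (rule connected_equivalence_relation)
  fix a b assume "\<exists>V \<kappa>. qcurve \<Omega> V \<kappa> \<and> \<kappa> 0 = a \<and> \<kappa> V = b"
  then obtain V \<kappa> where "qcurve \<Omega> V \<kappa>" "\<kappa> 0 = a" "\<kappa> V = b" by blast
  then show "\<exists>V \<kappa>. qcurve \<Omega> V \<kappa> \<and> \<kappa> 0 = b \<and> \<kappa> V = a"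
    using qcurve_reverse by (intro exI[of _ V] exI[of _ "\<lambda>t. \<kappa> (V - t)"]) auto
next
  fix a b c assume "\<exists>V \<kappa>. qcurve \<Omega> V \<kappa> \<and> \<kappa> 0 = a \<and> \<kappa> V = b" "\<exists>V \<kappa>. qcurve \<Omega> V \<kappa> \<and> \<kappa> 0 = b \<and> \<kappa> V = c"
  then obtain V \<kappa> W \<mu> where *: "qcurve \<Omega> V \<kappa>" "\<kappa> 0 = a" "\<kappa> V = b" "qcurve \<Omega> W \<mu>" "\<mu> 0 = b" "\<mu> W = c" by blast
  then show "\<exists>V \<kappa>. qcurve \<Omega> V \<kappa> \<and> \<kappa> 0 = a \<and> \<kappa> V = c"
    using qcurve_join[of \<Omega> V \<kappa> W \<mu>] qcurve_nonneg[OF *(1)] qcurve_nonneg[OF *(4)]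
    by (intro exI[of _ "V + W"] exI[of _ "\<lambda>t. if t \<le> V then \<kappa> t else \<mu> (t - V)"]) auto
next
  fix a assume a: "a \<in> \<Omega>"
  then obtain r where r: "r > 0" "ball a r \<subseteq> \<Omega>" using \<Omega>(1) open_contains_ball by blast
  define T where "T = ball a (min r (bdist \<Omega> a / 2))"
  have "\<exists>V \<kappa>. qcurve \<Omega> V \<kappa> \<and> \<kappa> 0 = a \<and> \<kappa> V = b" if b: "b \<in> T" for b
  proof (rule qcurve_segment[OF \<Omega> a])
    have "closed_segment a b \<subseteq> ball a r"
      using b r by (intro closed_segment_subset) (auto simp: T_def)
    with r show "closed_segment a b \<subseteq> \<Omega>" by blast
    show "b \<in> \<Omega>" using b r(2) by (auto simp: T_def)
  qed (use b in \<open>auto simp: T_def\<close>)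
  moreover have "openin (top_of_set \<Omega>) T"
  proof (rule open_subset)
    have "T \<subseteq> ball a r" by (auto simp: T_def)
    with r show "T \<subseteq> \<Omega>" by blast
  qed (simp add: T_def)
  moreover have "a \<in> T" using r bdist_pos[OF \<Omega> a] by (simp add: T_def)
  ultimately show "\<exists>T. openin (top_of_set \<Omega>) T \<and> a \<in> T \<and> (\<forall>x\<in>T. \<exists>V \<kappa>. qcurve \<Omega> V \<kappa> \<and> \<kappa> 0 = a \<and> \<kappa> V = x)" by blast
qed

section \<open>Minimizing curves and their relation to geodesics\<close>

text \<open>Minimality refers to competitors of the same kind, for which limits are available; the
  comparison with rectifiable paths is made in \<open>minimal_qcurve_qh_dist\<close>.\<close>

definition minimal_qcurve :: "'a::metric_space set \<Rightarrow> 'a \<Rightarrow> 'a \<Rightarrow> real \<Rightarrow> (real \<Rightarrow> 'a) \<Rightarrow> bool" where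
  "minimal_qcurve \<Omega> x y D \<kappa> \<longleftrightarrow> qcurve \<Omega> D \<kappa> \<and> \<kappa> 0 = x \<and> \<kappa> D = y \<and>
     (\<forall>V \<mu>. qcurve \<Omega> V \<mu> \<longrightarrow> \<mu> 0 = x \<longrightarrow> \<mu> V = y \<longrightarrow> D \<le> V)"

lemma minimal_qcurve_exists:
  fixes \<Omega> :: "'a::euclidean_space set"
  assumes \<Omega>: "open \<Omega>" "frontier \<Omega> \<noteq> {}" and conn: "connected \<Omega>" and xy: "x \<in> \<Omega>" "y \<in> \<Omega>"
  shows "\<exists>D \<kappa>. minimal_qcurve \<Omega> x y D \<kappa>"
proof -
  define S where "S = {V. \<exists>\<kappa>. qcurve \<Omega> V \<kappa> \<and> \<kappa> 0 = x \<and> \<kappa> V = y}"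
  have ne: "S \<noteq> {}" using qcurve_exists[OF \<Omega> conn xy] by (auto simp: S_def)
  have bdd: "bdd_below S" by (rule bdd_belowI[of _ 0]) (auto simp: S_def dest: qcurve_nonneg)
  define D where "D = Inf S"
  have D_le: "D \<le> V" if "V \<in> S" for V unfolding D_def by (rule cInf_lower[OF that bdd])
  have D0: "D \<ge> 0" unfolding D_def by (rule cInf_greatest[OF ne]) (auto simp: S_def dest: qcurve_nonneg)
  have "\<exists>V\<in>S. V < D + 1 / real (Suc n)" for n
    using cInf_lessD[OF ne, of "D + 1 / real (Suc n)"] by (auto simp: D_def)
  then obtain V where V: "\<And>n. V n \<in> S" "\<And>n. V n < D + 1 / real (Suc n)" by metis
  then obtain \<kappa> where \<kappa>: "\<And>n. qcurve \<Omega> (V n) (\<kappa> n)" "\<And>n. \<kappa> n 0 = x" "\<And>n. \<kappa> n (V n) = y"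
    unfolding S_def by simp metis
  have V_ge: "D \<le> V n" for n using D_le V(1) by blast
  have V_le: "V n \<le> D + 1" for n
  proof -
    have "1 / real (Suc n) \<le> 1" by simp
    with V(2)[of n] show ?thesis by linarith
  qed
  have V0: "0 \<le> V n" for n using V_ge D0 order_trans by blast
  \<comment> \<open>Almost minimal curves rest at \<open>y\<close> after time \<open>V n\<close>, so
    that all of them are defined on \<open>{0..D + 1}\<close>.\<close>
  have q: "qcurve \<Omega> (D + 1) (\<lambda>t. \<kappa> n (min t (V n)))" for n
    by (rule qcurve_reparam[OF \<kappa>(1)]) (use D0 V0[of n] in auto)
  have "\<kappa> n (min 0 (V n)) = x" for n using V0[of n] \<kappa>(2) by (simp add: min_def)
  from qcurve_limit[OF \<Omega>, of "D + 1" "\<lambda>n t. \<kappa> n (min t (V n))", OF q this]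
  obtain \<mu> k where \<mu>: "qcurve \<Omega> (D + 1) \<mu>" "strict_mono (k :: nat \<Rightarrow> nat)"
    "\<And>t. t \<in> {0..D + 1} \<Longrightarrow> (\<lambda>n. \<kappa> (k n) (min t (V (k n)))) \<longlonglongrightarrow> \<mu> t" by blast
  have "\<mu> 0 = x" using \<mu>(3)[of 0] D0 V0 \<kappa>(2) by (auto simp: LIMSEQ_const_iff min_def)
  moreover have "\<mu> D = y"
  proof (rule LIMSEQ_unique)
    show "(\<lambda>n. \<kappa> (k n) D) \<longlonglongrightarrow> \<mu> D" using \<mu>(3)[of D] D0 V_ge by (simp add: min_absorb1)
    \<comment> \<open>The common Lipschitz constant compares the value at \<open>D\<close> with the
      end value \<open>y\<close> at \<open>V (k n)\<close>, which tends to \<open>D\<close>.\<close>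
    define C where "C = bdist \<Omega> x * exp (2 * (D + 1))"
    have Vlim: "V \<longlonglongrightarrow> D"
    proof (rule tendsto_sandwich[where f = "\<lambda>_. D"])
      show "(\<lambda>n. D + 1 / real (Suc n)) \<longlonglongrightarrow> D"
        using tendsto_add[OF tendsto_const[of D] LIMSEQ_inverse_real_of_nat] by (simp add: field_simps)
      show "\<forall>\<^sub>F n in sequentially. V n \<le> D + 1 / real (Suc n)"
        using less_imp_le[OF V(2)] by (rule always_eventually[OF allI])
    qed (use V_ge in auto)
    have "(\<lambda>n. C * \<bar>D - V (k n)\<bar>) \<longlonglongrightarrow> C * \<bar>D - D\<bar>"
      using LIMSEQ_subseq_LIMSEQ[OF Vlim \<mu>(2)] by (intro tendsto_intros) (simp add: o_def)
    then have "(\<lambda>n. C * \<bar>D - V (k n)\<bar>) \<longlonglongrightarrow> 0" by simp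
    moreover have "dist (\<kappa> (k n) D) y \<le> C * \<bar>D - V (k n)\<bar>" for n
      using qcurve_lipschitz[OF \<kappa>(1)[of "k n"] V_le[of "k n"], of D "V (k n)"] D0 V_ge[of "k n"] V0
      by (simp add: \<kappa> C_def)
    ultimately show "(\<lambda>n. \<kappa> (k n) D) \<longlonglongrightarrow> y"
      by (subst tendsto_dist_iff) (rule tendsto_sandwich[of "\<lambda>_. 0" _ _ "\<lambda>n. C * \<bar>D - V (k n)\<bar>"], auto)
  qed
  moreover have "qcurve \<Omega> D \<mu>"
    using qcurve_reparam[OF \<mu>(1) D0, of "\<lambda>t. t"] by auto
  moreover have "D \<le> V" if "qcurve \<Omega> V \<nu>" "\<nu> 0 = x" "\<nu> V = y" for V \<nu>
    using that by (intro D_le) (auto simp: S_def)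
  ultimately show ?thesis unfolding minimal_qcurve_def by blast
qed

text \<open>The factorization theorem makes \<open>D\<close> a lower bound for all lengths, and
  \<open>qcurve_rectifiable\<close> shows that the minimal curve attains it.\<close>

lemma minimal_qcurve_qh_dist:
  assumes \<Omega>: "open \<Omega>" "frontier \<Omega> \<noteq> {}" and m: "minimal_qcurve \<Omega> x y D \<kappa>"
  shows "qh_dist \<Omega> x y = D" and "qh_geodesic \<Omega> x y (\<lambda>t. \<kappa> (D * t))"
proof -
  define p where "p t = \<kappa> (D * t)" for t
  have q: "qcurve \<Omega> D \<kappa>" "\<kappa> 0 = x" "\<kappa> D = y"
    and min: "\<And>V \<mu>. qcurve \<Omega> V \<mu> \<Longrightarrow> \<mu> 0 = x \<Longrightarrow> \<mu> V = y \<Longrightarrow> D \<le> V"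
    using m unfolding minimal_qcurve_def by blast+
  have ge: "D \<le> qh_length \<Omega> \<gamma>" if \<gamma>: "rectifiable_joining \<Omega> x y \<gamma>" for \<gamma>
  proof -
    have r: "rectifiable_path \<gamma>" "path_image \<gamma> \<subseteq> \<Omega>" "\<gamma> 0 = x" "\<gamma> 1 = y"
      using \<gamma> by (auto simp: rectifiable_joining_def pathstart_def pathfinish_def)
    obtain \<mu> \<Lambda> where "qcurve \<Omega> (qh_length \<Omega> \<gamma>) \<mu>" "\<Lambda> 0 = 0" "\<Lambda> 1 = qh_length \<Omega> \<gamma>"
      "\<And>t. t \<in> {0..1} \<Longrightarrow> \<gamma> t = \<mu> (\<Lambda> t)"
      using rectifiable_qcurve_factorization[OF \<Omega> r(1,2)] by metis
    then show ?thesis using r(3,4) by (intro min[of _ \<mu>]) force+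
  qed
  have j: "rectifiable_joining \<Omega> x y p" and le: "qh_length \<Omega> p \<le> D"
    using qcurve_rectifiable[OF \<Omega> q(1)] q(2,3) unfolding p_def by simp_all
  have eq: "qh_length \<Omega> p = D" using ge[OF j] le by simp
  show d: "qh_dist \<Omega> x y = D" unfolding qh_dist_def
    by (rule cInf_eq_minimum) (use j eq ge in auto)
  show "qh_geodesic \<Omega> x y (\<lambda>t. \<kappa> (D * t))" using j eq d unfolding qh_geodesic_def p_def by simp
qed

text \<open>Every geodesic factors through a minimal curve on the same interval
  \<open>{0..D}\<close>. If that curve is always \<open>\<kappa>\<close>, then
  \<open>\<kappa>\<close>, rescaled to the unit interval, is the third path that
  \<open>same_up_to_parametrization\<close> asks for.\<close>

theorem unique_qh_geodesicI:
  assumes \<Omega>: "open \<Omega>" "frontier \<Omega> \<noteq> {}" and m: "minimal_qcurve \<Omega> x y D \<kappa>"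
    and unique: "\<And>\<mu> t. minimal_qcurve \<Omega> x y D \<mu> \<Longrightarrow> t \<in> {0..D} \<Longrightarrow> \<mu> t = \<kappa> t"
  shows "unique_qh_geodesic \<Omega> x y"
  unfolding unique_qh_geodesic_def
proof (intro exI conjI allI impI)
  note d = minimal_qcurve_qh_dist[OF \<Omega> m]
  show "qh_geodesic \<Omega> x y (\<lambda>t. \<kappa> (D * t))" by (rule d(2))
  have D: "D \<ge> 0" using m qcurve_nonneg by (auto simp: minimal_qcurve_def)
  have "rectifiable_joining \<Omega> x y (\<lambda>t. \<kappa> (D * t))" using d(2) by (simp add: qh_geodesic_def)
  then have path: "path (\<lambda>t. \<kappa> (D * t))" by (simp add: rectifiable_joining_def rectifiable_path_def)
  fix \<eta> assume \<eta>: "qh_geodesic \<Omega> x y \<eta>"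
  then have r: "rectifiable_path \<eta>" "path_image \<eta> \<subseteq> \<Omega>" "\<eta> 0 = x" "\<eta> 1 = y" and len: "qh_length \<Omega> \<eta> = D"
    using d(1) by (auto simp: qh_geodesic_def rectifiable_joining_def pathstart_def pathfinish_def)
  obtain \<mu> \<Lambda> where \<mu>: "qcurve \<Omega> D \<mu>" and \<Lambda>: "continuous_on {0..1} \<Lambda>" "mono_on {0..1} \<Lambda>" "\<Lambda> 0 = 0" "\<Lambda> 1 = D"
    and \<eta>_eq: "\<And>t. t \<in> {0..1} \<Longrightarrow> \<eta> t = \<mu> (\<Lambda> t)"
    using rectifiable_qcurve_factorization[OF \<Omega> r(1,2)] len by metis
  have "minimal_qcurve \<Omega> x y D \<mu>"
    using m \<mu> \<eta>_eq[of 0] \<eta>_eq[of 1] \<Lambda> r by (auto simp: minimal_qcurve_def)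
  then have \<mu>\<kappa>: "\<mu> t = \<kappa> t" if "t \<in> {0..D}" for t using unique that by blast
  have \<Lambda>_in: "\<Lambda> t \<in> {0..D}" if "t \<in> {0..1}" for t
    using mono_onD[OF \<Lambda>(2), of 0 t] mono_onD[OF \<Lambda>(2), of t 1] that \<Lambda>(3,4) by auto
  \<comment> \<open>For \<open>D = 0\<close> the quotient would be constantly 0 and miss the end
    value 1; the curve is then constant and the identity serves.\<close>
  define \<psi> where "\<psi> t = (if D = 0 then t else \<Lambda> t / D)" for t
  have "parameter_change \<psi>"
  proof (cases "D = 0")
    case True then show ?thesis by (auto simp: parameter_change_def \<psi>_def mono_on_def)
  next
    case False
    with D \<Lambda> show ?thesis
      by (auto simp: parameter_change_def \<psi>_def mono_on_def intro!: continuous_intros divide_right_mono)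
  qed
  moreover have "\<eta> t = \<kappa> (D * \<psi> t)" if "t \<in> {0..1}" for t
    using \<eta>_eq[OF that] \<mu>\<kappa>[OF \<Lambda>_in[OF that]] \<Lambda>_in[OF that] by (auto simp: \<psi>_def)
  moreover have "parameter_change (\<lambda>t. t)" by (auto simp: parameter_change_def mono_on_def)
  ultimately show "same_up_to_parametrization (\<lambda>t. \<kappa> (D * t)) \<eta>"
    unfolding same_up_to_parametrization_def using path
    by (intro exI[of _ "\<lambda>t. \<kappa> (D * t)"] exI[of _ "\<lambda>t. t"] exI[of _ \<psi>]) auto
qed

section \<open>The harmonic majorant on a Jordan domain\<close>

text \<open>In \<open>Re x * Re y = Re ((x * y + x * cnj y) / 2)\<close> the relation
  \<open>z * cnj z = r^2\<close> turns the mixed term into a multiple of a power of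
  \<open>z\<close>, if the smaller exponent is the conjugated one. This is the closure under
  products that Stone-Weierstrass requires.\<close>

lemma re_poly_mult_on_circle:
  assumes "\<And>z. z \<in> sphere 0 r \<Longrightarrow> f z = Re (poly p z)" "\<And>z. z \<in> sphere 0 r \<Longrightarrow> g z = Re (poly q z)"
  shows "\<exists>s. \<forall>z\<in>sphere 0 r. f z * g z = Re (poly s z)"
proof -
  define T where "T h \<longleftrightarrow> (\<exists>s. \<forall>z\<in>sphere 0 r. h z = Re (poly s z))" for h :: "complex \<Rightarrow> real"
  have T_sum: "T (\<lambda>z. \<Sum>i\<in>I. h i z)" if "finite I" "\<And>i. i \<in> I \<Longrightarrow> T (h i)" for I :: "nat set" and h
    using that
  proof (induction I)
    case empty then show ?case by (auto simp: T_def intro: exI[of _ 0])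
  next
    case (insert i I)
    then obtain s t where "\<forall>z\<in>sphere 0 r. h i z = Re (poly s z)" "\<forall>z\<in>sphere 0 r. (\<Sum>i\<in>I. h i z) = Re (poly t z)"
      unfolding T_def by (metis insertCI)
    with insert.hyps show ?case unfolding T_def by (intro exI[of _ "s + t"]) auto
  qed
  have Re_mult_Re: "Re x * Re y = Re ((x * y + x * cnj y) / 2)" for x y by (simp add: field_simps)
  have le: "T (\<lambda>z. Re (a * z ^ m) * Re (b * z ^ n))" if "n \<le> m" for a b m n
  proof -
    have "Re (a * z ^ m) * Re (b * z ^ n) =
        Re (poly (monom (a * b / 2) (m + n) + monom (a * cnj b * of_real (r ^ (2 * n)) / 2) (m - n)) z)"
      if z: "z \<in> sphere 0 r" for z
    proof -
      have "z * cnj z = of_real (r ^ 2)" using z by (simp add: complex_norm_square[symmetric])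
      then have zz: "z ^ n * cnj z ^ n = of_real (r ^ (2 * n))"
        by (simp add: power_mult_distrib[symmetric] power_mult)
      have "z ^ m = z ^ (m - n) * z ^ n" using \<open>n \<le> m\<close> by (simp add: power_add[symmetric])
      then have "a * z ^ m * cnj (b * z ^ n) = a * cnj b * z ^ (m - n) * (z ^ n * cnj z ^ n)" by (simp add: mult_ac)
      then have "a * z ^ m * cnj (b * z ^ n) = a * cnj b * of_real (r ^ (2 * n)) * z ^ (m - n)" unfolding zz by (simp only: mult_ac)
      moreover have "Re (a * z ^ m) * Re (b * z ^ n) =
         Re ((a * z ^ m * (b * z ^ n) + a * z ^ m * cnj (b * z ^ n)) / 2)" by (rule Re_mult_Re)
      moreover have "poly (monom (a * b / 2) (m + n) + monom (a * cnj b * of_real (r ^ (2 * n)) / 2) (m - n)) z =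
          (a * z ^ m * (b * z ^ n) + a * cnj b * of_real (r ^ (2 * n)) * z ^ (m - n)) / 2"
        by (simp add: poly_monom power_add mult_ac add_divide_distrib)
      ultimately show ?thesis by (simp only:)
    qed
    then show ?thesis unfolding T_def by blast
  qed
  have mono: "T (\<lambda>z. Re (a * z ^ m) * Re (b * z ^ n))" for a b m n
    using le[of n m a b] le[of m n b a] by (cases "n \<le> m") (auto simp: mult.commute)
  have "T (\<lambda>z. \<Sum>i\<in>{..degree p}. \<Sum>j\<in>{..degree q}. Re (coeff p i * z ^ i) * Re (coeff q j * z ^ j))"
    by (intro T_sum mono) auto
  moreover have "f z * g z = (\<Sum>i\<in>{..degree p}. \<Sum>j\<in>{..degree q}. Re (coeff p i * z ^ i) * Re (coeff q j * z ^ j))"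
    if "z \<in> sphere 0 r" for z
    using assms that by (simp add: poly_altdef Re_sum sum_product del: times_complex.simps)
  ultimately show ?thesis unfolding T_def by auto
qed

lemma real_polynomial_function_eq_Re_poly_on_circle:
  fixes f :: "complex \<Rightarrow> real"
  assumes "real_polynomial_function f"
  shows "\<exists>p. \<forall>z\<in>sphere 0 r. f z = Re (poly p z)"
  using assms
proof (induction rule: real_polynomial_function.induct)
  case (linear f)
  then interpret bounded_linear f .
  have "f z = Re (poly [:0, Complex (f 1) (- f \<i>):] z)" for z
  proof -
    have "z = Re z *\<^sub>R 1 + Im z *\<^sub>R \<i>" by (simp add: complex_eq_iff)
    then have "f z = Re z * f 1 + Im z * f \<i>" by (metis add scaleR real_scaleR_def)
    then show ?thesis by (simp add: mult.commute)
  qed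
  then show ?case by blast
next
  case (const c)
  then show ?case by (intro exI[of _ "[:of_real c:]"]) auto
next
  case (add f g)
  then obtain p q where "\<forall>z\<in>sphere 0 r. f z = Re (poly p z)" "\<forall>z\<in>sphere 0 r. g z = Re (poly q z)" by blast
  then show ?case by (intro exI[of _ "p + q"]) auto
next
  case (mult f g)
  then obtain p q where "\<forall>z\<in>sphere 0 r. f z = Re (poly p z)" "\<forall>z\<in>sphere 0 r. g z = Re (poly q z)" by blast
  then show ?case using re_poly_mult_on_circle[of r f p g q] by blast
qed

text \<open>A substitute for the Poisson integral: the real part of a polynomial is harmonic in the
  disc, so the Dirichlet problem is solved up to the error \<open>e\<close>.\<close>

lemma Re_poly_approx_on_circle:
  fixes v :: "complex \<Rightarrow> real"
  assumes "continuous_on (sphere 0 r) v" "e > 0"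
  obtains p where "\<And>z. z \<in> sphere 0 r \<Longrightarrow> \<bar>v z - Re (poly p z)\<bar> < e"
  using Stone_Weierstrass_real_polynomial_function[OF compact_sphere assms]
    real_polynomial_function_eq_Re_poly_on_circle by metis

text \<open>The logarithm of \<open>1 / bdist \<Omega>\<close> is a supremum of the harmonic functions
  \<open>z \<mapsto> - ln |z - p|\<close>, hence satisfies the maximum principle relative to \<open>ln |g|\<close>.\<close>

lemma bdist_maximum_principle:
  fixes \<Omega> :: "complex set"
  assumes \<Omega>: "open \<Omega>" "frontier \<Omega> \<noteq> {}" and U: "bounded U" "closure U \<subseteq> \<Omega>"
    and g: "g holomorphic_on W" "open W" "closure U \<subseteq> W" "\<And>w. w \<in> W \<Longrightarrow> g w \<noteq> 0"
    and fr: "\<And>w. w \<in> frontier U \<Longrightarrow> 1 \<le> norm (g w) * bdist \<Omega> w" and z: "z \<in> closure U"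
  shows "1 \<le> norm (g z) * bdist \<Omega> z"
proof (cases "z \<in> U")
  case False
  with z have "z \<in> frontier U" using interior_subset by (auto simp: frontier_def)
  then show ?thesis by (rule fr)
next
  case True
  \<comment> \<open>Of all harmonic functions in the supremum, the one of a boundary point nearest
    to \<open>z\<close> suffices: it gives equality at \<open>z\<close> and an inequality in the
    right direction on the frontier.\<close>
  obtain p where p: "p \<in> frontier \<Omega>" "bdist \<Omega> z = dist z p"
    using infdist_attains_inf[OF frontier_closed \<Omega>(2)] by metis
  have "p \<notin> \<Omega>" using p(1) \<Omega>(1) by (simp add: frontier_def interior_open)
  then have ne: "w - p \<noteq> 0" if "w \<in> closure U" for w using that U by auto
  define h where "h w = 1 / (g w * (w - p))" for w
  have "norm (h z) \<le> 1"
  proof (rule maximum_modulus_frontier[of h U])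
    have sub: "interior U \<subseteq> closure U" using interior_subset closure_subset by blast
    show "h holomorphic_on interior U" unfolding h_def
      by (intro holomorphic_intros holomorphic_on_subset[OF g(1)]) (use sub g ne in fastforce)+
    show "continuous_on (closure U) h" unfolding h_def
      by (intro continuous_intros continuous_on_subset[OF holomorphic_on_imp_continuous_on[OF g(1)]])
        (use g ne in auto)
    fix w assume w: "w \<in> frontier U"
    have "bdist \<Omega> w \<le> norm (w - p)" using infdist_le[OF p(1), of w] by (simp add: dist_norm)
    then have "norm (g w) * bdist \<Omega> w \<le> norm (g w) * norm (w - p)" by (intro mult_left_mono) auto
    with fr[OF w] have "1 \<le> norm (g w * (w - p))" by (simp add: norm_mult)
    then show "norm (h w) \<le> 1" unfolding h_def norm_divide
      by (subst divide_le_eq_1_pos) auto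
  qed (use U True in auto)
  moreover have "g z * (z - p) \<noteq> 0" using g ne z by auto
  ultimately show ?thesis using p(2) by (simp add: h_def norm_divide norm_mult dist_norm)
qed

section \<open>Topology of closed Jordan domains\<close>

text \<open>The part of the complement of \<open>N\<close> in a large disc is covered by finitely
  many small discs off \<open>K\<close>, and each is tied to the outside by a path in the connected
  set \<open>- K\<close>. Together with the outside they form a closed connected set
  \<open>E\<close>. The component of \<open>- E\<close> around \<open>K\<close> has connected
  complement and is bounded, hence simply connected.\<close>

lemma simply_connected_neighbourhood:
  fixes K N :: "complex set"
  assumes K: "compact K" "connected K" "K \<noteq> {}" "connected (- K)" and N: "open N" "K \<subseteq> N"
  obtains D where "open D" "simply_connected D" "K \<subseteq> D" "D \<subseteq> N"
proof -
  obtain R where R: "K \<subseteq> ball 0 R" using K(1) compact_imp_bounded bounded_subset_ballD by blast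
  define q :: complex where "q = of_real \<bar>R\<bar>"
  have q: "q \<notin> ball 0 R" by (simp add: q_def)
  have pc: "path_connected (- K)"
    using K by (intro connected_open_path_connected) (auto simp: compact_imp_closed open_Compl)
  define C0 where "C0 = (- N) \<inter> cball 0 R"
  have C0: "compact C0" "C0 \<inter> K = {}" using N by (auto simp: C0_def intro!: closed_Int_compact)
  obtain \<delta> where \<delta>: "\<delta> > 0" "\<And>c w. c \<in> C0 \<Longrightarrow> dist c w \<le> \<delta> \<Longrightarrow> w \<notin> K"
  proof (cases "C0 = {}")
    case True then show ?thesis using that[of 1] by auto
  next
    case False
    have pos: "setdist C0 K > 0"
      using setdist_gt_0_compact_closed[OF C0(1) compact_imp_closed[OF K(1)]] False K(3) C0(2) by auto
    show ?thesis
    proof (rule that[of "setdist C0 K / 2"])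
      fix c w assume "c \<in> C0" "dist c w \<le> setdist C0 K / 2"
      then show "w \<notin> K" using setdist_le_dist[of c C0 w K] pos by fastforce
    qed (use pos in auto)
  qed
  obtain F where F: "finite F" "F \<subseteq> C0" "C0 \<subseteq> (\<Union>c\<in>F. ball c \<delta>)"
  proof (rule compactE_image[OF C0(1), of C0 "\<lambda>c. ball c \<delta>"])
    show "C0 \<subseteq> (\<Union>c\<in>C0. ball c \<delta>)" using \<delta>(1) by force
  qed (use that in auto)
  have "\<exists>g. path g \<and> path_image g \<subseteq> - K \<and> pathstart g = c \<and> pathfinish g = q" if "c \<in> F" for c
  proof -
    have "c \<in> - K" using that F(2) C0(2) by blast
    moreover have "q \<in> - K" using q R by blast
    ultimately show ?thesis using pc unfolding path_connected_def by blast
  qed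
  then obtain P where P: "\<And>c. c \<in> F \<Longrightarrow> path (P c) \<and> path_image (P c) \<subseteq> - K \<and> pathstart (P c) = c \<and> pathfinish (P c) = q"
    by metis
  define E where "E = - ball 0 R \<union> (\<Union>c\<in>F. cball c \<delta> \<union> path_image (P c))"
  have "connected E"
  proof -
    have "connected (- ball (0::complex) R)" by (rule connected_complement_bounded_convex) auto
    moreover have "connected (cball c \<delta> \<union> path_image (P c))" if "c \<in> F" for c
    proof (intro connected_Un connected_path_image)
      have "c \<in> cball c \<delta> \<inter> path_image (P c)"
        using P[OF that] \<delta>(1) pathstart_in_path_image[of "P c"] by auto
      then show "cball c \<delta> \<inter> path_image (P c) \<noteq> {}" by blast
    qed (use P[OF that] in \<open>auto intro: convex_connected\<close>)
    moreover have "q \<in> cball c \<delta> \<union> path_image (P c)" if "c \<in> F" for c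
      using P[OF that] pathfinish_in_path_image[of "P c"] by auto
    moreover have "q \<in> \<Inter> (insert (- ball 0 R) ((\<lambda>c. cball c \<delta> \<union> path_image (P c)) ` F))"
      using q calculation(3) by blast
    ultimately have "connected (\<Union> (insert (- ball 0 R) ((\<lambda>c. cball c \<delta> \<union> path_image (P c)) ` F)))"
      by (intro connected_Union) blast+
    moreover have "E = \<Union> (insert (- ball 0 R) ((\<lambda>c. cball c \<delta> \<union> path_image (P c)) ` F))" by (auto simp: E_def)
    ultimately show ?thesis by simp
  qed
  have "closed E" unfolding E_def
    using F(1) P by (intro closed_Un closed_UN) (auto intro: closed_path_image)
  have KE: "K \<subseteq> - E" using R \<delta>(2) F(2) P by (fastforce simp: E_def)
  obtain k where k: "k \<in> K" using K(3) by auto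
  define D where "D = connected_component_set (- E) k"
  have "open D" unfolding D_def using \<open>closed E\<close> by (intro open_connected_component) auto
  have KD: "K \<subseteq> D" unfolding D_def using K(2) KE k by (intro connected_component_maximal) auto
  have DE: "D \<subseteq> - E" unfolding D_def by (rule connected_component_subset)
  have "D \<in> components (- E)" unfolding D_def components_def using k KE by blast
  then have "connected (- D)" by (rule component_complement_connected[OF \<open>connected E\<close>])
  moreover have "bounded D" using DE by (intro bounded_subset[OF bounded_ball[of 0 R]]) (auto simp: E_def)
  moreover have "connected D" by (simp add: D_def)
  ultimately have "simply_connected D" using simply_connected_iff_simple[OF \<open>open D\<close>] by simp
  moreover have "D \<subseteq> N"
  proof
    fix w assume w: "w \<in> D"
    with DE have "w \<notin> E" by blast
    then have w: "w \<in> ball 0 R" "\<And>c. c \<in> F \<Longrightarrow> w \<notin> cball c \<delta>" unfolding E_def by blast+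
    have "w \<notin> (\<Union>c\<in>F. ball c \<delta>)" using w(2) ball_subset_cball by blast
    with F(3) w(1) have "w \<in> ball 0 R" "w \<notin> C0" by blast+
    then show "w \<in> N" by (auto simp: C0_def)
  qed
  ultimately show ?thesis using that \<open>open D\<close> KD by blast
qed

lemma Jordan_domain:
  fixes j :: "real \<Rightarrow> complex"
  assumes j: "simple_path j" "pathfinish j = pathstart j"
  defines "J \<equiv> path_image j" and "I \<equiv> inside (path_image j)"
  shows "compact J" "open I" "connected I" "I \<noteq> {}" "bounded I" "frontier I = J" "closure I = I \<union> J"
    "compact (I \<union> J)" "connected (I \<union> J)" "- (I \<union> J) = outside J" "connected (- (I \<union> J))"
    "frontier (- (I \<union> J)) = J"
proof -
  note JC = Jordan_inside_outside[OF j]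
  show "compact J" unfolding J_def by (intro compact_path_image simple_path_imp_path j)
  show I: "open I" "connected I" "I \<noteq> {}" "bounded I" "frontier I = J" unfolding I_def J_def using JC by auto
  have "interior I = I" using I(1) by (rule interior_open)
  with I(5) show cl: "closure I = I \<union> J"
    using closure_subset[of I] interior_subset[of I] by (auto simp: frontier_def)
  then show "compact (I \<union> J)" using I(4) by (metis compact_closure)
  show "connected (I \<union> J)" using cl connected_imp_connected_closure[OF I(2)] by simp
  show c: "- (I \<union> J) = outside J" unfolding I_def J_def using JC by blast
  show "connected (- (I \<union> J))" unfolding c unfolding J_def using JC by auto
  show "frontier (- (I \<union> J)) = J" unfolding c unfolding J_def using JC by auto
qed

section \<open>Barriers at points of a Jordan curve\<close>

text \<open>Different values of \<open>f\<close> differ by a nonzero multiple of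
  \<open>2 * pi * \<i>\<close>, so the range is discrete.\<close>

lemma constant_if_exp_constant:
  fixes f :: "real \<Rightarrow> complex"
  assumes "connected S" "continuous_on S f" "\<And>s. s \<in> S \<Longrightarrow> exp (f s) = c"
  shows "f constant_on S"
proof (rule continuous_discrete_range_constant[OF assms(1,2)])
  fix x assume x: "x \<in> S"
  have "2 * pi \<le> norm (f y - f x)" if "y \<in> S \<and> f y \<noteq> f x" for y
  proof (rule ccontr)
    assume "\<not> ?thesis"
    then have "\<bar>Im (f y) - Im (f x)\<bar> < 2 * pi" using abs_Im_le_cmod[of "f y - f x"] by simp
    with exp_complex_eqI[OF this] assms(3) x that show False by auto
  qed
  then show "\<exists>e>0. \<forall>y. y \<in> S \<and> f y \<noteq> f x \<longrightarrow> e \<le> norm (f y - f x)"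
    by (intro exI[of _ "2 * pi"]) auto
qed

text \<open>The bound is uniform in \<open>\<zeta>\<close>: the quotient \<open>(j - \<zeta>) / (j - w)\<close> stays in the right half plane, so
  \<open>\<xi>\<close> differs from a fixed logarithm of \<open>j - w\<close> by a constant and a bounded term.\<close>

lemma arg_variation_bound:
  fixes j :: "real \<Rightarrow> complex"
  assumes j: "continuous_on {a..b} j" and \<eta>: "\<eta> > 0" "\<And>s. s \<in> {a..b} \<Longrightarrow> \<eta> \<le> dist (j s) w"
  shows "\<exists>B. \<forall>\<zeta> \<xi> c. dist \<zeta> w < \<eta> / 2 \<longrightarrow> continuous_on {a..b} \<xi> \<longrightarrow>
      (\<forall>s\<in>{a..b}. exp (\<xi> s) = (j s - \<zeta>) * c) \<longrightarrow>
      (\<forall>s\<in>{a..b}. \<forall>t\<in>{a..b}. \<bar>Im (\<xi> s) - Im (\<xi> t)\<bar> \<le> B)"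
proof -
  have "continuous_on {a..b} (\<lambda>s. j s - w)" by (intro continuous_intros j)
  moreover have "contractible {a..b}" by (intro convex_imp_contractible) auto
  moreover have "j s - w \<noteq> 0" if "s \<in> {a..b}" for s using \<eta>(2)[OF that] \<eta>(1) by auto
  ultimately obtain q where q: "continuous_on {a..b} q" "\<And>s. s \<in> {a..b} \<Longrightarrow> j s - w = exp (q s)"
    using continuous_logarithm_on_contractible[of "{a..b}" "\<lambda>s. j s - w"] by auto
  have "compact (q ` {a..b})" by (intro compact_continuous_image q) auto
  then obtain M where M: "\<And>s. s \<in> {a..b} \<Longrightarrow> norm (q s) \<le> M"
    by (meson compact_imp_bounded bounded_iff imageI)
  show ?thesis
  \<comment> \<open>\<open>2 * M\<close> comes from the fixed logarithm \<open>q\<close>, and one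
    \<open>pi\<close> from each of the two values of \<open>Ln\<close>.\<close>
  proof (intro exI[of _ "2 * M + 2 * pi"] allI impI ballI)
    fix \<zeta> \<xi> c s t
    assume \<zeta>: "dist \<zeta> w < \<eta> / 2" and \<xi>: "continuous_on {a..b} \<xi>"
      and ex': "\<forall>s\<in>{a..b}. exp (\<xi> s) = (j s - \<zeta>) * c" and st: "s \<in> {a..b}" "t \<in> {a..b}"
    note ex = ex'[rule_format]
    define r where "r u = 1 + (w - \<zeta>) / (j u - w)" for u
    have jw: "j u - w \<noteq> 0" "2 * norm (w - \<zeta>) < norm (j u - w)" if "u \<in> {a..b}" for u
      using \<eta>(2)[OF that] \<eta>(1) \<zeta> by (auto simp: dist_norm norm_minus_commute)
    have r: "Re (r u) > 0" if "u \<in> {a..b}" for u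
    proof -
      have "norm ((w - \<zeta>) / (j u - w)) < 1"
        using jw[OF that] norm_ge_zero[of "w - \<zeta>"] unfolding norm_divide by (subst divide_less_eq_1_pos) linarith+
      then show ?thesis using abs_Re_le_cmod[of "(w - \<zeta>) / (j u - w)"] by (simp add: r_def)
    qed
    have r': "r u = (j u - \<zeta>) / (j u - w)" if "u \<in> {a..b}" for u
      using jw(1)[OF that] by (simp add: r_def field_simps)
    define f where "f u = \<xi> u - q u - Ln (r u)" for u
    have "continuous_on {a..b} f" unfolding f_def r_def
      by (intro continuous_intros \<xi> q j continuous_on_Ln)
         (use jw r in \<open>auto simp: complex_nonpos_Reals_iff r_def[symmetric]\<close>, fastforce)
    moreover have "exp (f u) = c" if u: "u \<in> {a..b}" for u
    proof -
      have "r u \<noteq> 0" using r[OF u] by auto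
      then have "exp (f u) = ((j u - \<zeta>) * c) / (j u - w) / r u"
        by (simp add: f_def exp_diff ex[OF u] q(2)[OF u])
      moreover have "j u - \<zeta> \<noteq> 0" using r'[OF u] \<open>r u \<noteq> 0\<close> by auto
      moreover have "A * c / B / (A / B) = c" if "A \<noteq> 0" "B \<noteq> 0" for A B :: complex using that by simp
      ultimately show ?thesis unfolding r'[OF u] using jw(1)[OF u] by simp
    qed
    ultimately have "f constant_on {a..b}" by (intro constant_if_exp_constant[where c = c]) auto
    then have "f s = f t" using st unfolding constant_on_def by auto
    then have "\<xi> s - \<xi> t = (q s - q t) + (Ln (r s) - Ln (r t))" by (simp add: f_def algebra_simps)
    then have "Im (\<xi> s) - Im (\<xi> t) = Im (q s - q t) + (Im (Ln (r s)) - Im (Ln (r t)))"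
      by (metis minus_complex.simps(2) plus_complex.simps(2))
    moreover have "\<bar>Im (q s - q t)\<bar> \<le> 2 * M"
      using M[OF st(1)] M[OF st(2)] norm_triangle_ineq4[of "q s" "q t"] abs_Im_le_cmod[of "q s - q t"] by linarith
    moreover have "\<bar>Im (Ln (r u))\<bar> \<le> pi" if "u \<in> {a..b}" for u
    proof -
      have "r u \<noteq> 0" using r[OF that] by auto
      then show ?thesis using mpi_less_Im_Ln[of "r u"] Im_Ln_le_pi[of "r u"] by auto
    qed
    note this[OF st(1)] this[OF st(2)]
    ultimately show "\<bar>Im (\<xi> s) - Im (\<xi> t)\<bar> \<le> 2 * M + 2 * pi" by linarith
  qed
qed

text \<open>With \<open>X = - Re \<xi>\<close> and \<open>Y = Im \<xi>\<close> the expression is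
  \<open>X / (X^2 + Y^2)\<close>. The second bound makes the barrier small where \<open>X\<close> is
  large; the third keeps it off 0 where modulus and argument are controlled.\<close>

lemma Re_inverse_bounds:
  assumes "Re \<xi> \<le> - 1" 
  shows "0 \<le> - Re (1 / \<xi>)" "- Re (1 / \<xi>) \<le> 1 / (- Re \<xi>)"
    "\<lbrakk>- Re \<xi> \<le> L; \<bar>Im \<xi>\<bar> \<le> B\<rbrakk> \<Longrightarrow> 1 / (L\<^sup>2 + B\<^sup>2) \<le> - Re (1 / \<xi>)"
proof -
  define X Y where "X = - Re \<xi>" and "Y = Im \<xi>"
  have X: "X \<ge> 1" using assms by (simp add: X_def)
  have eq: "- Re (1 / \<xi>) = X / (X\<^sup>2 + Y\<^sup>2)" by (simp add: Re_divide X_def Y_def)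
  have pos: "X\<^sup>2 + Y\<^sup>2 > 0" using X by (intro add_pos_nonneg) auto
  show "0 \<le> - Re (1 / \<xi>)" unfolding eq using X pos by auto
  have "X / (X\<^sup>2 + Y\<^sup>2) \<le> X / X\<^sup>2" using X pos by (intro divide_left_mono) auto
  then show "- Re (1 / \<xi>) \<le> 1 / (- Re \<xi>)" unfolding eq using X by (simp add: X_def power2_eq_square)
  assume "- Re \<xi> \<le> L" "\<bar>Im \<xi>\<bar> \<le> B"
  then have "X\<^sup>2 \<le> L\<^sup>2" "Y\<^sup>2 \<le> B\<^sup>2" using X by (auto simp: X_def Y_def abs_le_square_iff[symmetric])
  then have "1 / (L\<^sup>2 + B\<^sup>2) \<le> 1 / (X\<^sup>2 + Y\<^sup>2)" using pos by (intro divide_left_mono) auto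
  also have "\<dots> \<le> X / (X\<^sup>2 + Y\<^sup>2)" using X pos by (intro divide_right_mono) auto
  finally show "1 / (L\<^sup>2 + B\<^sup>2) \<le> - Re (1 / \<xi>)" unfolding eq .
qed

text \<open>The barrier is \<open>- Re (1 / log ((z - \<zeta>) / R))\<close> for a point \<open>\<zeta>\<close> outside the curve and close to \<open>w\<close>:
  it is small at \<open>w\<close>, and away from \<open>w\<close> it is bounded below because the argument of \<open>z - \<zeta>\<close> is bounded
  on the curve.\<close>

lemma Jordan_domain_barrier_start:
  fixes j :: "real \<Rightarrow> complex" and u :: "complex \<Rightarrow> real"
  assumes j: "simple_path j" "pathfinish j = pathstart j"
    and u: "continuous_on (path_image j) u" and e: "e > 0"
  obtains D g where "open D" "path_image j \<union> inside (path_image j) \<subseteq> D" "g holomorphic_on D"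
    "\<And>z. z \<in> D \<Longrightarrow> g z \<noteq> 0" "\<And>z. z \<in> path_image j \<Longrightarrow> u z \<le> ln (norm (g z))"
    "ln (norm (g (j 0))) < u (j 0) + e"
proof -
  define w where "w = j 0"
  define J where "J = path_image j"
  define K where "K = inside J \<union> J"
  note JD = Jordan_domain[OF j, folded J_def, folded K_def]
  have w1: "j 1 = w" using j(2) by (simp add: w_def pathfinish_def pathstart_def)
  have wJ: "w \<in> J" by (auto simp: w_def J_def path_image_def)
  have path: "path j" using j(1) by (rule simple_path_imp_path)
  have contj: "continuous_on {0..1} j" using path by (simp add: path_def)
  obtain \<delta> where \<delta>: "\<delta> > 0" "\<And>z. z \<in> J \<Longrightarrow> dist z w < \<delta> \<Longrightarrow> u z < u w + e / 2"
  proof -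
    obtain d where "d > 0" "\<And>z. z \<in> J \<Longrightarrow> dist z w < d \<Longrightarrow> dist (u z) (u w) < e / 2"
      using u wJ e unfolding J_def continuous_on_iff by (metis half_gt_zero)
    moreover have "u z < u w + e / 2" if "dist (u z) (u w) < e / 2" for z
      using that unfolding dist_real_def by linarith
    ultimately show ?thesis by (intro that[of d]) auto
  qed
  obtain C where C: "C \<ge> 0" "\<And>z. z \<in> J \<Longrightarrow> u z \<le> u w + C"
  proof -
    have "compact (u ` J)" using u JD(1) by (auto simp: J_def intro: compact_continuous_image)
    then obtain M where "\<And>z. z \<in> J \<Longrightarrow> norm (u z) \<le> M" by (meson compact_imp_bounded bounded_iff imageI)
    then have M: "\<bar>u z\<bar> \<le> M" if "z \<in> J" for z using that by simp
    show ?thesis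
    proof (rule that[of "2 * M"])
      show "2 * M \<ge> 0" using M[OF wJ] by linarith
      show "u z \<le> u w + 2 * M" if "z \<in> J" for z using M[OF wJ] M[OF that] by linarith
    qed
  qed
  \<comment> \<open>The loop starts and ends at \<open>w\<close>, so both ends of the parameter
    interval are close to \<open>w\<close>; only the middle part relies on the argument
    bound.\<close>
  obtain \<sigma> where \<sigma>: "0 < \<sigma>" "\<sigma> < 1/2" "\<And>s. s \<in> {0..1} \<Longrightarrow> s \<notin> {\<sigma>..1 - \<sigma>} \<Longrightarrow> dist (j s) w < \<delta>"
  proof -
    obtain d1 where d1: "d1 > 0" "\<And>s. s \<in> {0..1} \<Longrightarrow> dist s 0 < d1 \<Longrightarrow> dist (j s) w < \<delta>"
      using contj \<delta>(1) unfolding continuous_on_iff w_def by (metis atLeastAtMost_iff order_refl zero_le_one)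
    obtain d2 where d2: "d2 > 0" "\<And>s. s \<in> {0..1} \<Longrightarrow> dist s 1 < d2 \<Longrightarrow> dist (j s) w < \<delta>"
      using contj \<delta>(1) w1 unfolding continuous_on_iff by (metis atLeastAtMost_iff order_refl zero_le_one)
    show ?thesis
      using d1 d2 by (intro that[of "min (1/4) (min d1 d2)"]) (auto simp: dist_real_def)
  qed
  obtain \<eta> where \<eta>: "\<eta> > 0" "\<And>s. s \<in> {\<sigma>..1 - \<sigma>} \<Longrightarrow> \<eta> \<le> dist (j s) w"
  proof -
    have "continuous_on {\<sigma>..1 - \<sigma>} (\<lambda>s. dist (j s) w)"
      using \<sigma> by (intro continuous_intros continuous_on_subset[OF contj]) auto
    then obtain s0 where s0: "s0 \<in> {\<sigma>..1 - \<sigma>}" "\<And>s. s \<in> {\<sigma>..1 - \<sigma>} \<Longrightarrow> dist (j s0) w \<le> dist (j s) w"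
      using continuous_attains_inf[of "{\<sigma>..1 - \<sigma>}" "\<lambda>s. dist (j s) w"] \<sigma> by auto
    have "j s0 \<noteq> j 0"
      using j(1) s0(1) \<sigma> unfolding simple_path_def loop_free_def by force
    then show ?thesis using that[of "dist (j s0) w"] s0(2) by (simp add: w_def)
  qed
  have contI: "continuous_on {\<sigma>..1 - \<sigma>} j"
    using \<sigma> by (intro continuous_on_subset[OF contj]) auto
  \<comment> \<open>\<open>B0\<close> is fixed before \<open>\<zeta>\<close>. This avoids a circle,
    as the constants derived from it decide how close \<open>\<zeta>\<close> must be to
    \<open>w\<close>.\<close>
  obtain B0 where B0: "\<forall>\<zeta> \<xi> c. dist \<zeta> w < \<eta> / 2 \<longrightarrow> continuous_on {\<sigma>..1 - \<sigma>} \<xi> \<longrightarrow>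
      (\<forall>s\<in>{\<sigma>..1 - \<sigma>}. exp (\<xi> s) = (j s - \<zeta>) * c) \<longrightarrow>
      (\<forall>s\<in>{\<sigma>..1 - \<sigma>}. \<forall>t\<in>{\<sigma>..1 - \<sigma>}. \<bar>Im (\<xi> s) - Im (\<xi> t)\<bar> \<le> B0)"
    using arg_variation_bound[OF contI \<eta>] ..
  obtain M where M: "M > 0" "\<And>z. z \<in> K \<Longrightarrow> dist z w \<le> M"
  proof -
    have "bounded K" using JD by (auto intro: compact_imp_bounded)
    then obtain M where "\<And>z. z \<in> K \<Longrightarrow> dist w z \<le> M" using bounded_any_center[of K w] by blast
    then show ?thesis using that[of "max M 1"] by (auto simp: dist_commute le_max_iff_disj)
  qed
  \<comment> \<open>Then \<open>dist z \<zeta> \<le> R / 4\<close> on \<open>K\<close>, and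
    \<open>1 / 4 < exp (- 1)\<close> leaves room for a neighbourhood of \<open>K\<close> on which
    the logarithm has real part at most \<open>- 1\<close>.\<close>
  define R where "R = 4 * (M + 1)"
  define B where "B = B0 + pi"
  define L where "L = ln (2 * R / \<delta>)"
  \<comment> \<open>A lower bound for the barrier on the curve away from \<open>w\<close>; the
    summand 1 keeps the denominator positive.\<close>
  define c where "c = 1 / (L\<^sup>2 + B\<^sup>2 + 1)"
  have c: "c > 0" unfolding c_def by (intro divide_pos_pos add_nonneg_pos add_nonneg_nonneg) auto
  have R: "R > 4" using M by (simp add: R_def)
  \<comment> \<open>Chosen such that \<open>C / c * (1 / X) < e / 2\<close>, which bounds the
    barrier term at \<open>w\<close>.\<close>
  define X where "X = 2 * C / (c * e) + 1"
  have X: "X \<ge> 1" using C c e by (simp add: X_def)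
  define r where "r = min (min (\<eta> / 2) (\<delta> / 2)) (min 1 (R * exp (- X)))"
  have r: "r > 0" using \<eta> \<delta> R by (simp add: r_def)
  obtain \<zeta> where \<zeta>: "\<zeta> \<notin> K" "dist \<zeta> w < r"
  proof -
    have "w \<in> closure (- K)" using JD(12) wJ unfolding frontier_def by blast
    then show ?thesis using that r unfolding closure_approachable by (metis ComplD)
  qed
  have \<zeta>r: "dist \<zeta> w < \<eta> / 2" "dist \<zeta> w < \<delta> / 2" "dist \<zeta> w < 1" "dist \<zeta> w < R * exp (- X)"
    using \<zeta>(2) by (auto simp: r_def)
  have near\<zeta>: "dist z \<zeta> \<le> R / 4" if "z \<in> K" for z
    using M(2)[OF that] \<zeta>r(3) dist_triangle2[of z \<zeta> w] by (simp add: R_def)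
  obtain D where D: "open D" "simply_connected D" "K \<subseteq> D" "D \<subseteq> ball \<zeta> (R * exp (-1)) - {\<zeta>}"
  proof (rule simply_connected_neighbourhood[of K "ball \<zeta> (R * exp (-1)) - {\<zeta>}"])
    have "exp 1 < (4::real)" using exp_le by simp
    then have "1 / 4 < exp (- 1 :: real)" by (simp add: exp_minus field_simps)
    then have "R / 4 < R * exp (- 1)" using R by (simp add: field_simps)
    then show "K \<subseteq> ball \<zeta> (R * exp (-1)) - {\<zeta>}" using near\<zeta> \<zeta>(1) by (force simp: dist_commute)
    show "open (ball \<zeta> (R * exp (- 1)) - {\<zeta>})" by (intro open_Diff) auto
  qed (use JD wJ in \<open>auto simp: K_def\<close>)
  define f where "f z = (z - \<zeta>) / of_real R" for z
  have f0: "f z \<noteq> 0" if "z \<in> D" for z using that D(4) R by (auto simp: f_def)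
  have "f holomorphic_on D" unfolding f_def using R by (intro holomorphic_intros) auto
  then obtain \<xi>0 where \<xi>0: "\<xi>0 holomorphic_on D" "\<And>z. z \<in> D \<Longrightarrow> f z = exp (\<xi>0 z)"
    using D(2) f0 unfolding simply_connected_eq_holomorphic_log[OF D(1)] by blast
  have mI: "1/2 \<in> {\<sigma>..1 - \<sigma>}" using \<sigma> by auto
  define m where "m = j (1/2)"
  have IJ: "j s \<in> J" if "s \<in> {\<sigma>..1 - \<sigma>}" for s using that \<sigma> by (auto simp: J_def path_image_def)
  have KJ: "J \<subseteq> K" by (auto simp: K_def)
  have mD: "m \<in> D" using IJ[OF mI] KJ D(3) by (auto simp: m_def)
  \<comment> \<open>Fixing the branch at the curve point \<open>m\<close> bounds the argument there
    by \<open>pi\<close>, hence along the middle part by \<open>B\<close>, for every position of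
    \<open>\<zeta>\<close>.\<close>
  define \<xi> where "\<xi> z = \<xi>0 z - \<xi>0 m + Ln (f m)" for z
  have \<xi>hol: "\<xi> holomorphic_on D" unfolding \<xi>_def by (intro holomorphic_intros \<xi>0)
  have \<xi>exp: "exp (\<xi> z) = f z" if "z \<in> D" for z
    using f0[OF mD] \<xi>0(2)[OF that] \<xi>0(2)[OF mD] by (simp add: \<xi>_def exp_add exp_diff)
  have Re\<xi>: "Re (\<xi> z) = ln (dist z \<zeta> / R)" if "z \<in> D" for z
  proof -
    have "exp (Re (\<xi> z)) = norm (f z)" using \<xi>exp[OF that] by (metis norm_exp_eq_Re)
    also have "\<dots> = dist z \<zeta> / R" using R by (simp add: f_def norm_divide dist_norm)
    finally show ?thesis by (metis ln_exp)
  qed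
  have Re\<xi>_le: "Re (\<xi> z) \<le> - 1" if "z \<in> D" for z
  proof -
    have "0 < dist z \<zeta>" "dist z \<zeta> < R * exp (- 1)" using that D(4) by (auto simp: dist_commute)
    then have "dist z \<zeta> / R \<le> exp (- 1)" "0 < dist z \<zeta> / R" using R by (simp_all add: field_simps)
    then have "ln (dist z \<zeta> / R) \<le> ln (exp (- 1))" by (subst ln_le_cancel_iff) auto
    then show ?thesis unfolding Re\<xi>[OF that] by simp
  qed
  have Im\<xi>: "\<bar>Im (\<xi> (j s))\<bar> \<le> B" if s: "s \<in> {\<sigma>..1 - \<sigma>}" for s
  proof -
    have sub: "j ` {\<sigma>..1 - \<sigma>} \<subseteq> D" using IJ KJ D(3) by blast
    have "continuous_on {\<sigma>..1 - \<sigma>} (\<lambda>s. \<xi> (j s))"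
      by (rule continuous_on_compose2[OF holomorphic_on_imp_continuous_on[OF \<xi>hol] _ sub])
        (use \<sigma> in \<open>auto intro: continuous_on_subset[OF contj]\<close>)
    moreover have "exp (\<xi> (j s)) = (j s - \<zeta>) * (1 / of_real R)" if "s \<in> {\<sigma>..1 - \<sigma>}" for s
      using \<xi>exp[of "j s"] sub that by (auto simp: f_def image_subset_iff)
    ultimately have "\<bar>Im (\<xi> (j s)) - Im (\<xi> (j (1/2)))\<bar> \<le> B0"
      using B0[rule_format, of \<zeta> "\<lambda>s. \<xi> (j s)" "1 / of_real R" s "1/2"] \<zeta>r(1) s mI by blast
    moreover have "\<xi> (j (1/2)) = Ln (f m)" by (simp add: \<xi>_def m_def)
    moreover have "\<bar>Im (Ln (f m))\<bar> \<le> pi" using mpi_less_Im_Ln[OF f0[OF mD]] Im_Ln_le_pi[OF f0[OF mD]] by auto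
    ultimately show ?thesis by (simp add: B_def)
  qed
  define b where "b z = - Re (1 / \<xi> z)" for z
  \<comment> \<open>In \<open>ln (norm (g z))\<close> the slack \<open>e / 2\<close> covers the
    growth of \<open>u\<close> near \<open>w\<close>, and the factor \<open>C / c\<close> raises the
    barrier term to at least \<open>C\<close> on the rest of the curve.\<close>
  define g where "g z = exp (of_real (u w + e / 2) - of_real (C / c) * (1 / \<xi> z))" for z
  have \<xi>0': "\<xi> z \<noteq> 0" if "z \<in> D" for z using Re\<xi>_le[OF that] by auto
  have ln_g: "ln (norm (g z)) = u w + e / 2 + C / c * b z" for z
  proof -
    have *: "Re (of_real x * y) = x * Re y" for x y by simp
    show ?thesis unfolding g_def norm_exp_eq_Re b_def ln_exp minus_complex.simps * Re_complex_of_real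
      by (simp only: diff_conv_add_uminus mult_minus_right)
  qed
  show ?thesis
  proof (rule that[of D g])
    show "path_image j \<union> inside (path_image j) \<subseteq> D" using D(3) by (auto simp: K_def J_def)
    show "g holomorphic_on D" unfolding g_def by (intro holomorphic_intros \<xi>hol) (use \<xi>0' in auto)
    show "u z \<le> ln (norm (g z))" if "z \<in> path_image j" for z
    proof -
      have zJ: "z \<in> J" using that by (simp add: J_def)
      then have zD: "z \<in> D" using KJ D(3) by blast
      note bb = Re_inverse_bounds[OF Re\<xi>_le[OF zD], folded b_def]
      show ?thesis
      proof (cases "dist z w < \<delta>")
        case True
        have "0 \<le> C / c * b z" using bb(1) C c by (intro mult_nonneg_nonneg) auto
        then show ?thesis using \<delta>(2)[OF zJ True] unfolding ln_g by linarith
      next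
        case False
        obtain s where s: "s \<in> {0..1}" "z = j s" using zJ unfolding J_def path_image_def by blast
        with \<sigma>(3) False have sI: "s \<in> {\<sigma>..1 - \<sigma>}" by blast
        have "\<delta> / 2 \<le> dist z \<zeta>" using False \<zeta>r(2) dist_triangle[of z w \<zeta>] by (simp add: dist_commute)
        then have "\<delta> / 2 / R \<le> dist z \<zeta> / R" using R by (intro divide_right_mono) auto
        then have "ln (\<delta> / 2 / R) \<le> ln (dist z \<zeta> / R)" using \<delta>(1) R by (intro ln_mono) auto
        moreover have "L = - ln (\<delta> / 2 / R)" using \<delta>(1) R by (simp add: L_def ln_div ln_mult)
        ultimately have "- Re (\<xi> z) \<le> L" unfolding Re\<xi>[OF zD] by linarith
        moreover have "\<bar>Im (\<xi> z)\<bar> \<le> B" using Im\<xi>[OF sI] s(2) by simp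
        ultimately have "1 / (L\<^sup>2 + B\<^sup>2) \<le> b z" by (rule bb(3))
        moreover have "c \<le> 1 / (L\<^sup>2 + B\<^sup>2)"
        proof (cases "L\<^sup>2 + B\<^sup>2 = 0")
          case True
          have "- Re (\<xi> z) \<le> 0" using \<open>- Re (\<xi> z) \<le> L\<close> True by (simp add: sum_power2_eq_zero_iff)
          with Re\<xi>_le[OF zD] show ?thesis by linarith
        next
          case False
          moreover have "0 \<le> L\<^sup>2 + B\<^sup>2" by simp
          ultimately have "L\<^sup>2 + B\<^sup>2 > 0" by linarith
          then show ?thesis unfolding c_def by (intro divide_left_mono) auto
        qed
        ultimately have "c \<le> b z" by linarith
        then have "C / c * c \<le> C / c * b z" using C c by (intro mult_left_mono) auto
        then have "C \<le> C / c * b z" using c by simp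
        then show ?thesis using C(2)[OF zJ] e unfolding ln_g by linarith
      qed
    qed
    show "ln (norm (g (j 0))) < u (j 0) + e"
    proof -
      have wD: "w \<in> D" using wJ KJ D(3) by blast
      have pos: "0 < dist w \<zeta>" using wD D(4) by auto
      have "dist w \<zeta> / R \<le> exp (- X)" using \<zeta>r(4) R by (simp add: dist_commute field_simps)
      then have "ln (dist w \<zeta> / R) \<le> ln (exp (- X))" using pos R by (subst ln_le_cancel_iff) auto
      then have "X \<le> - Re (\<xi> w)" unfolding Re\<xi>[OF wD] by simp
      then have "1 / (- Re (\<xi> w)) \<le> 1 / X" using X by (intro divide_left_mono mult_pos_pos) auto
      with Re_inverse_bounds(2)[OF Re\<xi>_le[OF wD]] have "b w \<le> 1 / X" by (simp add: b_def)
      then have "C / c * b w \<le> C / c * (1 / X)" using C c by (intro mult_left_mono) auto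
      also have "\<dots> < e / 2"
      proof -
        have "2 * C < c * e * X" using c e by (simp add: X_def algebra_simps)
        then show ?thesis using c X by (simp add: field_simps)
      qed
      finally show ?thesis unfolding ln_g w_def[symmetric] by linarith
    qed
  qed (use D(1) in \<open>auto simp: g_def\<close>)
qed

lemma Jordan_domain_barrier:
  fixes j :: "real \<Rightarrow> complex" and u :: "complex \<Rightarrow> real"
  assumes j: "simple_path j" "pathfinish j = pathstart j"
    and u: "continuous_on (path_image j) u" and e: "e > 0" and w: "w \<in> path_image j"
  obtains D g where "open D" "path_image j \<union> inside (path_image j) \<subseteq> D" "g holomorphic_on D"
    "\<And>z. z \<in> D \<Longrightarrow> g z \<noteq> 0" "\<And>z. z \<in> path_image j \<Longrightarrow> u z \<le> ln (norm (g z))"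
    "ln (norm (g w)) < u w + e"
proof -
  obtain a where a: "a \<in> {0..1}" "w = j a" using w by (auto simp: path_image_def)
  define k where "k = shiftpath a j"
  have k: "simple_path k" "pathfinish k = pathstart k" "path_image k = path_image j" "k 0 = w"
  proof -
    show "simple_path k" "path_image k = path_image j" using a j unfolding k_def
      by (simp_all add: simple_path_shiftpath path_image_shiftpath)
    show "pathfinish k = pathstart k" using a j unfolding k_def
      by (simp add: pathfinish_shiftpath pathstart_shiftpath)
    show "k 0 = w" using a by (simp add: k_def shiftpath_def)
  qed
  from Jordan_domain_barrier_start[OF k(1,2), unfolded k(3,4), OF u e] that show ?thesis by blast
qed

section \<open>The majorant up to a factor close to 1\<close>

text \<open>The Riemann map of a slightly larger simply connected \<open>D\<close> reduces the
  Dirichlet problem to a circle around the image of \<open>K\<close>. Its solution is close to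
  \<open>u\<close> only on the boundary of \<open>U\<close>, which surrounds the curve. The lower
  bound moves inwards by the maximum principle; the upper bound on \<open>J\<close> needs barriers:
  finitely many dominate \<open>u - e\<close> on all of \<open>D\<close>, and at each point of
  \<open>J\<close> one of them is close to \<open>u\<close>.\<close>

lemma flat_majorant_on_Jordan_domain:
  fixes \<Omega> :: "complex set" and j :: "real \<Rightarrow> complex"
  assumes \<Omega>: "open \<Omega>" "frontier \<Omega> \<noteq> {}"
    and j: "simple_path j" "pathfinish j = pathstart j" "path_image j \<union> inside (path_image j) \<subseteq> \<Omega>"
    and \<eta>: "\<eta> > 0"
  obtains D G where "open D" "path_image j \<union> inside (path_image j) \<subseteq> D" "G holomorphic_on D"
    "\<And>z. z \<in> path_image j \<union> inside (path_image j) \<Longrightarrow> 1 \<le> norm (deriv G z) * bdist \<Omega> z"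
    "\<And>z. z \<in> path_image j \<Longrightarrow> norm (deriv G z) * bdist \<Omega> z \<le> 1 + \<eta>"
proof -
  define J where "J = path_image j"
  define I where "I = inside (path_image j)"
  define K where "K = I \<union> J"
  note JD = Jordan_domain[OF j(1,2), folded I_def, folded J_def, folded K_def]
  have K\<Omega>: "K \<subseteq> \<Omega>" using j(3) by (auto simp: K_def J_def I_def)
  have JK: "J \<subseteq> K" "I \<subseteq> K" by (auto simp: K_def)
  have bpos: "bdist \<Omega> z > 0" if "z \<in> \<Omega>" for z using bdist_pos[OF \<Omega> that] .
  \<comment> \<open>Four errors are spent: one to raise \<open>f\<close> to \<open>F\<close>, two in
    comparing \<open>f\<close> with a barrier on the boundary of \<open>U\<close>, and one for the
    barrier at \<open>z\<close>.\<close>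
  define e where "e = ln (1 + \<eta>) / 4"
  have e: "e > 0" using \<eta> by (simp add: e_def)
  have e4: "exp (4 * e) = 1 + \<eta>" using \<eta> by (simp add: e_def)
  define u where "u z = - ln (bdist \<Omega> z)" for z
  have u: "continuous_on \<Omega> u" unfolding u_def
    by (intro continuous_intros) (use bpos in force)
  define P where "P w D g \<longleftrightarrow> open D \<and> K \<subseteq> D \<and> g holomorphic_on D \<and> (\<forall>z\<in>D. g z \<noteq> 0) \<and>
      (\<forall>z\<in>J. u z \<le> ln (norm (g z))) \<and> ln (norm (g w)) < u w + e" for w :: complex and D g
  have "\<exists>D g. P w D g" if "w \<in> J" for w
  proof -
    have cu: "continuous_on (path_image j) u" using JK K\<Omega> by (intro continuous_on_subset[OF u]) (auto simp: J_def)
    have wj: "w \<in> path_image j" using that by (simp add: J_def)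
    show ?thesis
    proof (rule Jordan_domain_barrier[OF j(1,2) cu e wj])
      fix D g assume "open D" "path_image j \<union> inside (path_image j) \<subseteq> D" "g holomorphic_on D"
        "\<And>z. z \<in> D \<Longrightarrow> g z \<noteq> 0" "\<And>z. z \<in> path_image j \<Longrightarrow> u z \<le> ln (norm (g z))"
        "ln (norm (g w)) < u w + e"
      then have "P w D g" unfolding P_def K_def J_def I_def by auto
      then show ?thesis by blast
    qed
  qed
  then obtain E g where "\<And>w. w \<in> J \<Longrightarrow> P w (E w) (g w)" by metis
  then have E: "\<And>w. w \<in> J \<Longrightarrow> open (E w)" "\<And>w. w \<in> J \<Longrightarrow> K \<subseteq> E w"
    and g: "\<And>w. w \<in> J \<Longrightarrow> g w holomorphic_on E w" "\<And>w z. w \<in> J \<Longrightarrow> z \<in> E w \<Longrightarrow> g w z \<noteq> 0"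
      "\<And>w z. w \<in> J \<Longrightarrow> z \<in> J \<Longrightarrow> u z \<le> ln (norm (g w z))" "\<And>w. w \<in> J \<Longrightarrow> ln (norm (g w w)) < u w + e"
    unfolding P_def by blast+
  define A where "A w z = norm (g w z) * bdist \<Omega> z" for w z
  have A_cont: "continuous_on (E w \<inter> \<Omega>) (A w)" if "w \<in> J" for w
    unfolding A_def by (intro continuous_intros continuous_on_subset[OF holomorphic_on_imp_continuous_on[OF g(1)[OF that]]]) auto
  have A_pos: "A w z > 0" if "w \<in> J" "z \<in> E w" "z \<in> \<Omega>" for w z
    using g(2)[OF that(1,2)] bpos[OF that(3)] by (simp add: A_def)
  have ln_A: "ln (A w z) = ln (norm (g w z)) - u z" if "w \<in> J" "z \<in> E w" "z \<in> \<Omega>" for w z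
    using g(2)[OF that(1,2)] bpos[OF that(3)] by (simp add: A_def u_def ln_mult)
  have A_J: "1 \<le> A w z" if "w \<in> J" "z \<in> J" for w z
  proof -
    have z: "z \<in> E w" "z \<in> \<Omega>" using that E JK K\<Omega> by auto
    have "0 \<le> ln (A w z)" using g(3)[OF that] ln_A[OF that(1) z] by simp
    then show ?thesis using A_pos[OF that(1) z] by (simp add: ln_ge_zero_iff)
  qed
  \<comment> \<open>The barriers dominate \<open>u\<close> on \<open>J\<close>, hence on
    \<open>K\<close> by the maximum principle; this makes \<open>N\<close> below a neighbourhood of
    \<open>K\<close>.\<close>
  have A_K: "1 \<le> A w z" if "w \<in> J" "z \<in> K" for w z
    unfolding A_def
  proof (rule bdist_maximum_principle[OF \<Omega> _ _ g(1)[OF that(1)] E(1)[OF that(1)]])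
    show "closure I \<subseteq> E w" "closure I \<subseteq> \<Omega>" "z \<in> closure I" using E(2)[OF that(1)] K\<Omega> that(2) JD(7) by (auto simp: K_def)
    show "1 \<le> norm (g w v) * bdist \<Omega> v" if "v \<in> frontier I" for v
      using A_J[OF \<open>w \<in> J\<close>, of v] that JD(6) by (simp add: A_def)
  qed (use JD g(2)[OF that(1)] in auto)
  define V where "V w = {z \<in> E w \<inter> \<Omega>. A w z < exp e}" for w
  have V_open: "open (V w)" if "w \<in> J" for w
  proof -
    have "V w = (E w \<inter> \<Omega>) \<inter> A w -` {..<exp e}" by (auto simp: V_def)
    then show ?thesis using continuous_open_preimage[OF A_cont[OF that] open_Int[OF E(1)[OF that] \<Omega>(1)] open_lessThan] by simp
  qed
  have V_mem: "w \<in> V w" if "w \<in> J" for w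
  proof -
    have z: "w \<in> E w" "w \<in> \<Omega>" using that E JK K\<Omega> by auto
    have "ln (A w w) < e" using g(4)[OF that] ln_A[OF that z] by simp
    then have "A w w < exp e" using A_pos[OF that z] by (metis exp_less_cancel_iff exp_ln)
    with z show ?thesis by (simp add: V_def)
  qed
  \<comment> \<open>Every point of the curve lies in some \<open>V w\<close>, where the barrier of
    \<open>w\<close> exceeds \<open>u\<close> by less than \<open>e\<close>. Finiteness of
    \<open>W\<close> keeps \<open>N\<close> open.\<close>
  obtain W where W: "W \<subseteq> J" "finite W" "J \<subseteq> (\<Union>w\<in>W. V w)"
    using compactE_image[OF JD(1), of J V] V_open V_mem by (metis UN_I subsetI)
  define N where "N = \<Omega> \<inter> (\<Inter>w\<in>W. {z \<in> E w \<inter> \<Omega>. exp (- e) < A w z})"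
  have "open {z \<in> E w \<inter> \<Omega>. exp (- e) < A w z}" if "w \<in> W" for w
  proof -
    have wJ: "w \<in> J" using that W by auto
    have "{z \<in> E w \<inter> \<Omega>. exp (- e) < A w z} = (E w \<inter> \<Omega>) \<inter> A w -` {exp (- e)<..}" by auto
    then show ?thesis using continuous_open_preimage[OF A_cont[OF wJ] open_Int[OF E(1)[OF wJ] \<Omega>(1)] open_greaterThan] by simp
  qed
  then have N_open: "open N" unfolding N_def using W(2) \<Omega>(1) by (intro open_Int open_INT) auto
  have KN: "K \<subseteq> N"
  proof
    fix z assume z: "z \<in> K"
    have "exp (- e) < A w z" if "w \<in> W" for w
    proof -
      have "exp (- e) < 1" using e by simp
      moreover have "1 \<le> A w z" using A_K[of w z] that W(1) z by blast
      ultimately show ?thesis by linarith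
    qed
    with z K\<Omega> E(2) W(1) show "z \<in> N" unfolding N_def by blast
  qed
  have K: "compact K" "connected K" "K \<noteq> {}" "connected (- K)" using JD by (auto simp: K_def)
  obtain D where D: "open D" "simply_connected D" "K \<subseteq> D" "D \<subseteq> N"
    using simply_connected_neighbourhood[OF K N_open KN] .
  have D\<Omega>: "D \<subseteq> \<Omega>" using D(4) by (auto simp: N_def)
  have "D \<noteq> UNIV" using D\<Omega> \<Omega>(2) frontier_UNIV top.extremum_uniqueI by metis
  moreover have "D \<noteq> {}" using K(3) D(3) by auto
  ultimately obtain \<phi> \<psi> where \<phi>: "\<phi> holomorphic_on D" and \<psi>: "\<psi> holomorphic_on ball 0 1"
    and \<phi>\<psi>: "\<And>z. z \<in> D \<Longrightarrow> \<phi> z \<in> ball 0 1 \<and> \<psi> (\<phi> z) = z" "\<And>z. z \<in> ball 0 1 \<Longrightarrow> \<psi> z \<in> D \<and> \<phi> (\<psi> z) = z"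
    using Riemann_mapping_theorem[of D] D(1,2) by blast
  have "compact (\<phi> ` K)"
    using D(3) by (intro compact_continuous_image K(1) continuous_on_subset[OF holomorphic_on_imp_continuous_on[OF \<phi>]])
  moreover have "\<phi> ` K \<subseteq> ball 0 1" using \<phi>\<psi>(1) D(3) by blast
  ultimately obtain r where r: "0 < r" "r < 1" "\<phi> ` K \<subseteq> ball 0 r"
  proof -
    assume c: "compact (\<phi> ` K)" and s: "\<phi> ` K \<subseteq> ball 0 1"
    have "continuous_on (\<phi> ` K) norm" by (intro continuous_intros)
    then obtain y where y: "y \<in> \<phi> ` K" "\<And>x. x \<in> \<phi> ` K \<Longrightarrow> norm x \<le> norm y"
      using continuous_attains_sup[OF c] K(3) by blast
    have "norm y < 1" using y(1) s by auto
    show thesis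
    proof (rule that[of "(norm y + 1) / 2"])
      show "0 < (norm y + 1) / 2" by (intro divide_pos_pos add_nonneg_pos) auto
      show "(norm y + 1) / 2 < 1" using \<open>norm y < 1\<close> by simp
      show "\<phi> ` K \<subseteq> ball 0 ((norm y + 1) / 2)"
      proof
        fix x assume "x \<in> \<phi> ` K"
        then have "norm x \<le> norm y" by (rule y(2))
        with \<open>norm y < 1\<close> show "x \<in> ball 0 ((norm y + 1) / 2)" by simp
      qed
    qed
  qed
  have sph: "sphere 0 r \<subseteq> ball (0::complex) 1" "cball 0 r \<subseteq> ball (0::complex) 1" "ball 0 r \<subseteq> ball (0::complex) 1"
    using r(2) by auto
  have \<psi>c: "continuous_on (ball 0 1) \<psi>" by (rule holomorphic_on_imp_continuous_on[OF \<psi>])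
  have "continuous_on (sphere 0 r) (\<lambda>z. u (\<psi> z))"
    by (rule continuous_on_compose2[OF u continuous_on_subset[OF \<psi>c sph(1)]])
      (use \<phi>\<psi>(2) sph D\<Omega> in blast)
  from Re_poly_approx_on_circle[OF this e]
  obtain p where p: "\<And>z. z \<in> sphere 0 r \<Longrightarrow> \<bar>u (\<psi> z) - Re (poly p z)\<bar> < e" by blast
  \<comment> \<open>\<open>ln (norm (f z))\<close> is the harmonic function
    \<open>Re (poly p (\<phi> z))\<close>, within \<open>e\<close> of \<open>u\<close> on the
    boundary of \<open>U\<close>.\<close>
  define f where "f z = exp (poly p (\<phi> z))" for z
  have f_hol: "f holomorphic_on D"
  proof -
    have "poly p holomorphic_on UNIV" by (intro holomorphic_intros)
    then have "(\<lambda>z. poly p (\<phi> z)) holomorphic_on D"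
      using holomorphic_on_compose_gen[OF \<phi>, of "poly p" UNIV] by (simp add: o_def)
    then show ?thesis unfolding f_def by (rule holomorphic_on_exp')
  qed
  have f0: "f z \<noteq> 0" for z by (simp add: f_def)
  define U where "U = \<psi> ` ball 0 r"
  have U_eq: "U = D \<inter> \<phi> -` ball 0 r" 
  proof
    show "U \<subseteq> D \<inter> \<phi> -` ball 0 r"
    proof
      fix z assume "z \<in> U"
      then obtain \<omega> where \<omega>: "\<omega> \<in> ball 0 r" "z = \<psi> \<omega>" unfolding U_def by blast
      with \<phi>\<psi>(2)[of \<omega>] sph(3) show "z \<in> D \<inter> \<phi> -` ball 0 r" by auto
    qed
    show "D \<inter> \<phi> -` ball 0 r \<subseteq> U"
    proof
      fix z assume z: "z \<in> D \<inter> \<phi> -` ball 0 r"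
      then have "\<psi> (\<phi> z) = z" using \<phi>\<psi>(1)[of z] by blast
      with z show "z \<in> U" unfolding U_def by (metis IntD2 imageI vimageE)
    qed
  qed
  have U_open: "open U" unfolding U_eq
    by (intro continuous_open_preimage holomorphic_on_imp_continuous_on \<phi> D) auto
  have cc: "compact (\<psi> ` cball 0 r)" by (intro compact_continuous_image continuous_on_subset[OF \<psi>c sph(2)]) auto
  have U_cl: "closure U \<subseteq> \<psi> ` cball 0 r"
    unfolding U_def by (intro closure_minimal image_mono compact_imp_closed[OF cc]) auto
  have cD: "\<psi> ` cball 0 r \<subseteq> D" using \<phi>\<psi>(2) sph(2) by blast
  have U_clD: "closure U \<subseteq> D" using U_cl cD by blast
  have U_bdd: "bounded U" using compact_imp_bounded[OF cc] by (rule bounded_subset) (auto simp: U_def)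
  have U_fr: "\<exists>\<omega>\<in>sphere 0 r. z = \<psi> \<omega>" if "z \<in> frontier U" for z
  proof -
    have "z \<in> closure U" "z \<notin> U" using that U_open by (auto simp: frontier_def interior_open)
    then obtain \<omega> where \<omega>: "\<omega> \<in> cball 0 r" "z = \<psi> \<omega>" using U_cl by blast
    with \<open>z \<notin> U\<close> have "\<omega> \<notin> ball 0 r" by (auto simp: U_def)
    with \<omega> show ?thesis by (intro bexI[of _ \<omega>]) auto
  qed
  have KU: "K \<subseteq> U" using r(3) D(3) by (auto simp: U_eq)
  have f_fr: "exp (- e) < norm (f z) * bdist \<Omega> z" "norm (f z) * bdist \<Omega> z < exp e" if "z \<in> frontier U" for z
  proof -
    obtain \<omega> where \<omega>: "\<omega> \<in> sphere 0 r" "z = \<psi> \<omega>" using U_fr[OF \<open>z \<in> frontier U\<close>] by blast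
    have zD: "z \<in> D" "\<phi> z = \<omega>" using \<phi>\<psi>(2)[of \<omega>] \<omega> sph(1) by auto
    have b: "bdist \<Omega> z > 0" using bpos zD D\<Omega> by auto
    then have "norm (f z) * bdist \<Omega> z = exp (Re (poly p \<omega>) - u z)"
      using zD(2) by (simp add: f_def norm_exp_eq_Re u_def exp_add)
    moreover have "\<bar>u z - Re (poly p \<omega>)\<bar> < e" using p[OF \<omega>(1)] \<omega>(2) by simp
    then have "- e < Re (poly p \<omega>) - u z" "Re (poly p \<omega>) - u z < e" by linarith+
    ultimately show "exp (- e) < norm (f z) * bdist \<Omega> z" "norm (f z) * bdist \<Omega> z < exp e" by simp_all
  qed
  define F where "F z = of_real (exp e) * f z" for z
  have F_hol: "F holomorphic_on D" unfolding F_def by (intro holomorphic_intros f_hol)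
  have F_norm: "norm (F z) = exp e * norm (f z)" for z by (simp add: F_def norm_mult)
  have F_low: "1 \<le> norm (F z) * bdist \<Omega> z" if "z \<in> K" for z
  proof (rule bdist_maximum_principle[OF \<Omega> U_bdd _ F_hol D(1) U_clD])
    show "closure U \<subseteq> \<Omega>" using U_clD D\<Omega> by blast
    show "F w \<noteq> 0" for w using f0 by (simp add: F_def)
    show "1 \<le> norm (F w) * bdist \<Omega> w" if "w \<in> frontier U" for w
    proof -
      have "exp e * exp (- e) \<le> exp e * (norm (f w) * bdist \<Omega> w)" using f_fr(1)[OF that] by (intro mult_left_mono) auto
      then show ?thesis by (simp add: F_norm mult.assoc exp_minus)
    qed
    show "z \<in> closure U" using KU that closure_subset by blast
  qed
  have F_up: "norm (F z) * bdist \<Omega> z \<le> 1 + \<eta>" if zJ: "z \<in> J" for z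
  proof -
    obtain w where w: "w \<in> W" "z \<in> V w" using W(3) zJ by blast
    have wJ: "w \<in> J" using w W by auto
    have DE: "D \<subseteq> E w" using D(4) w(1) by (auto simp: N_def)
    \<comment> \<open>On the boundary of \<open>U\<close>, in logarithms, \<open>f\<close> is at
      most \<open>e\<close> above \<open>u\<close> and the barrier at most \<open>e\<close> below
      it; the maximum modulus principle for the quotient carries this to the curve.\<close>
    have "norm (f z / g w z) \<le> exp (2 * e)"
    proof (rule maximum_modulus_frontier[of "\<lambda>z. f z / g w z" U])
      have iU: "interior U \<subseteq> D" using U_clD interior_subset closure_subset by blast
      show "(\<lambda>z. f z / g w z) holomorphic_on interior U"
        by (intro holomorphic_intros holomorphic_on_subset[OF f_hol] holomorphic_on_subset[OF g(1)[OF wJ]])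
          (use iU DE g(2)[OF wJ] in auto)
      show "continuous_on (closure U) (\<lambda>z. f z / g w z)"
        by (intro continuous_intros continuous_on_subset[OF holomorphic_on_imp_continuous_on[OF f_hol]]
           continuous_on_subset[OF holomorphic_on_imp_continuous_on[OF g(1)[OF wJ]]])
          (use U_clD DE g(2)[OF wJ] in auto)
      fix v assume v: "v \<in> frontier U"
      then have vD: "v \<in> D" using U_clD by (auto simp: frontier_def)
      have b: "bdist \<Omega> v > 0" using bpos vD D\<Omega> by auto
      have "exp (- e) < norm (g w v) * bdist \<Omega> v" using vD D(4) w(1) by (auto simp: N_def A_def)
      then have "exp (2 * e) * exp (- e) \<le> exp (2 * e) * (norm (g w v) * bdist \<Omega> v)" by (intro mult_left_mono) auto
      then have "exp e \<le> exp (2 * e) * norm (g w v) * bdist \<Omega> v" by (simp add: exp_add[symmetric] mult.assoc)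
      with f_fr(2)[OF v] have "norm (f v) * bdist \<Omega> v \<le> exp (2 * e) * norm (g w v) * bdist \<Omega> v" by linarith
      then have "norm (f v) \<le> exp (2 * e) * norm (g w v)" using b by simp
      then show "norm (f v / g w v) \<le> exp (2 * e)"
        using g(2)[OF wJ, of v] vD DE by (simp add: norm_divide divide_le_eq)
    qed (use KU zJ JK U_bdd in auto)
    moreover have "g w z \<noteq> 0" using g(2)[OF wJ, of z] w(2) by (auto simp: V_def)
    ultimately have "norm (f z) \<le> exp (2 * e) * norm (g w z)" by (simp add: norm_divide divide_le_eq)
    then have "exp e * norm (f z) * bdist \<Omega> z \<le> exp e * (exp (2 * e) * norm (g w z)) * bdist \<Omega> z"
      by (intro mult_left_mono mult_right_mono) (auto simp: infdist_nonneg)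
    also have "\<dots> = exp e * exp (2 * e) * A w z" by (simp add: A_def)
    also have "\<dots> \<le> exp e * exp (2 * e) * exp e" using w(2) by (intro mult_left_mono) (auto simp: V_def)
    also have "\<dots> = exp (4 * e)" by (simp add: exp_add[symmetric])
    finally show ?thesis unfolding F_norm e4 .
  qed
  \<comment> \<open>Simple connectivity of \<open>D\<close> provides a single-valued primitive,
    which turns the density \<open>norm (F z)\<close> into the flat metric of
    \<open>G\<close>.\<close>
  obtain G where G: "\<And>z. z \<in> D \<Longrightarrow> (G has_field_derivative F z) (at z)"
    using simply_connected_eq_global_primitive[OF D(1)] D(2) F_hol by blast
  have dG: "deriv G z = F z" if "z \<in> D" for z using G[OF that] by (rule DERIV_imp_deriv)
  show ?thesis
  proof (rule that[of D G])
    show "G holomorphic_on D" using G D(1) by (auto simp: holomorphic_on_open)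
    show "path_image j \<union> inside (path_image j) \<subseteq> D" using D(3) by (auto simp: K_def I_def J_def)
    fix z
    show "1 \<le> norm (deriv G z) * bdist \<Omega> z" if "z \<in> path_image j \<union> inside (path_image j)"
    proof -
      have "z \<in> K" using that by (auto simp: K_def I_def J_def)
      then show ?thesis using F_low[of z] dG[of z] D(3) by auto
    qed
    show "norm (deriv G z) * bdist \<Omega> z \<le> 1 + \<eta>" if "z \<in> path_image j"
    proof -
      have "z \<in> J" using that by (auto simp: J_def)
      then show ?thesis using F_up[of z] dG[of z] D(3) JK by auto
    qed
  qed (rule D(1))
qed

section \<open>Bigons of minimizing curves\<close>

lemma qcurve_dist_le_exp:
  assumes "qcurve \<Omega> V \<kappa>" "s \<in> {0..V}" "t \<in> {0..V}"
  shows "dist (\<kappa> t) (\<kappa> s) \<le> bdist \<Omega> (\<kappa> s) * (exp \<bar>t - s\<bar> * \<bar>t - s\<bar>)"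
proof -
  have "dist (\<kappa> s) (\<kappa> t) \<le> bdist \<Omega> (\<kappa> s) * (exp \<bar>s - t\<bar> - 1)" by (rule qcurve_dist[OF assms])
  also have "\<dots> \<le> bdist \<Omega> (\<kappa> s) * (exp \<bar>s - t\<bar> * \<bar>s - t\<bar>)"
    by (intro mult_left_mono exp_diff_one_le infdist_nonneg)
  finally show ?thesis by (simp add: dist_commute abs_minus_commute)
qed

text \<open>In place of a chain rule, the linearization of \<open>G\<close> at
  \<open>\<kappa> r\<close> is combined with the local speed bound
  \<open>bdist \<Omega> (\<kappa> r)\<close>; the product
  \<open>norm (G' r) * bdist \<Omega> (\<kappa> r)\<close> is the ratio of the two metrics.\<close>

lemma qcurve_image_lipschitz:
  fixes \<kappa> :: "real \<Rightarrow> complex"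
  assumes \<Omega>: "open \<Omega>" "frontier \<Omega> \<noteq> {}" and q: "qcurve \<Omega> V \<kappa>" and K: "K \<ge> 0"
    and G: "\<And>t. t \<in> {0..V} \<Longrightarrow> (G has_field_derivative G' t) (at (\<kappa> t))"
    and G': "\<And>t. t \<in> {0..V} \<Longrightarrow> norm (G' t) * bdist \<Omega> (\<kappa> t) \<le> K"
    and st: "s \<in> {0..V}" "t \<in> {0..V}"
  shows "dist (G (\<kappa> s)) (G (\<kappa> t)) \<le> K * \<bar>s - t\<bar>"
proof -
  define a b where "a = min s t" and "b = max s t"
  have ab: "a \<le> b" "{a..b} \<subseteq> {0..V}" using st by (auto simp: a_def b_def)
  have "dist (G (\<kappa> a)) (G (\<kappa> b)) \<le> K * (b - a)"
  proof (rule dist_le_of_locally_lipschitz[OF ab(1) K])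
    fix r e :: real assume r: "r \<in> {a..b}" and e: "e > 0"
    with ab have rV: "r \<in> {0..V}" by auto
    define \<beta> where "\<beta> = bdist \<Omega> (\<kappa> r)"
    have \<beta>: "\<beta> > 0" unfolding \<beta>_def by (rule bdist_pos[OF \<Omega> qcurve_mem[OF q rV]])
    have "(G has_derivative (*) (G' r)) (at (\<kappa> r))" using G[OF rV] by (simp add: has_field_derivative_def)
    \<comment> \<open>The error \<open>e / (2 * \<beta>)\<close> turns into \<open>e / 2\<close>
      when multiplied by the speed \<open>\<beta>\<close>.\<close>
    then obtain d where d: "d > 0" "\<And>z. norm (z - \<kappa> r) < d \<Longrightarrow>
        norm (G z - G (\<kappa> r) - G' r * (z - \<kappa> r)) \<le> e / (2 * \<beta>) * norm (z - \<kappa> r)"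
      unfolding has_derivative_at_alt using e \<beta> by (metis divide_pos_pos mult_pos_pos zero_less_numeral)
    have "continuous (at r within {0..V}) \<kappa>"
      using qcurve_continuous_on[OF q] rV by (simp add: continuous_on_eq_continuous_within)
    then have "(\<kappa> \<longlongrightarrow> \<kappa> r) (at r within {a..b})"
      unfolding continuous_within using ab(2) by (rule tendsto_within_subset)
    then have "\<forall>\<^sub>F u in at r within {a..b}. dist (\<kappa> u) (\<kappa> r) < d" using d(1) by (rule tendstoD)
    moreover have "\<forall>\<^sub>F u in at r within {a..b}. u \<in> {a..b}" by (auto simp: eventually_at_filter)
    moreover have "((\<lambda>u. (K + e / 2) * exp \<bar>u - r\<bar>) \<longlongrightarrow> (K + e / 2) * exp \<bar>r - r\<bar>) (at r within {a..b})"
      by (intro tendsto_intros)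
    then have "\<forall>\<^sub>F u in at r within {a..b}. (K + e / 2) * exp \<bar>u - r\<bar> < K + e"
      using e by (intro order_tendstoD(2)) auto
    ultimately show "\<forall>\<^sub>F u in at r within {a..b}. dist (G (\<kappa> u)) (G (\<kappa> r)) \<le> (K + e) * \<bar>u - r\<bar>"
    proof eventually_elim
      case (elim u)
      then have uV: "u \<in> {0..V}" using ab by auto
      have "norm (G (\<kappa> u) - G (\<kappa> r)) \<le> norm (G' r * (\<kappa> u - \<kappa> r)) + e / (2 * \<beta>) * norm (\<kappa> u - \<kappa> r)"
        using d(2)[of "\<kappa> u"] elim(1) norm_triangle_sub[of "G (\<kappa> u) - G (\<kappa> r)" "G' r * (\<kappa> u - \<kappa> r)"]
        by (simp add: dist_norm)
      also have "\<dots> = (norm (G' r) + e / (2 * \<beta>)) * dist (\<kappa> u) (\<kappa> r)"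
        unfolding norm_mult dist_norm by (simp add: distrib_right)
      also have "\<dots> \<le> (norm (G' r) + e / (2 * \<beta>)) * (\<beta> * (exp \<bar>u - r\<bar> * \<bar>u - r\<bar>))"
        using qcurve_dist_le_exp[OF q rV uV] e \<beta> unfolding \<beta>_def by (intro mult_left_mono) auto
      also have "\<dots> = (norm (G' r) * \<beta> + e / 2) * (exp \<bar>u - r\<bar> * \<bar>u - r\<bar>)"
        using \<beta> by (simp add: field_simps)
      also have "\<dots> \<le> (K + e / 2) * (exp \<bar>u - r\<bar> * \<bar>u - r\<bar>)"
        using G'[OF rV] by (intro mult_right_mono) (auto simp: \<beta>_def)
      also have "\<dots> = ((K + e / 2) * exp \<bar>u - r\<bar>) * \<bar>u - r\<bar>" by simp
      also have "\<dots> \<le> (K + e) * \<bar>u - r\<bar>" using elim(3) by (intro mult_right_mono) auto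
      finally show ?case by (simp add: dist_norm)
    qed
  qed
  then show ?thesis by (auto simp: a_def b_def dist_commute min_def max_def split: if_splits)
qed

text \<open>The majorant and the lifts rest on the speed bound of the arcs alone; minimality enters
  in \<open>not_minimal\<close>, where it is refuted.\<close>

locale qcurve_bigon =
  fixes \<Omega> :: "complex set" and \<gamma> \<eta> :: "real \<Rightarrow> complex" and l :: real and j :: "real \<Rightarrow> complex"
  assumes \<Omega>: "open \<Omega>" "frontier \<Omega> \<noteq> {}" and l: "l > 0"
    and q\<gamma>: "qcurve \<Omega> l \<gamma>" and q\<eta>: "qcurve \<Omega> l \<eta>"
    and start: "\<gamma> 0 = \<eta> 0"
    and meet: "\<gamma> ` {0..l} \<inter> \<eta> ` {0..l} \<subseteq> {\<gamma> 0, \<gamma> l}"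
    and j: "simple_path j" "pathfinish j = pathstart j" "path_image j = \<gamma> ` {0..l} \<union> \<eta> ` {0..l}"
    and K\<Omega>': "path_image j \<union> inside (path_image j) \<subseteq> \<Omega>"
begin

definition J where "J = path_image j"
definition I where "I = inside (path_image j)"
definition K where "K = I \<union> J"

lemmas JD = Jordan_domain[OF j(1,2), folded I_def, folded J_def, folded K_def]

lemma K_\<Omega>: "K \<subseteq> \<Omega>" using K\<Omega>' by (auto simp: K_def I_def J_def)
lemma IK: "I \<subseteq> K" and JK: "J \<subseteq> K" by (auto simp: K_def)
lemma I_J_disjoint: "I \<inter> J = {}" by (simp add: I_def J_def)
lemma J_eq: "J = \<gamma> ` {0..l} \<union> \<eta> ` {0..l}" by (simp add: J_def j(3))
lemma \<gamma>J: "s \<in> {0..l} \<Longrightarrow> \<gamma> s \<in> J" and \<eta>J: "s \<in> {0..l} \<Longrightarrow> \<eta> s \<in> J" by (auto simp: J_eq)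

text \<open>Subtracting \<open>G (\<gamma> 0)\<close> keeps the family bounded along the arcs as
  \<open>\<epsilon>\<close> tends to 0, in preparation for a compactness argument.\<close>

lemma almost_flat_majorant:
  assumes "\<epsilon> > 0"
  shows "\<exists>D G. open D \<and> K \<subseteq> D \<and> G holomorphic_on D \<and> G (\<gamma> 0) = 0 \<and>
    (\<forall>z\<in>K. 1 \<le> norm (deriv G z) * bdist \<Omega> z) \<and>
    (\<forall>s\<in>{0..l}. \<forall>t\<in>{0..l}. dist (G (\<gamma> s)) (G (\<gamma> t)) \<le> (1 + \<epsilon>) * \<bar>s - t\<bar>) \<and>
    (\<forall>s\<in>{0..l}. \<forall>t\<in>{0..l}. dist (G (\<eta> s)) (G (\<eta> t)) \<le> (1 + \<epsilon>) * \<bar>s - t\<bar>)"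
proof -
  obtain D G where D: "open D" "path_image j \<union> inside (path_image j) \<subseteq> D" "G holomorphic_on D"
    and low: "\<And>z. z \<in> path_image j \<union> inside (path_image j) \<Longrightarrow> 1 \<le> norm (deriv G z) * bdist \<Omega> z"
    and up: "\<And>z. z \<in> path_image j \<Longrightarrow> norm (deriv G z) * bdist \<Omega> z \<le> 1 + \<epsilon>"
    using flat_majorant_on_Jordan_domain[OF \<Omega> j(1,2) K\<Omega>' assms] by metis
  have KD: "K \<subseteq> D" using D(2) by (auto simp: K_def I_def J_def)
  define H where "H z = G z - G (\<gamma> 0)" for z
  have G': "(G has_field_derivative deriv G z) (at z)" if "z \<in> D" for z
    using holomorphic_derivI[OF D(3,1) that] .
  have H': "deriv H z = deriv G z" if "z \<in> D" for z
    unfolding H_def using G'[OF that] by (intro DERIV_imp_deriv) (auto intro!: derivative_eq_intros)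
  have H_lip: "dist (H (\<kappa> s)) (H (\<kappa> t)) \<le> (1 + \<epsilon>) * \<bar>s - t\<bar>"
    if "qcurve \<Omega> l \<kappa>" "\<And>s. s \<in> {0..l} \<Longrightarrow> \<kappa> s \<in> J" "s \<in> {0..l}" "t \<in> {0..l}" for \<kappa> s t
  proof -
    have "dist (G (\<kappa> s)) (G (\<kappa> t)) \<le> (1 + \<epsilon>) * \<bar>s - t\<bar>"
      using assms that(2) JK KD
      by (intro qcurve_image_lipschitz[OF \<Omega> that(1) _ G' up that(3,4)]) (auto simp: J_def)
    then show ?thesis by (simp add: H_def dist_norm)
  qed
  show ?thesis
  proof (intro exI conjI ballI)
    show "open D" "K \<subseteq> D" by (rule D(1) KD)+
    show "H holomorphic_on D" unfolding H_def by (intro holomorphic_intros D(3))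
    show "H (\<gamma> 0) = 0" by (simp add: H_def)
    show "1 \<le> norm (deriv H z) * bdist \<Omega> z" if "z \<in> K" for z
      using low[of z] that KD H'[of z] by (auto simp: K_def I_def J_def)
  qed (use H_lip[OF q\<gamma> \<gamma>J] H_lip[OF q\<eta> \<eta>J] in auto)
qed

text \<open>Equicontinuity is available only along the arcs. Arzela-Ascoli, applied to both arcs at
  once, gives a subsequence converging uniformly on \<open>J\<close>, and the maximum modulus
  principle makes it uniformly Cauchy on \<open>K\<close>. The limit is known to be holomorphic only
  inside, but the Lipschitz bounds on the arcs persist, now without the factor
  \<open>1 + \<epsilon>\<close>.\<close>

theorem flat_majorant:
  obtains G where "continuous_on K G" "G holomorphic_on I"
    "\<And>z. z \<in> I \<Longrightarrow> 1 \<le> norm (deriv G z) * bdist \<Omega> z"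
    "\<And>s t. s \<in> {0..l} \<Longrightarrow> t \<in> {0..l} \<Longrightarrow> dist (G (\<gamma> s)) (G (\<gamma> t)) \<le> \<bar>s - t\<bar>"
    "\<And>s t. s \<in> {0..l} \<Longrightarrow> t \<in> {0..l} \<Longrightarrow> dist (G (\<eta> s)) (G (\<eta> t)) \<le> \<bar>s - t\<bar>"
proof -
  define \<epsilon> where "\<epsilon> n = 1 / real (Suc n)" for n
  have \<epsilon>: "\<epsilon> n > 0" "\<epsilon> n \<le> 1" for n by (auto simp: \<epsilon>_def)
  have \<epsilon>0: "\<epsilon> \<longlonglongrightarrow> 0" unfolding \<epsilon>_def using LIMSEQ_inverse_real_of_nat by (simp add: inverse_eq_divide)
  define P where "P n D G \<longleftrightarrow> open D \<and> K \<subseteq> D \<and> G holomorphic_on D \<and> G (\<gamma> 0) = 0 \<and>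
    (\<forall>z\<in>K. 1 \<le> norm (deriv G z) * bdist \<Omega> z) \<and>
    (\<forall>s\<in>{0..l}. \<forall>t\<in>{0..l}. dist (G (\<gamma> s)) (G (\<gamma> t)) \<le> (1 + \<epsilon> n) * \<bar>s - t\<bar>) \<and>
    (\<forall>s\<in>{0..l}. \<forall>t\<in>{0..l}. dist (G (\<eta> s)) (G (\<eta> t)) \<le> (1 + \<epsilon> n) * \<bar>s - t\<bar>)" for n D and G :: "complex \<Rightarrow> complex"
  have "\<exists>D G. P n D G" for n unfolding P_def using almost_flat_majorant[OF \<epsilon>(1)] .
  then obtain D G where "\<And>n. P n (D n) (G n)" by metis
  then have D: "\<And>n. open (D n)" "\<And>n. K \<subseteq> D n" and G_hol: "\<And>n. G n holomorphic_on D n" and G0: "\<And>n. G n (\<gamma> 0) = 0"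
    and G_low: "\<And>n z. z \<in> K \<Longrightarrow> 1 \<le> norm (deriv (G n) z) * bdist \<Omega> z"
    and G\<gamma>: "\<And>n s t. s \<in> {0..l} \<Longrightarrow> t \<in> {0..l} \<Longrightarrow> dist (G n (\<gamma> s)) (G n (\<gamma> t)) \<le> (1 + \<epsilon> n) * \<bar>s - t\<bar>"
    and G\<eta>: "\<And>n s t. s \<in> {0..l} \<Longrightarrow> t \<in> {0..l} \<Longrightarrow> dist (G n (\<eta> s)) (G n (\<eta> t)) \<le> (1 + \<epsilon> n) * \<bar>s - t\<bar>"
    unfolding P_def by blast+
  have le2: "(1 + \<epsilon> n) * \<bar>s - t\<bar> \<le> 2 * \<bar>s - t\<bar>" for n s t
    using \<epsilon>(2)[of n] by (intro mult_right_mono) auto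
  define F where "F n s = (G n (\<gamma> s), G n (\<eta> s))" for n s
  have F_lip: "norm (F n s - F n t) \<le> 4 * \<bar>s - t\<bar>" if "s \<in> {0..l}" "t \<in> {0..l}" for n s t
  proof -
    have "norm (F n s - F n t) \<le> dist (G n (\<gamma> s)) (G n (\<gamma> t)) + dist (G n (\<eta> s)) (G n (\<eta> t))"
      unfolding F_def diff_Pair dist_norm by (rule norm_Pair_le)
    also have "\<dots> \<le> 4 * \<bar>s - t\<bar>" using G\<gamma>[OF that, of n] G\<eta>[OF that, of n] le2[of n s t] by linarith
    finally show ?thesis .
  qed
  obtain g k where k: "strict_mono (k :: nat \<Rightarrow> nat)"
    and conv: "\<And>e. 0 < e \<Longrightarrow> \<exists>N. \<forall>n s. n \<ge> N \<and> s \<in> {0..l} \<longrightarrow> norm (F (k n) s - g s) < e"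
  proof (rule Arzela_Ascoli[of "{0..l}" F "4 * l"])
    fix n s assume s: "s \<in> {0..l}"
    have "F n 0 = 0" using G0[of n] start by (simp add: F_def zero_prod_def)
    then have "norm (F n s) \<le> 4 * \<bar>s - 0\<bar>" using F_lip[OF s, of 0 n] s by auto
    then show "norm (F n s) \<le> 4 * l" using s by auto
  next
    fix s e :: real assume s: "s \<in> {0..l}" and e: "0 < e"
    show "\<exists>d>0. \<forall>n t. t \<in> {0..l} \<and> norm (s - t) < d \<longrightarrow> norm (F n s - F n t) < e"
    proof (intro exI[of _ "e / 4"] conjI allI impI)
      fix n t assume "t \<in> {0..l} \<and> norm (s - t) < e / 4"
      then have "t \<in> {0..l}" "4 * \<bar>s - t\<bar> < e" by auto
      then show "norm (F n s - F n t) < e" using F_lip[OF s, of t n] by linarith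
    qed (use e in auto)
  qed auto
  have cauchy_J: "norm (G (k m) z - G (k n) z) < e"
    if N: "\<forall>n s. n \<ge> N \<and> s \<in> {0..l} \<longrightarrow> norm (F (k n) s - g s) < e / 2" and mn: "m \<ge> N" "n \<ge> N" and z: "z \<in> J" for e N m n z
  proof -
    obtain s where s: "s \<in> {0..l}" "z = \<gamma> s \<or> z = \<eta> s" using z by (auto simp: J_eq)
    have "norm (F (k m) s - F (k n) s) < e"
      using N[rule_format, of m s] N[rule_format, of n s] mn s(1) norm_triangle_ineq4[of "F (k m) s - g s" "F (k n) s - g s"] by simp
    moreover have "norm (G (k m) z - G (k n) z) \<le> norm (F (k m) s - F (k n) s)"
      using s(2) norm_fst_le[of "fst (F (k m) s - F (k n) s)" "snd (F (k m) s - F (k n) s)"]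
        norm_snd_le[of "snd (F (k m) s - F (k n) s)" "fst (F (k m) s - F (k n) s)"] by (auto simp: F_def)
    ultimately show ?thesis by simp
  qed
  have G_cont: "continuous_on K (G n)" for n
    by (rule continuous_on_subset[OF holomorphic_on_imp_continuous_on[OF G_hol] D(2)])
  have G_holI: "G (k n) holomorphic_on I" for n
    using D(2)[of "k n"] IK by (intro holomorphic_on_subset[OF G_hol]) auto
  have "uniformly_Cauchy_on K (\<lambda>n. G (k n))"
  proof (rule uniformly_Cauchy_onI)
    fix e :: real assume e: "e > 0"
    obtain N where N: "\<forall>n s. n \<ge> N \<and> s \<in> {0..l} \<longrightarrow> norm (F (k n) s - g s) < e / 4" using conv[of "e / 4"] e by auto
    have "dist (G (k m) z) (G (k n) z) < e" if z: "z \<in> K" and mn: "m \<ge> N" "n \<ge> N" for z m n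
    proof -
      have cJ: "norm (G (k m) z - G (k n) z) \<le> e / 2" if "z \<in> J" for z
        using cauchy_J[of N "e / 2" m n z] N mn that by auto
      have "norm (G (k m) z - G (k n) z) \<le> e / 2"
      proof (cases "z \<in> I")
        case True
        have clI: "closure I = K" using JD(7) by (simp add: K_def)
        show ?thesis
        proof (rule maximum_modulus_frontier[of "\<lambda>z. G (k m) z - G (k n) z" I])
          show "(\<lambda>z. G (k m) z - G (k n) z) holomorphic_on interior I"
            unfolding interior_open[OF JD(2)] by (intro holomorphic_intros G_holI)
          show "continuous_on (closure I) (\<lambda>z. G (k m) z - G (k n) z)"
            unfolding clI by (intro continuous_intros G_cont)
          show "norm (G (k m) w - G (k n) w) \<le> e / 2" if "w \<in> frontier I" for w
            using cJ that unfolding JD(6) .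
        qed (rule JD(5) True)+
      next
        case False with z cJ show ?thesis by (auto simp: K_def)
      qed
      with e show ?thesis by (simp add: dist_norm)
    qed
    then show "\<exists>M. \<forall>x\<in>K. \<forall>m\<ge>M. \<forall>n\<ge>M. dist (G (k m) x) (G (k n) x) < e" by blast
  qed
  then obtain H where H: "uniform_limit K (\<lambda>n. G (k n)) H sequentially"
    using Cauchy_uniformly_convergent uniformly_convergent_on_def by blast
  have HI: "uniform_limit I (\<lambda>n. G (k n)) H sequentially" by (rule uniform_limit_on_subset[OF H IK])
  have lim: "(\<lambda>n. G (k n) z) \<longlonglongrightarrow> H z" if "z \<in> K" for z
    using tendsto_uniform_limitI[OF H that] .
  have \<epsilon>k: "(\<lambda>n. (1 + \<epsilon> (k n)) * c) \<longlonglongrightarrow> c" for c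
  proof -
    have "(\<lambda>n. (1 + \<epsilon> (k n)) * c) \<longlonglongrightarrow> (1 + 0) * c"
      using LIMSEQ_subseq_LIMSEQ[OF \<epsilon>0 k] by (intro tendsto_intros) (simp add: o_def)
    then show ?thesis by simp
  qed
  show ?thesis
  proof (rule that[of H])
    show "continuous_on K H" by (rule uniform_limit_theorem[OF _ H]) (auto simp: G_cont)
    show "H holomorphic_on I"
    proof (rule holomorphic_uniform_sequence[OF JD(2) G_holI])
      fix z assume "z \<in> I"
      then obtain d where "d > 0" "cball z d \<subseteq> I" using JD(2) open_contains_cball by blast
      then show "\<exists>d>0. cball z d \<subseteq> I \<and> uniform_limit (cball z d) (\<lambda>n. G (k n)) H sequentially"
        using uniform_limit_on_subset[OF HI] by blast
    qed
    fix z assume z: "z \<in> I"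
    have "(\<lambda>n. (deriv ^^ 1) (G (k n)) z) \<longlonglongrightarrow> (deriv ^^ 1) H z"
      by (rule higher_deriv_complex_uniform_limit[OF HI _ _ JD(2) z]) (auto simp: G_holI)
    then have "(\<lambda>n. norm (deriv (G (k n)) z) * bdist \<Omega> z) \<longlonglongrightarrow> norm (deriv H z) * bdist \<Omega> z"
      by (intro tendsto_intros) simp
    then show "1 \<le> norm (deriv H z) * bdist \<Omega> z"
      by (rule LIMSEQ_le_const) (use G_low z IK in blast)
  next
    fix s t assume st: "s \<in> {0..l}" "t \<in> {0..l}"
    have K: "\<gamma> s \<in> K" "\<gamma> t \<in> K" "\<eta> s \<in> K" "\<eta> t \<in> K" using st \<gamma>J \<eta>J JK by auto
    show "dist (H (\<gamma> s)) (H (\<gamma> t)) \<le> \<bar>s - t\<bar>"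
      by (rule LIMSEQ_le[OF tendsto_dist[OF lim[OF K(1)] lim[OF K(2)]] \<epsilon>k]) (use G\<gamma>[OF st] in blast)
    show "dist (H (\<eta> s)) (H (\<eta> t)) \<le> \<bar>s - t\<bar>"
      by (rule LIMSEQ_le[OF tendsto_dist[OF lim[OF K(3)] lim[OF K(4)]] \<epsilon>k]) (use G\<eta>[OF st] in blast)
  qed
qed

end

section \<open>Lifting straight lines through the flat majorant\<close>

text \<open>A local inverse of \<open>G\<close> has derivative of modulus
  \<open>1 / norm (deriv G z)\<close>, at most \<open>bdist \<Omega> z\<close>, so it maps unit
  speed segments to curves of at most unit quasihyperbolic speed.\<close>

lemma qcurve_local_inverse:
  fixes G :: "complex \<Rightarrow> complex"
  assumes \<Omega>: "open \<Omega>" "frontier \<Omega> \<noteq> {}" and S: "open S" "S \<subseteq> \<Omega>" and G: "G holomorphic_on S"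
    and low: "\<And>z. z \<in> S \<Longrightarrow> 1 \<le> norm (deriv G z) * bdist \<Omega> z" and a: "a \<in> S" and e: "norm e = 1"
  obtains h \<tau> where "h > 0" "qcurve \<Omega> h \<tau>" "\<tau> 0 = a"
    "\<And>t. t \<in> {0..h} \<Longrightarrow> \<tau> t \<in> S \<and> G (\<tau> t) = G a + of_real t * e"
proof -
  have G'0: "deriv G a \<noteq> 0" using low[OF a] by auto
  obtain r where r: "r > 0" "ball a r \<subseteq> S" "open (G ` ball a r)" "inj_on G (ball a r)"
    using has_complex_derivative_locally_invertible[OF G a S(1) G'0] by metis
  have G_r: "G holomorphic_on ball a r" using G r(2) by (rule holomorphic_on_subset)
  obtain g where g: "g holomorphic_on G ` ball a r"
    "\<And>z. z \<in> ball a r \<Longrightarrow> deriv G z * deriv g (G z) = 1" "\<And>z. z \<in> ball a r \<Longrightarrow> g (G z) = z"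
    using holomorphic_has_inverse[OF G_r open_ball r(4)] by metis
  have "G a \<in> G ` ball a r" using r(1) by auto
  then obtain h0 where h0: "h0 > 0" "ball (G a) h0 \<subseteq> G ` ball a r" using r(3) open_contains_ball by blast
  define h where "h = h0 / 2"
  define w where "w t = G a + of_real t * e" for t :: real
  have h: "h > 0" using h0 by (simp add: h_def)
  have w: "w t \<in> G ` ball a r" if "t \<in> {0..h}" for t
  proof -
    have "dist (G a) (w t) < h0" using that e h0(1) by (auto simp: w_def h_def dist_norm norm_mult)
    then show ?thesis using h0(2) by auto
  qed
  define \<tau> where "\<tau> t = g (w t)" for t
  have \<tau>: "\<tau> t \<in> ball a r" "G (\<tau> t) = w t" if t: "t \<in> {0..h}" for t
  proof -
    obtain z where "z \<in> ball a r" "w t = G z" using w[OF t] by blast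
    then show "\<tau> t \<in> ball a r" "G (\<tau> t) = w t" using g(3)[of z] by (simp_all add: \<tau>_def)
  qed
  have "qcurve \<Omega> h \<tau>"
  proof (rule qcurveI_local[OF \<Omega>])
    show "0 \<le> h" using h by simp
    show "\<tau> s \<in> \<Omega>" if "s \<in> {0..h}" for s using \<tau>(1)[OF that] r(2) S(2) by blast
    fix s \<epsilon> :: real assume s: "s \<in> {0..h}" and \<epsilon>: "\<epsilon> > 0"
    have \<tau>S: "\<tau> s \<in> S" using \<tau>(1)[OF s] r(2) by blast
    have b: "bdist \<Omega> (\<tau> s) > 0" using bdist_pos[OF \<Omega>] \<tau>S S(2) by blast
    have "deriv G (\<tau> s) * deriv g (w s) = 1" using g(2)[OF \<tau>(1)[OF s]] \<tau>(2)[OF s] by simp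
    then have "norm (deriv G (\<tau> s)) * norm (deriv g (w s)) = 1" by (metis norm_mult norm_one)
    moreover have "norm (deriv g (w s)) * 1 \<le> norm (deriv g (w s)) * (norm (deriv G (\<tau> s)) * bdist \<Omega> (\<tau> s))"
      using low[OF \<tau>S] by (intro mult_left_mono) auto
    ultimately have g'_le: "norm (deriv g (w s)) \<le> bdist \<Omega> (\<tau> s)"
      by (metis mult.assoc mult.commute mult.right_neutral)
    have "(g has_field_derivative deriv g (w s)) (at (w s))"
      using holomorphic_derivI[OF g(1) r(3) w[OF s]] .
    then have "(g has_field_derivative deriv g (w s)) (at (G a + of_real s * e))" by (simp add: w_def)
    moreover have "((\<lambda>z. G a + z * e) has_field_derivative e) (at (of_real s))"
      by (auto intro!: derivative_eq_intros)
    ultimately have "((\<lambda>z. g (G a + z * e)) has_field_derivative deriv g (w s) * e) (at (of_real s))"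
      by (rule DERIV_chain2)
    from has_vector_derivative_real_field[OF this, of "{0..h}"]
    have "(\<tau> has_vector_derivative deriv g (w s) * e) (at s within {0..h})"
      unfolding \<tau>_def[abs_def] w_def .
    then have "(\<tau> has_derivative (\<lambda>t. t *\<^sub>R (deriv g (w s) * e))) (at s within {0..h})"
      by (simp add: has_vector_derivative_def)
    then have *: "\<forall>\<^sub>F t in at s within {0..h}. norm (\<tau> t - \<tau> s - (t - s) *\<^sub>R (deriv g (w s) * e)) \<le> c * norm (t - s)"
      if "c > 0" for c
      using that unfolding has_derivative_within_alt2 by blast
    have "\<epsilon> * bdist \<Omega> (\<tau> s) > 0" using \<epsilon> b by simp
    from *[OF this]
    show "\<forall>\<^sub>F t in at s within {0..h}. dist (\<tau> t) (\<tau> s) \<le> (1 + \<epsilon>) * bdist \<Omega> (\<tau> s) * \<bar>t - s\<bar>"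
    proof eventually_elim
      case (elim t)
      have "dist (\<tau> t) (\<tau> s) \<le> norm ((t - s) *\<^sub>R (deriv g (w s) * e)) + (\<epsilon> * bdist \<Omega> (\<tau> s)) * norm (t - s)"
        using elim norm_triangle_sub[of "\<tau> t - \<tau> s" "(t - s) *\<^sub>R (deriv g (w s) * e)"] by (simp add: dist_norm)
      also have "norm ((t - s) *\<^sub>R (deriv g (w s) * e)) = norm (deriv g (w s)) * \<bar>t - s\<bar>"
        using e by (simp add: norm_mult)
      also have "\<dots> \<le> bdist \<Omega> (\<tau> s) * \<bar>t - s\<bar>" by (intro mult_right_mono g'_le) auto
      finally show ?case by (simp add: algebra_simps)
    qed
  qed
  moreover have "\<tau> 0 = a" using g(3)[of a] r(1) by (simp add: \<tau>_def w_def)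
  moreover have "\<tau> t \<in> S \<and> G (\<tau> t) = G a + of_real t * e" if "t \<in> {0..h}" for t
    using \<tau>[OF that] r(2) by (auto simp: w_def)
  ultimately show ?thesis using that h by blast
qed

context qcurve_bigon
begin

text \<open>Lifting a straight line through \<open>G\<close>: a lift of maximal length is obtained by compactness,
  and it ends on the boundary since otherwise a local inverse of \<open>G\<close> would extend it.\<close>

lemma straight_lift:
  assumes G: "continuous_on K G" "G holomorphic_on I"
    and low: "\<And>z. z \<in> I \<Longrightarrow> 1 \<le> norm (deriv G z) * bdist \<Omega> z"
    and z: "z \<in> I" and e: "norm e = 1"
  obtains T \<sigma> where "T > 0" "qcurve \<Omega> T \<sigma>" "\<sigma> 0 = z" "\<sigma> T \<in> J"
    "\<And>t. t \<in> {0..T} \<Longrightarrow> \<sigma> t \<in> K \<and> G (\<sigma> t) = G z + of_real t * e"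
proof -
  define lift where "lift T \<sigma> \<longleftrightarrow> qcurve \<Omega> T \<sigma> \<and> \<sigma> 0 = z \<and>
     (\<forall>t\<in>{0..T}. \<sigma> t \<in> K \<and> G (\<sigma> t) = G z + of_real t * e)" for T \<sigma>
  define S where "S = {T. \<exists>\<sigma>. lift T \<sigma>}"
  have "lift 0 (\<lambda>_. z)" using z IK K_\<Omega> by (auto simp: lift_def qcurve_def)
  then have S0: "0 \<in> S" by (auto simp: S_def)
  have cK: "compact K" using JD(8) by (simp add: K_def)
  have "compact (G ` K)" using G(1) cK by (rule compact_continuous_image)
  then obtain M where M: "\<And>w. w \<in> K \<Longrightarrow> norm (G w) \<le> M" by (meson compact_imp_bounded bounded_iff imageI)
  \<comment> \<open>Along a lift \<open>G\<close> moves at unit speed on a line, while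
    \<open>G\<close> is bounded on \<open>K\<close>.\<close>
  have S_bdd: "T \<le> 2 * M" if "T \<in> S" for T
  proof -
    obtain \<sigma> where \<sigma>: "lift T \<sigma>" using \<open>T \<in> S\<close> by (auto simp: S_def)
    then have T: "T \<ge> 0" by (auto simp: lift_def dest: qcurve_nonneg)
    with \<sigma> have "\<sigma> T \<in> K" "G (\<sigma> T) = G z + of_real T * e" by (auto simp: lift_def)
    then have "norm (of_real T * e) \<le> 2 * M"
      using M[of z] M[of "\<sigma> T"] z IK norm_triangle_ineq4[of "G (\<sigma> T)" "G z"] by auto
    with e T show ?thesis by (simp add: norm_mult)
  qed
  define L where "L = Sup S"
  have bdd: "bdd_above S" by (rule bdd_aboveI[OF S_bdd])
  have L_ge: "T \<le> L" if "T \<in> S" for T unfolding L_def using that bdd by (rule cSup_upper)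
  have L0: "L \<ge> 0" by (rule L_ge[OF S0])
  have "\<exists>T\<in>S. L - 1 / real (Suc n) < T" for n
    using less_cSupD[of S "L - 1 / real (Suc n)"] S0 by (auto simp: L_def)
  then obtain T where T: "\<And>n. T n \<in> S" "\<And>n. L - 1 / real (Suc n) < T n" by metis
  then obtain \<sigma> where \<sigma>: "\<And>n. lift (T n) (\<sigma> n)" unfolding S_def by simp metis
  have T_bds: "0 \<le> T n" "T n \<le> L" for n
    using \<sigma>[of n] L_ge[OF T(1)] by (auto simp: lift_def dest: qcurve_nonneg)
  have Tlim: "T \<longlonglongrightarrow> L"
  proof (rule tendsto_sandwich)
    show "(\<lambda>n. L - 1 / real (Suc n)) \<longlonglongrightarrow> L"
      using tendsto_diff[OF tendsto_const[of L] LIMSEQ_inverse_real_of_nat] by (simp add: inverse_eq_divide)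
    show "\<forall>\<^sub>F n in sequentially. L - 1 / real (Suc n) \<le> T n"
      using less_imp_le[OF T(2)] by (rule always_eventually[OF allI])
    show "(\<lambda>n. L) \<longlonglongrightarrow> L" by simp
    show "\<forall>\<^sub>F n in sequentially. T n \<le> L" using T_bds by (intro always_eventually allI)
  qed
  have q: "qcurve \<Omega> L (\<lambda>t. \<sigma> n (min t (T n)))" for n
  proof (rule qcurve_reparam)
    show "qcurve \<Omega> (T n) (\<sigma> n)" using \<sigma> by (simp add: lift_def)
  qed (use L0 T_bds[of n] in auto)
  have "\<sigma> n (min 0 (T n)) = z" for n using T_bds[of n] \<sigma>[of n] by (simp add: lift_def min_def)
  from qcurve_limit[OF \<Omega>, of L "\<lambda>n t. \<sigma> n (min t (T n))", OF q this]
  obtain \<mu> k where \<mu>: "qcurve \<Omega> L \<mu>" and k: "strict_mono (k :: nat \<Rightarrow> nat)"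
    and lim: "\<And>t. t \<in> {0..L} \<Longrightarrow> (\<lambda>n. \<sigma> (k n) (min t (T (k n)))) \<longlonglongrightarrow> \<mu> t" by blast
  have "\<mu> t \<in> K \<and> G (\<mu> t) = G z + of_real t * e" if t: "t \<in> {0..L}" for t
  proof -
    have *: "\<sigma> (k n) (min t (T (k n))) \<in> K \<and>
       G (\<sigma> (k n) (min t (T (k n)))) = G z + of_real (min t (T (k n))) * e" for n
      using \<sigma>[of "k n"] t T_bds[of "k n"] by (auto simp: lift_def)
    have \<mu>K: "\<mu> t \<in> K"
      using closed_sequentially[OF compact_imp_closed[OF cK] _ lim[OF t]] * by blast
    have "(\<lambda>n. G (\<sigma> (k n) (min t (T (k n))))) \<longlonglongrightarrow> G (\<mu> t)"
      by (rule continuous_on_tendsto_compose[OF G(1) lim[OF t] \<mu>K]) (use * in auto)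
    moreover have "(\<lambda>n. G z + of_real (min t (T (k n))) * e) \<longlonglongrightarrow> G z + of_real (min t L) * e"
      using LIMSEQ_subseq_LIMSEQ[OF Tlim k] by (intro tendsto_intros) (simp add: o_def)
    ultimately have "G (\<mu> t) = G z + of_real (min t L) * e" using * by (simp add: LIMSEQ_unique)
    with t \<mu>K show ?thesis by (simp add: min_def)
  qed
  moreover have "\<mu> 0 = z"
    using lim[of 0] L0 \<open>\<And>n. \<sigma> n (min 0 (T n)) = z\<close> by (auto simp: LIMSEQ_const_iff)
  ultimately have \<mu>_lift: "lift L \<mu>" using \<mu> by (simp add: lift_def)
  have \<mu>J: "\<mu> L \<in> J"
  proof (rule ccontr)
    assume "\<mu> L \<notin> J"
    then have \<mu>I: "\<mu> L \<in> I" using \<mu>_lift L0 by (auto simp: lift_def K_def)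
    have IO: "I \<subseteq> \<Omega>" using IK K_\<Omega> by blast
    obtain h \<tau> where h: "h > 0" and \<tau>: "qcurve \<Omega> h \<tau>" "\<tau> 0 = \<mu> L"
      "\<And>t. t \<in> {0..h} \<Longrightarrow> \<tau> t \<in> I \<and> G (\<tau> t) = G (\<mu> L) + of_real t * e"
      using qcurve_local_inverse[OF \<Omega> JD(2) IO G(2) low \<mu>I e] by metis
    have "lift (L + h) (\<lambda>t. if t \<le> L then \<mu> t else \<tau> (t - L))"
      unfolding lift_def
    proof (intro conjI ballI)
      show "qcurve \<Omega> (L + h) (\<lambda>t. if t \<le> L then \<mu> t else \<tau> (t - L))"
        by (rule qcurve_join[OF \<mu> \<tau>(1)]) (simp add: \<tau>(2))
      show "(if 0 \<le> L then \<mu> 0 else \<tau> (0 - L)) = z" using L0 \<mu>_lift by (simp add: lift_def)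
      fix t assume t: "t \<in> {0..L + h}"
      have \<mu>L: "G (\<mu> L) = G z + of_real L * e" using \<mu>_lift L0 by (simp add: lift_def)
      show "(if t \<le> L then \<mu> t else \<tau> (t - L)) \<in> K"
        using t \<mu>_lift \<tau>(3)[of "t - L"] IK by (auto simp: lift_def)
      show "G (if t \<le> L then \<mu> t else \<tau> (t - L)) = G z + of_real t * e"
        using t \<mu>_lift \<tau>(3)[of "t - L"] \<mu>L by (auto simp: lift_def algebra_simps)
    qed
    then have "L + h \<in> S" by (auto simp: S_def)
    with L_ge[OF this] h show False by simp
  qed
  have "L > 0"
  proof (rule ccontr)
    assume "\<not> L > 0"
    with L0 \<mu>J \<mu>_lift have "z \<in> J" by (auto simp: lift_def)
    with z I_J_disjoint show False by blast
  qed
  then show ?thesis using that[of L \<mu>] \<mu>_lift \<mu>J by (auto simp: lift_def)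
qed

text \<open>Lifts in the directions \<open>e\<close> and \<open>- e\<close> are joined at
  \<open>z\<close>. The last equation is the point: the crosscut has parameter length
  \<open>T\<close> and the images of its ends are exactly \<open>T\<close> apart, whereas on the
  arcs image distances never exceed parameter distances.\<close>

lemma straight_crosscut:
  assumes G: "continuous_on K G" "G holomorphic_on I"
    and low: "\<And>z. z \<in> I \<Longrightarrow> 1 \<le> norm (deriv G z) * bdist \<Omega> z"
    and z: "z \<in> I" and e: "norm e = 1"
  obtains T \<nu> where "T > 0" "qcurve \<Omega> T \<nu>" "\<nu> 0 \<in> J" "\<nu> T \<in> J" "z \<in> \<nu> ` {0..T}"
    "\<And>t. t \<in> {0..T} \<Longrightarrow> \<nu> t \<in> K \<and> (\<exists>s. G (\<nu> t) = G z + of_real s * e)" "norm (G (\<nu> 0) - G (\<nu> T)) = T"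
proof -
  obtain T \<sigma> where T: "T > 0" "qcurve \<Omega> T \<sigma>" "\<sigma> 0 = z" "\<sigma> T \<in> J"
    "\<And>t. t \<in> {0..T} \<Longrightarrow> \<sigma> t \<in> K \<and> G (\<sigma> t) = G z + of_real t * e"
    using straight_lift[OF G low z e] by metis
  have e': "norm (- e) = 1" using e by simp
  obtain U \<tau> where U: "U > 0" "qcurve \<Omega> U \<tau>" "\<tau> 0 = z" "\<tau> U \<in> J"
    "\<And>t. t \<in> {0..U} \<Longrightarrow> \<tau> t \<in> K \<and> G (\<tau> t) = G z + of_real t * (- e)"
    using straight_lift[OF G low z e'] by metis
  define \<nu> where "\<nu> t = (if t \<le> U then \<tau> (U - t) else \<sigma> (t - U))" for t
  have \<nu>: "\<nu> t \<in> K \<and> G (\<nu> t) = G z + of_real (t - U) * e" if "t \<in> {0..U + T}" for t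
    using that U(5)[of "U - t"] T(5)[of "t - U"] by (auto simp: \<nu>_def algebra_simps)
  show ?thesis
  proof (rule that[of "U + T" \<nu>])
    show "qcurve \<Omega> (U + T) \<nu>" unfolding \<nu>_def
      using qcurve_join[OF qcurve_reverse[OF U(2)] T(2)] U(3) T(3) by simp
    show "norm (G (\<nu> 0) - G (\<nu> (U + T))) = U + T"
    proof -
      have "G (\<nu> 0) - G (\<nu> (U + T)) = - (of_real (U + T) * e)"
        using \<nu>[of 0] \<nu>[of "U + T"] T(1) U(1) by (simp add: algebra_simps)
      then show ?thesis using e T(1) U(1) by (simp add: norm_mult del: of_real_add)
    qed
    show "z \<in> \<nu> ` {0..U + T}" using T U by (intro image_eqI[of _ _ U]) (auto simp: \<nu>_def)
    show "\<nu> t \<in> K \<and> (\<exists>s. G (\<nu> t) = G z + of_real s * e)" if "t \<in> {0..U + T}" for t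
      using \<nu>[OF that] by blast
  qed (use T U in \<open>auto simp: \<nu>_def\<close>)
qed

end

section \<open>Level lines near the maximum and the contradiction\<close>

context qcurve_bigon
begin

text \<open>The functional vanishes on the difference \<open>d\<close> of the two end values.
  Openness of \<open>G\<close> gives interior points with different values, so one of them is off
  the common end value, and a change of sign puts it above. Openness also excludes interior
  maxima.\<close>

lemma extremal_direction:
  assumes G: "continuous_on K G" "G holomorphic_on I"
    and low: "\<And>z. z \<in> I \<Longrightarrow> 1 \<le> norm (deriv G z) * bdist \<Omega> z"
  obtains \<omega> where "norm \<omega> = 1" "Re (\<omega> * G (\<gamma> 0)) = Re (\<omega> * G (\<gamma> l))"
    "\<exists>z\<in>K. Re (\<omega> * G (\<gamma> 0)) < Re (\<omega> * G z)"
    "\<And>z. z \<in> I \<Longrightarrow> \<exists>z'\<in>I. Re (\<omega> * G z) < Re (\<omega> * G z')"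
proof -
  have G'0: "deriv G z \<noteq> 0" if "z \<in> I" for z using low[OF that] by auto
  have up: "\<exists>z'\<in>I. Re (\<omega> * G z) < Re (\<omega> * G z')" if z: "z \<in> I" and \<omega>: "norm \<omega> = 1" for z \<omega>
  proof -
    obtain r where r: "r > 0" "ball z r \<subseteq> I" "open (G ` ball z r)"
      using has_complex_derivative_locally_invertible[OF G(2) z JD(2) G'0[OF z]] by metis
    have "G z \<in> G ` ball z r" using r(1) by auto
    then obtain h where h: "h > 0" "ball (G z) h \<subseteq> G ` ball z r" using r(3) open_contains_ball by blast
    \<comment> \<open>A step of length \<open>h / 2\<close> in the direction
      \<open>cnj \<omega>\<close> raises the functional by \<open>h / 2\<close>.\<close>
    define w where "w = G z + of_real (h / 2) * cnj \<omega>"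
    have "w \<in> ball (G z) h" using h(1) \<omega> by (simp add: w_def dist_norm norm_mult)
    then obtain z' where z': "z' \<in> ball z r" "w = G z'" using h(2) by blast
    have "\<omega> * cnj \<omega> = 1" using \<omega> by (simp add: complex_norm_square[symmetric])
    then have "\<omega> * w = \<omega> * G z + of_real (h / 2)" by (simp add: w_def algebra_simps)
    then have "Re (\<omega> * G z') = Re (\<omega> * G z) + h / 2" using z'(2) by simp
    with z'(1) r(2) h(1) show ?thesis by (intro bexI[of _ z']) auto
  qed
  define d where "d = G (\<gamma> 0) - G (\<gamma> l)"
  obtain \<omega>0 where \<omega>0: "norm \<omega>0 = 1" "Re (\<omega>0 * d) = 0"
  proof (cases "d = 0")
    case True then show ?thesis using that[of 1] by simp
  next
    case False
    have "\<i> * cnj d / of_real (norm d) * d = \<i> * (d * cnj d) / of_real (norm d)" by simp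
    also have "\<dots> = \<i> * of_real (norm d)" using False
      by (simp add: complex_norm_square[symmetric] power2_eq_square)
    finally show ?thesis using False by (intro that[of "\<i> * cnj d / of_real (norm d)"]) (auto simp: norm_divide norm_mult)
  qed
  obtain z where z: "z \<in> I" using JD(4) by blast
  obtain z' where z': "z' \<in> I" "Re (\<omega>0 * G z) < Re (\<omega>0 * G z')" using up[OF z \<omega>0(1)] by blast
  have eq: "Re (\<omega>0 * G (\<gamma> 0)) = Re (\<omega>0 * G (\<gamma> l))" using \<omega>0(2) by (simp add: d_def right_diff_distrib)
  show ?thesis
  proof (cases "Re (\<omega>0 * G (\<gamma> 0)) < Re (\<omega>0 * G z')")
    case True
    then show ?thesis using that[of \<omega>0] \<omega>0(1) eq up[OF _ \<omega>0(1)] z'(1) IK by blast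
  next
    case False
    have "Re (- \<omega>0 * G (\<gamma> 0)) < Re (- \<omega>0 * G z)" using False z'(2) by simp
    moreover have "norm (- \<omega>0) = 1" using \<omega>0 by simp
    moreover have "Re (- \<omega>0 * G (\<gamma> 0)) = Re (- \<omega>0 * G (\<gamma> l))" using eq by simp
    ultimately show ?thesis using that[of "- \<omega>0"] up z IK by blast
  qed
qed

text \<open>The length \<open>a + b\<close> is used up in the direction on which the functional vanishes.\<close>

lemma level_constant:
  fixes \<omega> P Q W :: complex
  assumes \<omega>: "norm \<omega> = 1" and a: "norm (W - P) \<le> a" and b: "norm (Q - W) \<le> b"
    and ab: "a + b \<le> norm (Q - P)" and PQ: "Re (\<omega> * P) = c" "Re (\<omega> * Q) = c"
  shows "Re (\<omega> * W) = c"
proof -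
  define u v where "u = \<omega> * (W - P)" and "v = \<omega> * (Q - W)"
  have n: "norm u \<le> a" "norm v \<le> b" using a b \<omega> by (simp_all add: u_def v_def norm_mult)
  have uv: "u + v = \<omega> * (Q - P)" by (simp add: u_def v_def algebra_simps)
  then have "Re (u + v) = 0" using PQ by (simp add: right_diff_distrib)
  then have "norm (u + v) = \<bar>Im (u + v)\<bar>" by (simp add: cmod_def)
  moreover have "norm (u + v) = norm (Q - P)" unfolding uv using \<omega> by (simp add: norm_mult)
  ultimately have "a + b \<le> \<bar>Im u + Im v\<bar>" using ab by simp
  moreover have "\<bar>Im u\<bar> \<le> norm u" "\<bar>Im v\<bar> \<le> norm v" by (rule abs_Im_le_cmod)+
  ultimately have "norm u \<le> \<bar>Im u\<bar>" using n by linarith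
  then have "(norm u)\<^sup>2 \<le> (Im u)\<^sup>2" by (simp add: abs_le_square_iff[symmetric])
  then have "(Re u)\<^sup>2 \<le> 0" by (simp add: cmod_power2)
  then have "Re u = 0" by simp
  then show ?thesis using PQ by (simp add: u_def right_diff_distrib)
qed

text \<open>For a level just below the maximum two estimates meet: minimality bounds the parameter
  distance of the crosscut's ends on their arc by \<open>T\<close>, and the Lipschitz bound for
  \<open>G\<close> shows that it is at least \<open>T\<close>. Equality forces the piece of the arc
  in between onto the same level, so each such level is one of countably many values.\<close>

theorem not_minimal:
  assumes min\<gamma>: "\<And>s t V \<nu>. s \<in> {0..l} \<Longrightarrow> t \<in> {0..l} \<Longrightarrow> qcurve \<Omega> V \<nu> \<Longrightarrow> \<nu> 0 = \<gamma> s \<Longrightarrow> \<nu> V = \<gamma> t \<Longrightarrow> \<bar>s - t\<bar> \<le> V"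
    and min\<eta>: "\<And>s t V \<nu>. s \<in> {0..l} \<Longrightarrow> t \<in> {0..l} \<Longrightarrow> qcurve \<Omega> V \<nu> \<Longrightarrow> \<nu> 0 = \<eta> s \<Longrightarrow> \<nu> V = \<eta> t \<Longrightarrow> \<bar>s - t\<bar> \<le> V"
  shows False
proof -
  obtain G where G: "continuous_on K G" "G holomorphic_on I"
    and low: "\<And>z. z \<in> I \<Longrightarrow> 1 \<le> norm (deriv G z) * bdist \<Omega> z"
    and G\<gamma>: "\<And>s t. s \<in> {0..l} \<Longrightarrow> t \<in> {0..l} \<Longrightarrow> dist (G (\<gamma> s)) (G (\<gamma> t)) \<le> \<bar>s - t\<bar>"
    and G\<eta>: "\<And>s t. s \<in> {0..l} \<Longrightarrow> t \<in> {0..l} \<Longrightarrow> dist (G (\<eta> s)) (G (\<eta> t)) \<le> \<bar>s - t\<bar>"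
    using flat_majorant by metis
  obtain \<omega> where \<omega>: "norm \<omega> = 1" "Re (\<omega> * G (\<gamma> 0)) = Re (\<omega> * G (\<gamma> l))"
    "\<exists>z\<in>K. Re (\<omega> * G (\<gamma> 0)) < Re (\<omega> * G z)"
    "\<And>z. z \<in> I \<Longrightarrow> \<exists>z'\<in>I. Re (\<omega> * G z) < Re (\<omega> * G z')"
    using extremal_direction[OF G low] by metis
  define f where "f z = Re (\<omega> * G z)" for z
  have f: "continuous_on K f" unfolding f_def by (intro continuous_intros G(1))
  have cK: "compact K" using JD(8) by (simp add: K_def)
  have clI: "closure I = K" using JD(7) by (simp add: K_def)
  have "K \<noteq> {}" using JD(4) IK by blast
  then obtain m where m: "m \<in> K" "\<And>z. z \<in> K \<Longrightarrow> f z \<le> f m"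
    using continuous_attains_sup[OF cK _ f] by blast
  define M where "M = f m"
  have fM: "f z \<le> M" if "z \<in> K" for z using m(2)[OF that] by (simp add: M_def)
  have M_ends: "f (\<gamma> 0) < M" "f (\<gamma> l) < M"
    using \<omega>(2,3) fM unfolding f_def by (auto intro: less_le_trans)
  have M_I: "f z < M" if "z \<in> I" for z
    using \<omega>(4)[OF that] fM IK unfolding f_def by (meson less_le_trans subsetD)
  \<comment> \<open>The maximum points on the two arcs. The arcs share only their ends, where
    \<open>f\<close> is below \<open>M\<close>, so these closed sets are disjoint.\<close>
  define A where "A = {z \<in> \<gamma> ` {0..l}. f z = M}"
  define B where "B = {z \<in> \<eta> ` {0..l}. f z = M}"
  have c\<gamma>: "compact (\<gamma> ` {0..l})" and c\<eta>: "compact (\<eta> ` {0..l})"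
    by (intro compact_continuous_image qcurve_continuous_on[OF q\<gamma>] qcurve_continuous_on[OF q\<eta>] compact_Icc)+
  have sub: "\<gamma> ` {0..l} \<subseteq> K" "\<eta> ` {0..l} \<subseteq> K" using JK J_eq by auto
  have "A = \<gamma> ` {0..l} \<inter> f -` {M}" "B = \<eta> ` {0..l} \<inter> f -` {M}" by (auto simp: A_def B_def)
  then have cAB: "closed A" "closed B"
    using continuous_closed_preimage[OF continuous_on_subset[OF f sub(1)] compact_imp_closed[OF c\<gamma>] closed_singleton]
      continuous_closed_preimage[OF continuous_on_subset[OF f sub(2)] compact_imp_closed[OF c\<eta>] closed_singleton] by simp_all
  have meetM: "z \<notin> \<eta> ` {0..l}" if "z \<in> \<gamma> ` {0..l}" "f z = M" for z
    using meet that M_ends by auto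
  have "A \<inter> B = {}" using meetM by (auto simp: A_def B_def)
  then obtain U0 V0 where UV0: "open U0" "open V0" "A \<subseteq> U0" "B \<subseteq> V0" "U0 \<inter> V0 = {}"
    using separation_normal[OF cAB] by metis
  \<comment> \<open>Removing the other arc ensures that a point of \<open>J\<close> in
    \<open>U\<close> lies on \<open>\<gamma>\<close>, and one in \<open>V\<close> on
    \<open>\<eta>\<close>.\<close>
  define U where "U = U0 - \<eta> ` {0..l}"
  define V where "V = V0 - \<gamma> ` {0..l}"
  have UV: "open U" "open V" "U \<inter> V = {}" "A \<subseteq> U" "B \<subseteq> V"
    using UV0 c\<gamma> c\<eta> meetM by (auto simp: U_def V_def A_def B_def intro!: open_Diff compact_imp_closed)
  \<comment> \<open>Compactness: off the neighbourhoods of its maximum points, \<open>f\<close>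
    stays a definite amount below \<open>M\<close>.\<close>
  have "\<exists>c1<M. \<forall>z\<in>K - (U \<union> V). f z \<le> c1"
  proof (cases "K - (U \<union> V) = {}")
    case True then show ?thesis by (intro exI[of _ "M - 1"]) auto
  next
    case False
    have "compact (K - (U \<union> V))" using cK UV by (intro compact_diff open_Un)
    moreover have "continuous_on (K - (U \<union> V)) f" by (rule continuous_on_subset[OF f]) auto
    ultimately obtain z where z: "z \<in> K - (U \<union> V)" "\<forall>w\<in>K - (U \<union> V). f w \<le> f z"
      using continuous_attains_sup False by blast
    have "f z \<noteq> M"
    proof
      assume "f z = M"
      with M_I[of z] z(1) have "z \<in> J" by (auto simp: K_def)
      with \<open>f z = M\<close> have "z \<in> A \<union> B" by (auto simp: J_eq A_def B_def)
      with UV z(1) show False by blast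
    qed
    with fM[of z] z(1) have "f z < M" by auto
    with z(2) show ?thesis by blast
  qed
  then obtain c1 where c1: "c1 < M" "\<And>z. z \<in> K \<Longrightarrow> c1 < f z \<Longrightarrow> z \<in> U \<union> V" by (meson DiffI not_less)
  obtain z0 where z0: "z0 \<in> I" using JD(4) by blast
  \<comment> \<open>Taking levels above \<open>f z0\<close> guarantees, as \<open>I\<close> is
    connected, that they are attained inside.\<close>
  define c2 where "c2 = max c1 (f z0)"
  have c2: "c2 < M" using c1(1) M_I[OF z0] by (simp add: c2_def)
  txt \<open>The rational parameters witness that a level is taken on a nondegenerate interval.\<close>
  have key: "c \<in> (\<lambda>r. f (\<gamma> r)) ` \<rat> \<union> (\<lambda>r. f (\<eta> r)) ` \<rat>" if c: "c \<in> {c2<..<M}" for c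
  proof -
    have "\<exists>z\<in>I. c < f z"
    proof -
      have "\<exists>y\<in>I. dist y m < d" if "d > 0" for d
        using m(1) that unfolding clI[symmetric] closure_approachable by blast
      moreover obtain d where "d > 0" "\<And>y. y \<in> K \<Longrightarrow> dist y m < d \<Longrightarrow> dist (f y) (f m) < M - c"
        using f m(1) c unfolding continuous_on_iff by (metis diff_gt_0_iff_gt greaterThanLessThan_iff)
      ultimately obtain y where "y \<in> I" "dist (f y) (f m) < M - c" using IK by blast
      then show ?thesis by (intro bexI[of _ y]) (auto simp: dist_real_def M_def)
    qed
    then obtain z1 where z1: "z1 \<in> I" "c < f z1" by blast
    have "connected (f ` I)" by (intro connected_continuous_image continuous_on_subset[OF f IK] JD(3))
    moreover have "f z0 \<le> c" using c by (simp add: c2_def)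
    ultimately have "c \<in> f ` I"
      using z0 z1 unfolding connected_iff_interval by (meson imageI less_imp_le)
    then obtain z where z: "z \<in> I" "f z = c" by blast
    \<comment> \<open>Moving along \<open>e\<close> leaves \<open>Re (\<omega> * _)\<close>
      unchanged, so the crosscut stays on the level \<open>c\<close>.\<close>
    define e where "e = \<i> * cnj \<omega>"
    have e: "norm e = 1" using \<omega>(1) by (simp add: e_def norm_mult)
    have \<omega>e: "Re (\<omega> * (of_real s * e)) = 0" for s
    proof -
      have "\<omega> * (of_real s * e) = of_real s * \<i> * (\<omega> * cnj \<omega>)" by (simp add: e_def)
      also have "\<omega> * cnj \<omega> = 1" using \<omega>(1) by (simp add: complex_norm_square[symmetric])
      finally have eq: "\<omega> * (of_real s * e) = of_real s * \<i>" by simp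
      show ?thesis unfolding eq by simp
    qed
    obtain T \<nu> where T: "T > 0" and \<nu>: "qcurve \<Omega> T \<nu>" "\<nu> 0 \<in> J" "\<nu> T \<in> J" "z \<in> \<nu> ` {0..T}"
      "\<And>t. t \<in> {0..T} \<Longrightarrow> \<nu> t \<in> K \<and> (\<exists>s. G (\<nu> t) = G z + of_real s * e)" "norm (G (\<nu> 0) - G (\<nu> T)) = T"
      using straight_crosscut[OF G low z(1) e] by metis
    have f\<nu>: "f (\<nu> t) = c" if t: "t \<in> {0..T}" for t
    proof -
      obtain s where "G (\<nu> t) = G z + of_real s * e" using \<nu>(5)[OF t] by blast
      then have "f (\<nu> t) = f z + Re (\<omega> * (of_real s * e))" by (simp add: f_def distrib_left)
      then show ?thesis using \<omega>e z(2) by simp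
    qed
    have "\<nu> ` {0..T} \<subseteq> U \<union> V"
    proof
      fix w assume "w \<in> \<nu> ` {0..T}"
      then obtain t where t: "t \<in> {0..T}" "w = \<nu> t" by blast
      have "c1 < f (\<nu> t)" unfolding f\<nu>[OF t(1)] using c by (simp add: c2_def)
      then show "w \<in> U \<union> V" using c1(2)[of "\<nu> t"] \<nu>(5)[OF t(1)] t(2) by blast
    qed
    moreover have "connected (\<nu> ` {0..T})"
      by (intro connected_continuous_image qcurve_continuous_on[OF \<nu>(1)]) auto
    \<comment> \<open>A connected level line cannot pass from \<open>U\<close> to \<open>V\<close>,
      so its two ends lie on the same arc.\<close>
    ultimately have "U \<inter> \<nu> ` {0..T} = {} \<or> V \<inter> \<nu> ` {0..T} = {}"
      using connectedD[OF _ UV(1,2)] UV(3) by blast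
    then have "\<nu> ` {0..T} \<subseteq> U \<or> \<nu> ` {0..T} \<subseteq> V" using \<open>\<nu> ` {0..T} \<subseteq> U \<union> V\<close> by blast
    moreover have T0: "0 \<in> {0..T}" "T \<in> {0..T}" using T by auto
    ultimately have ends: "{\<nu> 0, \<nu> T} \<subseteq> \<gamma> ` {0..l} \<or> {\<nu> 0, \<nu> T} \<subseteq> \<eta> ` {0..l}"
      using \<nu>(2,3) unfolding J_eq U_def V_def by blast
    have level: "\<exists>r\<in>\<rat>. f (\<kappa> r) = c"
      if st: "s \<in> {0..l}" "t \<in> {0..l}" "\<nu> 0 = \<kappa> s" "\<nu> T = \<kappa> t" and lt: "\<bar>s - t\<bar> \<le> T"
        and lip: "\<And>s t. s \<in> {0..l} \<Longrightarrow> t \<in> {0..l} \<Longrightarrow> dist (G (\<kappa> s)) (G (\<kappa> t)) \<le> \<bar>s - t\<bar>" for \<kappa> s t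
    proof -
      have T_eq: "norm (G (\<kappa> s) - G (\<kappa> t)) = T" using \<nu>(6) st by simp
      then have "T = \<bar>s - t\<bar>" using lip[OF st(1,2)] lt by (simp add: dist_norm)
      define a b where "a = min s t" and "b = max s t"
      have ab: "a < b" "b - a = T" using T \<open>T = \<bar>s - t\<bar>\<close> by (auto simp: a_def b_def)
      have abl: "a \<in> {0..l}" "b \<in> {0..l}" using st by (auto simp: a_def b_def)
      have nab: "norm (G (\<kappa> b) - G (\<kappa> a)) = T" using T_eq
        by (cases "s \<le> t") (auto simp: a_def b_def norm_minus_commute min_def max_def)
      have fab: "f (\<kappa> a) = c" "f (\<kappa> b) = c"
        using f\<nu>[OF T0(1)] f\<nu>[OF T0(2)] st by (auto simp: a_def b_def min_def max_def)
      obtain r where r: "r \<in> \<rat>" "a < r" "r < b" using Rats_dense_in_real[OF ab(1)] by blast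
      have rl: "r \<in> {0..l}" using r abl by auto
      have "Re (\<omega> * G (\<kappa> r)) = c"
      proof (rule level_constant[OF \<omega>(1), of _ "G (\<kappa> a)" "r - a" "G (\<kappa> b)" "b - r"])
        show "norm (G (\<kappa> r) - G (\<kappa> a)) \<le> r - a" using lip[OF rl abl(1)] r by (simp add: dist_norm)
        show "norm (G (\<kappa> b) - G (\<kappa> r)) \<le> b - r" using lip[OF abl(2) rl] r by (simp add: dist_norm)
      qed (use nab ab fab in \<open>auto simp: f_def\<close>)
      with r(1) show ?thesis by (auto simp: f_def)
    qed
    from ends show ?thesis
    proof
      assume "{\<nu> 0, \<nu> T} \<subseteq> \<gamma> ` {0..l}"
      then obtain s t where st: "s \<in> {0..l}" "t \<in> {0..l}" "\<nu> 0 = \<gamma> s" "\<nu> T = \<gamma> t" by blast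
      from level[OF st min\<gamma>[OF st(1,2) \<nu>(1) st(3,4)] G\<gamma>] show ?thesis by blast
    next
      assume "{\<nu> 0, \<nu> T} \<subseteq> \<eta> ` {0..l}"
      then obtain s t where st: "s \<in> {0..l}" "t \<in> {0..l}" "\<nu> 0 = \<eta> s" "\<nu> T = \<eta> t" by blast
      from level[OF st min\<eta>[OF st(1,2) \<nu>(1) st(3,4)] G\<eta>] show ?thesis by blast
    qed
  qed
  have "countable ((\<lambda>r. f (\<gamma> r)) ` \<rat> \<union> (\<lambda>r. f (\<eta> r)) ` \<rat>)"
    by (intro countable_Un countable_image countable_rat)
  then have "countable {c2<..<M}" by (rule countable_subset[rotated]) (use key in blast)
  then show False using uncountable_open_interval[of c2 M] c2 by simp
qed

end

section \<open>Uniqueness\<close>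

lemma bdist_le_dist_outside:
  fixes z p :: "'a::real_normed_vector"
  assumes "z \<in> \<Omega>" "p \<notin> \<Omega>"
  shows "bdist \<Omega> z \<le> dist z p"
proof -
  have "closed_segment z p \<inter> \<Omega> \<noteq> {}" "closed_segment z p - \<Omega> \<noteq> {}" using assms by auto
  from connected_Int_frontier[OF connected_segment(1) this]
  obtain w where w: "w \<in> closed_segment z p" "w \<in> frontier \<Omega>" by blast
  have "bdist \<Omega> z \<le> dist z w" by (rule infdist_le[OF w(2)])
  also have "\<dots> \<le> dist z p" using segment_bound(1)[OF w(1)] by (simp add: dist_norm norm_minus_commute)
  finally show ?thesis .
qed

text \<open>Since \<open>1 / bdist \<Omega> z \<ge> 1 / |z - p|\<close>, the flat metric \<open>|dz| / |z - p|\<close> does not exceed the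
  quasihyperbolic one.\<close>

lemma qcurve_log_lift:
  fixes \<kappa> :: "real \<Rightarrow> complex"
  assumes q: "qcurve \<Omega> V \<kappa>" and p: "p \<notin> \<Omega>" and g: "continuous_on {0..V} g"
    and ex: "\<And>t. t \<in> {0..V} \<Longrightarrow> exp (g t) = \<kappa> t - p"
  shows "dist (g 0) (g V) \<le> V"
proof -
  have "dist (g 0) (g V) \<le> 1 * (V - 0)"
  proof (rule dist_le_of_locally_lipschitz)
    show "0 \<le> V" by (rule qcurve_nonneg[OF q])
    fix s e :: real assume s: "s \<in> {0..V}" and e: "e > 0"
    \<comment> \<open>Chosen such that \<open>(1 + e) * (1 - c) = 1 + e / 2\<close>: the fraction
      \<open>c\<close> is granted to the linearization of \<open>exp\<close>, and the excess over 1
      absorbs the factor \<open>exp \<bar>t - s\<bar>\<close>.\<close>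
    define c where "c = (e / 2) / (1 + e)"
    have "1 + e \<noteq> 0" using e by simp
    then have ec: "(1 + e) * c = e / 2"
      unfolding c_def by (subst times_divide_eq_right) (rule nonzero_mult_div_cancel_left)
    have c: "c > 0" "c < 1" using e by (simp_all add: c_def field_simps)
    moreover have "(1 + e) * (1 - c) = 1 + e / 2" using ec by (simp add: right_diff_distrib)
    ultimately have c: "c > 0" "c < 1" "1 < (1 + e) * (1 - c)" using e by simp_all
    define m where "m = norm (\<kappa> s - p)"
    have m: "m > 0" "m = norm (exp (g s))" using ex[OF s, symmetric] by (auto simp: m_def)
    have b: "bdist \<Omega> (\<kappa> s) \<le> m"
      using bdist_le_dist_outside[OF qcurve_mem[OF q s] p] by (simp add: m_def dist_norm)
    have "(exp has_derivative (*) (exp (g s))) (at (g s))"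
      using DERIV_exp[of "g s"] by (simp add: has_field_derivative_def)
    then have "\<exists>d>0. \<forall>z. norm (z - g s) < d \<longrightarrow>
        norm (exp z - exp (g s) - exp (g s) * (z - g s)) \<le> (c * m) * norm (z - g s)"
      unfolding has_derivative_at_alt using c(1) m(1) by simp
    then obtain d where d: "d > 0" "\<And>z. norm (z - g s) < d \<Longrightarrow>
        norm (exp z - exp (g s) - exp (g s) * (z - g s)) \<le> (c * m) * norm (z - g s)" by blast
    have "(g \<longlongrightarrow> g s) (at s within {0..V})" using g s by (simp add: continuous_on_def)
    then have "\<forall>\<^sub>F t in at s within {0..V}. dist (g t) (g s) < d" using d(1) by (rule tendstoD)
    moreover have "\<forall>\<^sub>F t in at s within {0..V}. t \<in> {0..V}" by (auto simp: eventually_at_filter)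
    moreover have "((\<lambda>t. exp \<bar>t - s\<bar>) \<longlongrightarrow> exp \<bar>s - s\<bar>) (at s within {0..V})"
      by (intro tendsto_intros)
    then have "\<forall>\<^sub>F t in at s within {0..V}. exp \<bar>t - s\<bar> < (1 + e) * (1 - c)"
      using c(3) by (intro order_tendstoD(2)) auto
    ultimately show "\<forall>\<^sub>F t in at s within {0..V}. dist (g t) (g s) \<le> (1 + e) * \<bar>t - s\<bar>"
    proof eventually_elim
      case (elim t)
      have "m * norm (g t - g s) = norm (exp (g s) * (g t - g s))" by (simp add: norm_mult m(2))
      also have "\<dots> \<le> norm (exp (g t) - exp (g s)) + (c * m) * norm (g t - g s)"
        using d(2)[of "g t"] elim(1) norm_triangle_sub[of "exp (g s) * (g t - g s)" "exp (g t) - exp (g s)"]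
        by (simp add: dist_norm norm_minus_commute)
      also have "norm (exp (g t) - exp (g s)) = dist (\<kappa> t) (\<kappa> s)"
        using ex[OF elim(2)] ex[OF s] by (simp add: dist_norm)
      also have "\<dots> \<le> bdist \<Omega> (\<kappa> s) * (exp \<bar>t - s\<bar> * \<bar>t - s\<bar>)"
        by (rule qcurve_dist_le_exp[OF q s elim(2)])
      also have "\<dots> \<le> m * (exp \<bar>t - s\<bar> * \<bar>t - s\<bar>)" using b by (intro mult_right_mono) auto
      also have "\<dots> \<le> m * (((1 + e) * (1 - c)) * \<bar>t - s\<bar>)"
        using elim(3) m(1) by (intro mult_left_mono mult_right_mono) auto
      finally have "m * ((1 - c) * norm (g t - g s)) \<le> m * ((1 - c) * ((1 + e) * \<bar>t - s\<bar>))"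
        by (simp add: algebra_simps)
      then show ?case using m(1) c(2) by (simp add: dist_norm)
    qed
  qed simp
  then show ?thesis by simp
qed

text \<open>A continuous logarithm of \<open>j - p\<close> changes by \<open>2 * pi\<close> in
  modulus along the loop, but by at most \<open>l\<close> along each of its two arcs.\<close>

lemma two_pi_le_winding_lengths:
  fixes \<gamma> \<eta> :: "real \<Rightarrow> complex"
  assumes \<gamma>: "qcurve \<Omega> l \<gamma>" and \<eta>: "qcurve \<Omega> l \<eta>" and l: "l > 0" and fin: "\<gamma> l = \<eta> l"
    and p: "p \<notin> \<Omega>"
    and j: "j = (\<lambda>t. \<gamma> (l * t)) +++ reversepath (\<lambda>t. \<eta> (l * t))"
    and wn: "norm (winding_number j p) = 1"
    and path: "path j" and im: "p \<notin> path_image j"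
  shows "pi \<le> l"
proof -
  obtain q where q: "path q" "pathfinish q - pathstart q = 2 * of_real pi * \<i> * winding_number j p"
    "\<And>t. t \<in> {0..1} \<Longrightarrow> j t = p + exp (q t)"
    using winding_number_as_continuous_log[OF path im] by metis
  have qc: "continuous_on {0..1} q" using q(1) by (simp add: path_def)
  \<comment> \<open>The first half of the join runs through \<open>\<gamma>\<close>, hence the
    parameter \<open>t / (2 * l)\<close>; the second runs backwards through \<open>\<eta>\<close>,
    hence \<open>1 - t / (2 * l)\<close> further down.\<close>
  have "dist (q (0 / (2 * l))) (q (l / (2 * l))) \<le> l"
  proof (rule qcurve_log_lift[OF \<gamma> p, where g = "\<lambda>t. q (t / (2 * l))"])
    show "continuous_on {0..l} (\<lambda>t. q (t / (2 * l)))"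
      using l by (intro continuous_on_compose2[OF qc]) (auto intro!: continuous_intros simp: field_simps)
    fix t assume t: "t \<in> {0..l}"
    then have "t / (2 * l) \<in> {0..1}" "t / (2 * l) \<le> 1/2" using l by (auto simp: field_simps)
    with q(3)[of "t / (2 * l)"] l show "exp (q (t / (2 * l))) = \<gamma> t - p" by (simp add: j joinpaths_def)
  qed
  moreover have "dist (q (1 - 0 / (2 * l))) (q (1 - l / (2 * l))) \<le> l"
  proof (rule qcurve_log_lift[OF \<eta> p, where g = "\<lambda>t. q (1 - t / (2 * l))"])
    show "continuous_on {0..l} (\<lambda>t. q (1 - t / (2 * l)))"
      using l by (intro continuous_on_compose2[OF qc]) (auto intro!: continuous_intros simp: field_simps)
    fix t assume t: "t \<in> {0..l}"
    define u where "u = 1 - t / (2 * l)"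
    have u: "u \<in> {0..1}" "1/2 \<le> u" using t l by (auto simp: u_def field_simps)
    have "j u = \<eta> t"
    proof (cases "u = 1/2")
      case True
      then have "t = l" using l by (simp add: u_def field_simps)
      with fin show ?thesis unfolding True by (simp add: j joinpaths_def)
    next
      case False
      have "l * (1 - (2 * u - 1)) = t" using l by (simp add: u_def field_simps)
      with False u show ?thesis by (simp add: j joinpaths_def reversepath_def)
    qed
    with q(3)[OF u(1)] show "exp (q (1 - t / (2 * l))) = \<eta> t - p"
      by (simp add: u_def eq_diff_eq add.commute)
  qed
  moreover have "dist (q 0) (q 1) = 2 * pi"
    using q(2) wn by (simp add: pathfinish_def pathstart_def dist_norm norm_minus_commute norm_mult)
  ultimately show ?thesis using l dist_triangle2[of "q 0" "q 1" "q (1/2)"] by (simp add: dist_commute)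
qed

section \<open>Splicing minimizing curves and the global argument\<close>

text \<open>Splicing \<open>\<nu>\<close> into the minimal curve gives a competitor of length
  \<open>s + V + (D - t)\<close>; the other order of \<open>s\<close> and \<open>t\<close> follows
  by reversing \<open>\<nu>\<close>.\<close>

lemma minimal_qcurve_segment:
  assumes m: "minimal_qcurve \<Omega> x y D \<kappa>" and st: "s \<in> {0..D}" "t \<in> {0..D}"
    and \<nu>: "qcurve \<Omega> V \<nu>" "\<nu> 0 = \<kappa> s" "\<nu> V = \<kappa> t"
  shows "\<bar>s - t\<bar> \<le> V"
proof -
  have q: "qcurve \<Omega> D \<kappa>" "\<kappa> 0 = x" "\<kappa> D = y"
    and min: "\<And>V \<mu>. qcurve \<Omega> V \<mu> \<Longrightarrow> \<mu> 0 = x \<Longrightarrow> \<mu> V = y \<Longrightarrow> D \<le> V"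
    using m unfolding minimal_qcurve_def by blast+
  have main: "t - s \<le> V" if st: "s \<in> {0..D}" "t \<in> {0..D}" and \<nu>: "qcurve \<Omega> V \<nu>" "\<nu> 0 = \<kappa> s" "\<nu> V = \<kappa> t" for s t \<nu>
  proof -
    have V: "V \<ge> 0" by (rule qcurve_nonneg[OF \<nu>(1)])
    have 1: "qcurve \<Omega> s \<kappa>" using st by (intro qcurve_reparam[OF q(1), of s "\<lambda>t. t"]) auto
    have 3: "qcurve \<Omega> (D - t) (\<lambda>r. \<kappa> (t + r))" using st by (intro qcurve_reparam[OF q(1)]) auto
    define \<mu> where "\<mu> r = (if r \<le> V then \<nu> r else \<kappa> (t + (r - V)))" for r
    have 23: "qcurve \<Omega> (V + (D - t)) \<mu>" unfolding \<mu>_def using qcurve_join[OF \<nu>(1) 3] \<nu>(3) by simp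
    have \<mu>: "\<mu> 0 = \<kappa> s" "\<mu> (V + (D - t)) = y" using V st \<nu> q(3) by (auto simp: \<mu>_def)
    have "qcurve \<Omega> (s + (V + (D - t))) (\<lambda>r. if r \<le> s then \<kappa> r else \<mu> (r - s))"
      using qcurve_join[OF 1 23] \<mu>(1) by simp
    then have "D \<le> s + (V + (D - t))"
    proof (rule min)
      show "(if 0 \<le> s then \<kappa> 0 else \<mu> (0 - s)) = x" using st q(2) by simp
      show "(if s + (V + (D - t)) \<le> s then \<kappa> (s + (V + (D - t))) else \<mu> (s + (V + (D - t)) - s)) = y"
      proof (cases "V + (D - t) = 0")
        case True
        with \<mu> show ?thesis by simp
      next
        case False
        moreover have "V + (D - t) \<ge> 0" using V st by simp
        ultimately show ?thesis using \<mu>(2) by simp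
      qed
    qed
    then show ?thesis by simp
  qed
  have "qcurve \<Omega> V (\<lambda>r. \<nu> (V - r))" by (rule qcurve_reverse[OF \<nu>(1)])
  from main[OF st \<nu>] main[OF st(2,1) this] \<nu>(2,3) show ?thesis by auto
qed

text \<open>Following one curve up to the crossing and the other one afterwards gives a competitor
  of length \<open>s + (D - t)\<close>, so \<open>t \<le> s\<close>, and symmetry does the rest.
  Applied to a curve and itself this is injectivity.\<close>

lemma minimal_qcurves_cross:
  assumes m: "minimal_qcurve \<Omega> x y D \<kappa>" "minimal_qcurve \<Omega> x y D \<mu>" and st: "s \<in> {0..D}" "t \<in> {0..D}"
    and eq: "\<kappa> s = \<mu> t"
  shows "s = t"
proof -
  have main: "t \<le> s" if m: "minimal_qcurve \<Omega> x y D \<kappa>" "minimal_qcurve \<Omega> x y D \<mu>" and st: "s \<in> {0..D}" "t \<in> {0..D}"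
    and eq: "\<kappa> s = \<mu> t" for \<kappa> \<mu> s t
  proof -
    have q: "qcurve \<Omega> D \<kappa>" "\<kappa> 0 = x" "qcurve \<Omega> D \<mu>" "\<mu> D = y"
      and min: "\<And>V \<mu>. qcurve \<Omega> V \<mu> \<Longrightarrow> \<mu> 0 = x \<Longrightarrow> \<mu> V = y \<Longrightarrow> D \<le> V"
      using m unfolding minimal_qcurve_def by blast+
    have 1: "qcurve \<Omega> s \<kappa>" using st by (intro qcurve_reparam[OF q(1), of s "\<lambda>t. t"]) auto
    have 2: "qcurve \<Omega> (D - t) (\<lambda>r. \<mu> (t + r))" using st by (intro qcurve_reparam[OF q(3)]) auto
    have "qcurve \<Omega> (s + (D - t)) (\<lambda>r. if r \<le> s then \<kappa> r else \<mu> (t + (r - s)))"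
      using qcurve_join[OF 1 2] eq by simp
    then have "D \<le> s + (D - t)" by (rule min) (use st q eq in auto)
    then show ?thesis by simp
  qed
  from main[OF m st eq] main[OF m(2,1) st(2,1) eq[symmetric]] show ?thesis by simp
qed

text \<open>Minimal curves can meet only at equal parameters, so all crossings are recorded by the
  coincidence set \<open>Z\<close>. Between the two points of \<open>Z\<close> adjacent to
  \<open>t0\<close> the curves bound a bigon of minimizing arcs, which \<open>not_minimal\<close>
  excludes.\<close>

theorem minimal_qcurve_unique_complex:
  fixes \<Omega> :: "complex set"
  assumes \<Omega>: "open \<Omega>" "frontier \<Omega> \<noteq> {}"
    and m: "minimal_qcurve \<Omega> x y D \<kappa>" "minimal_qcurve \<Omega> x y D \<mu>"
    and D: "D < pi \<or> simply_connected \<Omega>" and t0: "t0 \<in> {0..D}"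
  shows "\<mu> t0 = \<kappa> t0"
proof (rule ccontr)
  assume ne: "\<mu> t0 \<noteq> \<kappa> t0"
  have q: "qcurve \<Omega> D \<kappa>" "qcurve \<Omega> D \<mu>" and ends: "\<kappa> 0 = \<mu> 0" "\<kappa> D = \<mu> D"
    using m by (auto simp: minimal_qcurve_def)
  have D0: "D \<ge> 0" by (rule qcurve_nonneg[OF q(1)])
  have "closed ({0..D} \<inter> (\<lambda>t. \<kappa> t - \<mu> t) -` {0})"
    by (intro continuous_closed_preimage continuous_on_diff qcurve_continuous_on[OF q(1)]
        qcurve_continuous_on[OF q(2)]) auto
  moreover define Z where "Z = {0..D} \<inter> (\<lambda>t. \<kappa> t - \<mu> t) -` {0}"
  ultimately have Z: "closed Z" by simp
  have Z_iff: "t \<in> Z \<longleftrightarrow> t \<in> {0..D} \<and> \<kappa> t = \<mu> t" for t by (auto simp: Z_def)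
  have Z_ends: "0 \<in> Z" "D \<in> Z" using D0 ends by (auto simp: Z_iff)
  \<comment> \<open>\<open>\<alpha>\<close> and then \<open>\<beta>\<close> are the coincidences
    next to \<open>t0\<close> on either side; they exist because \<open>Z\<close> is closed and
    contains both ends.\<close>
  obtain \<alpha> where \<alpha>: "\<alpha> \<in> Z" "\<alpha> \<le> t0" "\<And>t. t \<in> Z \<Longrightarrow> t \<le> t0 \<Longrightarrow> t \<le> \<alpha>"
  proof -
    define S where "S = Z \<inter> {0..t0}"
    have "compact S" unfolding S_def by (intro closed_Int_compact Z compact_Icc)
    moreover have "0 \<in> S" using Z_ends t0 by (simp add: S_def)
    then have "S \<noteq> {}" by blast
    ultimately have "\<exists>s\<in>S. \<forall>t\<in>S. t \<le> s" by (rule compact_attains_sup)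
    then obtain s where s: "s \<in> S" "\<forall>t\<in>S. t \<le> s" by blast
    have "t \<in> S" if "t \<in> Z" "t \<le> t0" for t using that by (simp add: S_def Z_iff)
    with s show thesis using that[of s] by (simp add: S_def)
  qed
  obtain \<beta> where \<beta>: "\<beta> \<in> Z" "t0 \<le> \<beta>" "\<And>t. t \<in> Z \<Longrightarrow> t0 \<le> t \<Longrightarrow> \<beta> \<le> t"
  proof -
    define S where "S = Z \<inter> {t0..D}"
    have "compact S" unfolding S_def by (intro closed_Int_compact Z compact_Icc)
    moreover have "D \<in> S" using Z_ends t0 by (simp add: S_def)
    then have "S \<noteq> {}" by blast
    ultimately have "\<exists>s\<in>S. \<forall>t\<in>S. s \<le> t" by (rule compact_attains_inf)
    then obtain s where s: "s \<in> S" "\<forall>t\<in>S. s \<le> t" by blast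
    have "t \<in> S" if "t \<in> Z" "t0 \<le> t" for t using that by (simp add: S_def Z_iff)
    with s show thesis using that[of s] by (simp add: S_def)
  qed
  have "t0 \<notin> Z" using ne by (auto simp: Z_iff)
  then have "\<alpha> \<noteq> t0" using \<alpha>(1) by auto
  then have ab: "\<alpha> < \<beta>" using \<alpha>(2) \<beta>(2) by linarith
  define l where "l = \<beta> - \<alpha>"
  define \<gamma> \<eta> where "\<gamma> s = \<kappa> (\<alpha> + s)" and "\<eta> s = \<mu> (\<alpha> + s)" for s
  have l: "l > 0" using ab by (simp add: l_def)
  have in_D: "\<alpha> + s \<in> {0..D}" if "s \<in> {0..l}" for s
    using that \<alpha>(1) \<beta>(1) by (auto simp: Z_iff l_def)
  have q\<gamma>: "qcurve \<Omega> l \<gamma>" and q\<eta>: "qcurve \<Omega> l \<eta>" unfolding \<gamma>_def \<eta>_def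
    using l in_D by (auto intro!: qcurve_reparam[OF q(1)] qcurve_reparam[OF q(2)])
  have start: "\<gamma> 0 = \<eta> 0" and finish: "\<gamma> l = \<eta> l"
    using \<alpha>(1) \<beta>(1) by (auto simp: \<gamma>_def \<eta>_def l_def Z_iff)
  have inj: "inj_on \<gamma> {0..l}" "inj_on \<eta> {0..l}"
  proof -
    show "inj_on \<gamma> {0..l}"
    proof (rule inj_onI)
      fix s t assume "s \<in> {0..l}" "t \<in> {0..l}" "\<gamma> s = \<gamma> t"
      then show "s = t" using minimal_qcurves_cross[OF m(1) m(1) in_D in_D, of s t] by (simp add: \<gamma>_def)
    qed
    show "inj_on \<eta> {0..l}"
    proof (rule inj_onI)
      fix s t assume "s \<in> {0..l}" "t \<in> {0..l}" "\<eta> s = \<eta> t"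
      then show "s = t" using minimal_qcurves_cross[OF m(2) m(2) in_D in_D, of s t] by (simp add: \<eta>_def)
    qed
  qed
  have meet: "\<gamma> ` {0..l} \<inter> \<eta> ` {0..l} \<subseteq> {\<gamma> 0, \<gamma> l}"
  proof
    fix z assume "z \<in> \<gamma> ` {0..l} \<inter> \<eta> ` {0..l}"
    then obtain s t where st: "s \<in> {0..l}" "t \<in> {0..l}" "z = \<gamma> s" "z = \<eta> t" by auto
    then have "\<alpha> + s = \<alpha> + t"
      using minimal_qcurves_cross[OF m in_D[OF st(1)] in_D[OF st(2)]] by (simp add: \<gamma>_def \<eta>_def)
    then have "\<alpha> + s \<in> Z" using st in_D[OF st(1)] by (auto simp: Z_iff \<gamma>_def \<eta>_def)
    then have "\<alpha> + s \<le> \<alpha> \<or> \<beta> \<le> \<alpha> + s" using \<alpha>(3) \<beta>(3) by (meson linear)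
    then have "s = 0 \<or> s = l" using st(1) by (auto simp: l_def)
    with st(3) show "z \<in> {\<gamma> 0, \<gamma> l}" by auto
  qed
  define g h where "g t = \<gamma> (l * t)" and "h t = \<eta> (l * t)" for t
  have lt: "l * t \<in> {0..l}" if "t \<in> {0..1}" for t using that l by (auto simp: mult_left_le)
  have img: "(\<lambda>t. l * t) ` {0..1} = {0..l}"
    using l by (simp add: image_mult_atLeastAtMost)
  have path: "path (\<lambda>t. \<nu> (l * t))" if "qcurve \<Omega> l \<nu>" for \<nu>
    unfolding path_def
  proof (rule continuous_on_compose2[OF qcurve_continuous_on[OF that]])
    show "continuous_on {0..1} (\<lambda>t. l * t)" by (intro continuous_intros)
    show "(\<lambda>t. l * t) ` {0..1} \<subseteq> {0..l}" by (simp only: img order_refl)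
  qed
  have "path g" "path h" unfolding g_def[abs_def] h_def[abs_def] by (rule path[OF q\<gamma>] path[OF q\<eta>])+
  moreover have "inj_on g {0..1}"
  proof (rule inj_onI)
    fix s t :: real assume "s \<in> {0..1}" "t \<in> {0..1}" "g s = g t"
    with inj_onD[OF inj(1), of "l * s" "l * t"] lt l show "s = t" by (simp add: g_def)
  qed
  moreover have "inj_on h {0..1}"
  proof (rule inj_onI)
    fix s t :: real assume "s \<in> {0..1}" "t \<in> {0..1}" "h s = h t"
    with inj_onD[OF inj(2), of "l * s" "l * t"] lt l show "s = t" by (simp add: h_def)
  qed
  ultimately have "arc g" "arc h" by (simp_all add: arc_def)
  then have arc: "arc g" "arc (reversepath h)" by (simp_all add: arc_reversepath)
  have pimg: "path_image g = \<gamma> ` {0..l}" "path_image h = \<eta> ` {0..l}"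
    unfolding path_image_def g_def[abs_def] h_def[abs_def] img[symmetric] image_image by (rule refl)+
  define j where "j = g +++ reversepath h"
  have gh: "pathfinish g = pathstart (reversepath h)" "pathfinish (reversepath h) = pathstart g"
    using start finish by (auto simp: g_def h_def pathstart_def pathfinish_def reversepath_def)
  have "path_image g \<inter> path_image (reversepath h) \<subseteq> {pathstart g, pathstart (reversepath h)}"
    using meet finish unfolding path_image_reversepath pimg
    by (simp add: pathstart_def reversepath_def g_def h_def)
  then have j: "simple_path j" unfolding j_def using gh by (intro simple_path_join_loop arc)
  have j': "pathfinish j = pathstart j" unfolding j_def using gh by simp
  have j_im: "path_image j = \<gamma> ` {0..l} \<union> \<eta> ` {0..l}"
    unfolding j_def using gh by (simp add: path_image_join pimg)
  have j\<Omega>: "path_image j \<subseteq> \<Omega>" using j_im qcurve_mem[OF q\<gamma>] qcurve_mem[OF q\<eta>] by auto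
  \<comment> \<open>Simple connectivity gives this directly; otherwise a point of the interior
    outside \<open>\<Omega>\<close> has winding number of modulus 1 and forces
    \<open>pi \<le> l\<close>, against \<open>l \<le> D < pi\<close>.\<close>
  have "inside (path_image j) \<subseteq> \<Omega>"
  proof (cases "simply_connected \<Omega>")
    case True
    then show ?thesis by (rule subset_simply_connected_imp_inside_subset[OF _ \<Omega>(1) j\<Omega>])
  next
    case False
    with D have Dpi: "D < pi" by simp
    show ?thesis
    proof (rule ccontr)
      assume "\<not> ?thesis"
      then obtain p where p: "p \<in> inside (path_image j)" "p \<notin> \<Omega>" by blast
      have "norm (winding_number j p) = 1"
      proof (rule simple_closed_path_winding_number_inside[OF j])
      qed (use p(1) in auto)
      moreover have "p \<notin> path_image j" using p(1) inside_no_overlap by blast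
      moreover have "j = (\<lambda>t. \<gamma> (l * t)) +++ reversepath (\<lambda>t. \<eta> (l * t))"
        unfolding j_def g_def[abs_def] h_def[abs_def] ..
      ultimately have "pi \<le> l"
        using simple_path_imp_path[OF j] by (intro two_pi_le_winding_lengths[OF q\<gamma> q\<eta> l finish p(2)])
      moreover have "l \<le> D" using \<alpha>(1) \<beta>(1) by (auto simp: l_def Z_iff)
      ultimately show False using Dpi by simp
    qed
  qed
  with j\<Omega> have "path_image j \<union> inside (path_image j) \<subseteq> \<Omega>" by simp
  then interpret qcurve_bigon \<Omega> \<gamma> \<eta> l j
    using \<Omega> l q\<gamma> q\<eta> start meet j j' j_im by unfold_locales simp_all
  show False
  proof (rule not_minimal)
    fix s t V \<nu> assume *: "s \<in> {0..l}" "t \<in> {0..l}" "qcurve \<Omega> V \<nu>"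
    show "\<bar>s - t\<bar> \<le> V" if "\<nu> 0 = \<gamma> s" "\<nu> V = \<gamma> t"
      using minimal_qcurve_segment[OF m(1) in_D[OF *(1)] in_D[OF *(2)] *(3)] that by (simp add: \<gamma>_def)
    show "\<bar>s - t\<bar> \<le> V" if "\<nu> 0 = \<eta> s" "\<nu> V = \<eta> t"
      using minimal_qcurve_segment[OF m(2) in_D[OF *(1)] in_D[OF *(2)] *(3)] that by (simp add: \<eta>_def)
  qed
qed

section \<open>Transfer from \<open>real ^ 2\<close> to the complex plane\<close>

definition vec2_complex :: "real ^ 2 \<Rightarrow> complex" where
  "vec2_complex v = Complex (v $ 1) (v $ 2)"

lemma linear_vec2_complex: "linear vec2_complex"
  by (rule linearI) (auto simp: vec2_complex_def complex_eq_iff)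

lemma dist_vec2_complex [simp]: "dist (vec2_complex u) (vec2_complex v) = dist u v"
proof -
  have "norm (vec2_complex w) = norm w" for w
    by (simp add: vec2_complex_def cmod_def norm_vec_def L2_set_def sum_2)
  then show ?thesis by (simp add: dist_norm linear_diff[OF linear_vec2_complex, symmetric])
qed

lemma bij_vec2_complex: "bij vec2_complex"
proof (rule bijI)
  show "inj vec2_complex" by (rule injI) (metis dist_eq_0_iff dist_vec2_complex)
  show "surj vec2_complex"
  proof (rule surjI)
    fix z show "vec2_complex (vector [Re z, Im z]) = z" by (simp add: vec2_complex_def)
  qed
qed

lemma frontier_vec2_complex: "frontier (vec2_complex ` S) = vec2_complex ` frontier S"
proof -
  have "frontier (vec2_complex ` S) = vec2_complex ` closure S - vec2_complex ` interior S"
    unfolding frontier_def using bij_vec2_complex linear_vec2_complex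
    by (simp add: closure_injective_linear_image bij_is_inj interior_bijective_linear_image)
  also have "\<dots> = vec2_complex ` frontier S"
    unfolding frontier_def using bij_vec2_complex by (simp add: image_set_diff bij_is_inj)
  finally show ?thesis .
qed

lemma bdist_vec2_complex [simp]: "bdist (vec2_complex ` \<Omega>) (vec2_complex z) = bdist \<Omega> z"
  by (simp add: frontier_vec2_complex infdist_def image_image)

lemma qcurve_vec2_complex:
  "qcurve (vec2_complex ` \<Omega>) V (\<lambda>t. vec2_complex (\<kappa> t)) \<longleftrightarrow> qcurve \<Omega> V \<kappa>"
  using bij_vec2_complex by (simp add: qcurve_def inj_image_mem_iff bij_is_inj)

lemma minimal_qcurve_vec2_complex:
  assumes "minimal_qcurve \<Omega> x y D \<kappa>"
  shows "minimal_qcurve (vec2_complex ` \<Omega>) (vec2_complex x) (vec2_complex y) D (\<lambda>t. vec2_complex (\<kappa> t))"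
  unfolding minimal_qcurve_def
proof (intro conjI allI impI)
  show "qcurve (vec2_complex ` \<Omega>) D (\<lambda>t. vec2_complex (\<kappa> t))" "vec2_complex (\<kappa> 0) = vec2_complex x"
    "vec2_complex (\<kappa> D) = vec2_complex y"
    using assms by (auto simp: minimal_qcurve_def qcurve_vec2_complex)
  fix V \<mu> assume \<mu>: "qcurve (vec2_complex ` \<Omega>) V \<mu>" "\<mu> 0 = vec2_complex x" "\<mu> V = vec2_complex y"
  define \<nu> where "\<nu> t = inv vec2_complex (\<mu> t)" for t
  have "\<mu> = (\<lambda>t. vec2_complex (\<nu> t))"
    using bij_vec2_complex by (auto simp: \<nu>_def surj_f_inv_f bij_is_surj)
  moreover have "\<nu> 0 = x" "\<nu> V = y" using \<mu> bij_vec2_complex by (auto simp: \<nu>_def inv_f_f bij_is_inj)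
  ultimately show "D \<le> V" using \<mu>(1) assms by (auto simp: minimal_qcurve_def qcurve_vec2_complex)
qed

lemma open_vec2_complex: "open S \<Longrightarrow> open (vec2_complex ` S)"
  using open_surjective_linear_image[OF _ linear_vec2_complex] bij_vec2_complex by (simp add: bij_is_surj)

lemma simply_connected_vec2_complex: "simply_connected S \<Longrightarrow> simply_connected (vec2_complex ` S)"
  using homeomorphic_simply_connected linear_homeomorphic_image[OF linear_vec2_complex, of S]
    bij_vec2_complex bij_is_inj by blast

theorem theorem1p2:
  fixes \<Omega> :: "(real ^ 2) set"
  assumes "open \<Omega>" and "connected \<Omega>" and "\<Omega> \<noteq> {}" and "\<Omega> \<noteq> UNIV"
  shows "(\<forall>x\<in>\<Omega>. \<forall>y\<in>\<Omega>. qh_dist \<Omega> x y < pi \<longrightarrow> unique_qh_geodesic \<Omega> x y) \<and>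
         (simply_connected \<Omega> \<longrightarrow> (\<forall>x\<in>\<Omega>. \<forall>y\<in>\<Omega>. unique_qh_geodesic \<Omega> x y))"
proof -
  have fr: "frontier \<Omega> \<noteq> {}" using assms(3,4) by (simp add: frontier_eq_empty)
  have main: "unique_qh_geodesic \<Omega> x y"
    if xy: "x \<in> \<Omega>" "y \<in> \<Omega>" and D: "qh_dist \<Omega> x y < pi \<or> simply_connected \<Omega>" for x y
  proof -
    \<comment> \<open>Existence and the identification of \<open>D\<close> with
      \<open>qh_dist\<close> are obtained in \<open>real ^ 2\<close> itself; only the uniqueness of
      minimal curves comes from the complex plane.\<close>
    obtain D \<kappa> where \<kappa>: "minimal_qcurve \<Omega> x y D \<kappa>"
      using minimal_qcurve_exists[OF assms(1) fr assms(2) xy] by blast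
    have D': "D < pi \<or> simply_connected (vec2_complex ` \<Omega>)"
      using D minimal_qcurve_qh_dist(1)[OF assms(1) fr \<kappa>] simply_connected_vec2_complex by auto
    have fr': "frontier (vec2_complex ` \<Omega>) \<noteq> {}" using fr by (simp add: frontier_vec2_complex)
    show ?thesis
    proof (rule unique_qh_geodesicI[OF assms(1) fr \<kappa>])
      fix \<mu> t assume \<mu>: "minimal_qcurve \<Omega> x y D \<mu>" and t: "t \<in> {0..D}"
      have "vec2_complex (\<mu> t) = vec2_complex (\<kappa> t)"
        by (rule minimal_qcurve_unique_complex[OF open_vec2_complex[OF assms(1)] fr'
          minimal_qcurve_vec2_complex[OF \<kappa>] minimal_qcurve_vec2_complex[OF \<mu>] D' t])
      then show "\<mu> t = \<kappa> t" using bij_vec2_complex by (simp add: inj_eq bij_is_inj)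
    qed
  qed
  then show ?thesis by blast
qed

end
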